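(* Let $X_0$ be a set of $n$ Boolean variables and let $\mathrm{OR}_{X_0}$ be the OR function on these variables. Then every $\frac{1}{8}$-error probabilistic polynomial over the reals for $\mathrm{OR}_{X_0}$ has degree at least $\frac{\sqrt{\log n}}{(\log\log n)^2}$.
   Context: A $\frac18$-error probabilistic polynomial for $f:\{0,1\}^n\to\{0,1\}$ is a random polynomial $\mathbf{P}\in\mathbb{R}[x_1,\ldots,x_n]$ such that for every $a\in\{0,1\}^n$, $\Pr_{\mathbf{P}}[\mathbf{P}(a)\neq f(a)]\leq\frac18$; its degree is the maximum degree of a polynomial in its support.
   Formalization: Proved for n ≥ 4 with log to base 2: for n ≤ 2 the bound is undefined, and for n = 3 it is about 2.85 although OR on three variables has a 1/8-error probabilistic polynomial of degree 2. *)

theory Defs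
  imports "HOL-Probability.Probability" "HOL-Library.Poly_Mapping" "HOL-Library.Extended_Nat"
begin

(* A monomial is a finitely supported exponent vector, a polynomial a finitely supported
   family of real coefficients indexed by monomials. *)
type_synonym 'v real_mpoly = "('v \<Rightarrow>\<^sub>0 nat) \<Rightarrow>\<^sub>0 real"

definition mpoly_vars :: "'v real_mpoly \<Rightarrow> 'v set" where
  "mpoly_vars p = (\<Union>m\<in>Poly_Mapping.keys p. Poly_Mapping.keys m)"

definition mpoly_eval :: "'v real_mpoly \<Rightarrow> ('v \<Rightarrow> real) \<Rightarrow> real" where
  "mpoly_eval p a =
     (\<Sum>m\<in>Poly_Mapping.keys p. Poly_Mapping.lookup p m *
        (\<Prod>v\<in>Poly_Mapping.keys m. a v ^ Poly_Mapping.lookup m v))"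

(* Total degree. The zero polynomial gets degree 0.
   (The constant Poly_Mapping.degree is for univariate polynomials.) *)
definition mpoly_degree :: "'v real_mpoly \<Rightarrow> nat" where
  "mpoly_degree p =
     Max (insert 0 ((\<lambda>m. \<Sum>v\<in>Poly_Mapping.keys m. Poly_Mapping.lookup m v) ` Poly_Mapping.keys p))"

(* The cube {0,1}^X, with False for 0 and True for 1. *)
definition bool_cube :: "'v set \<Rightarrow> ('v \<Rightarrow> bool) set" where
  "bool_cube X = X \<rightarrow>\<^sub>E UNIV"

definition OR_fun :: "'v set \<Rightarrow> ('v \<Rightarrow> bool) \<Rightarrow> bool" where
  "OR_fun X a \<longleftrightarrow> (\<exists>x\<in>X. a x)"

(* The random polynomial is a (discrete) probability distribution on real polynomials
   in the variables X; its support may be infinite. *)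
definition probabilistic_polynomial ::
    "real \<Rightarrow> 'v set \<Rightarrow> (('v \<Rightarrow> bool) \<Rightarrow> bool) \<Rightarrow> 'v real_mpoly pmf \<Rightarrow> bool" where
  "probabilistic_polynomial \<epsilon> X f P \<longleftrightarrow>
     (\<forall>p\<in>set_pmf P. mpoly_vars p \<subseteq> X) \<and>
     (\<forall>a\<in>bool_cube X.
        measure_pmf.prob P {p. mpoly_eval p (\<lambda>v. of_bool (a v)) \<noteq> of_bool (f a)} \<le> \<epsilon>)"

(* The maximum degree over the support; it is infinite if the degrees are unbounded there. *)
definition prob_poly_degree :: "'v real_mpoly pmf \<Rightarrow> enat" where
  "prob_poly_degree P = (SUP p\<in>set_pmf P. enat (mpoly_degree p))"

end

theory Submission
  imports Defs "HOL-Library.Disjoint_Sets"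
begin

text \<open>
  Multiplying \<open>t\<close> independent copies of \<open>p - 1\<close> gives a random polynomial \<open>q\<close> of degree \<open>D = d t\<close>.
  Conditioned on being nonzero at the origin, it vanishes at any other given input except with probability
  exponentially small in \<open>t\<close>. Test \<open>q\<close> on uniformly random points of the subcubes obtained by
  repeatedly setting all but a random \<open>\<rho>\<close>-fraction of the variables to zero. If at some stage the
  monomials of top degree contain many disjoint ones, then \<open>q \<noteq> 0\<close> with constant probability, which is
  too often. Otherwise a small set of variables hits all of them, and the next restriction most likely
  kills that set and lowers the degree. After at most \<open>D\<close> stages \<open>q\<close> is a nonzero constant. With
  \<open>1 / \<rho> = D^{O(D)}\<close> this needs only \<open>log n\<close> of order \<open>D^2 log D\<close>.

  The anticoncentration statement for many disjoint top monomials is proved by fixing influential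
  variables at random. Each round succeeds with probability \<open>9^{-O(D)}\<close>: either the conditional mean dominates, or all
  influences become small. In the latter case Lindeberg's method allows replacing each sign by a
  unit combination \<open>\<Sum> u_i X_i\<close> of \<open>m + 1\<close> signs, \<open>m = 16 D^2\<close>, for any \<open>u\<close> on the sphere. Averaged
  over \<open>u\<close> with random coordinates \<open>\<plusminus> 1 / sqrt m\<close>, the squared value concentrates, because two such
  vectors are nearly orthogonal. So \<open>q\<close> is not small at one of these \<open>u\<close>, and a Remez inequality in
  only \<open>m\<close> dimensions spreads this to most of the sphere at a cost of \<open>D^{O(D)}\<close>.
\<close>

section \<open>Expectations over random subsets and multilinear forms\<close>

text \<open>The stage at which a given q is detected depends on q, which is itself random, whereas
  the test distribution has to be fixed beforehand. So the estimate for fixed q is summed over all D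
  + 1 stages and only then averaged over q. This costs a factor D + 1, which amplification must
  repay: q is nonzero at the origin with probability at least (7/8)^t and errs elsewhere with
  probability at most (1/8)^t, so 7^t has to beat D by a constant factor, and t of order log log n
  does it. Then D = d t is of order sqrt(log n) / log log n, which leaves a factor of order log log
  n to spare in the requirement on log n; this room absorbs all constants.

  Within one stage, second moments of forms of degree k yield success only with probability of order
  9^{-k}. A top monomial that avoids the fixed variables keeps its coefficient, whatever signs they
  get. Hence a failed round can be followed by another one, about 9^k times. This is why many
  disjoint top monomials are required instead of a single one.\<close>

definition expect :: "real \<Rightarrow> 'a set \<Rightarrow> ('a set \<Rightarrow> real) \<Rightarrow> real" where
  "expect p X f = (\<Sum>A\<in>Pow X. p ^ card A * (1 - p) ^ card (X - A) * f A)"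

lemma expect_empty [simp]: "expect p {} f = f {}"
  by (simp add: expect_def)

lemma expect_insert:
  assumes "finite X" "x \<notin> X"
  shows "expect p (insert x X) f = p * expect p X (\<lambda>A. f (insert x A)) + (1 - p) * expect p X f"
proof -
  have d: "Pow X \<inter> insert x ` Pow X = {}" using assms(2) by auto
  have inj: "inj_on (insert x) (Pow X)" using assms(2) by (auto simp: inj_on_def)
  have c1: "card (insert x A) = Suc (card A)" "X - insert x A = X - A"
           "card (insert x X - A) = Suc (card (X - A))" if "A \<in> Pow X" for A
  proof -
    have A: "A \<subseteq> X" "finite A" "x \<notin> A" using that assms finite_subset by auto
    then show "card (insert x A) = Suc (card A)" by simp
    show "X - insert x A = X - A" using assms(2) by auto
    have "insert x X - A = insert x (X - A)" using A by auto
    then show "card (insert x X - A) = Suc (card (X - A))" using assms by simp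
  qed
  have "expect p (insert x X) f =
      (\<Sum>A\<in>Pow X. p ^ card A * (1 - p) ^ card (insert x X - A) * f A) +
      (\<Sum>A\<in>insert x ` Pow X. p ^ card A * (1 - p) ^ card (insert x X - A) * f A)"
    unfolding expect_def Pow_insert using assms(1) d by (intro sum.union_disjoint) auto
  also have "(\<Sum>A\<in>insert x ` Pow X. p ^ card A * (1 - p) ^ card (insert x X - A) * f A) =
      p * expect p X (\<lambda>A. f (insert x A))"
    unfolding sum.reindex[OF inj] o_def expect_def sum_distrib_left
    by (intro sum.cong refl) (simp add: c1)
  also have "(\<Sum>A\<in>Pow X. p ^ card A * (1 - p) ^ card (insert x X - A) * f A) =
      (1 - p) * expect p X f"
    unfolding expect_def sum_distrib_left
    by (intro sum.cong refl) (simp add: c1)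
  finally show ?thesis by simp
qed

lemma expect_cong:
  "(\<And>A. A \<subseteq> X \<Longrightarrow> f A = g A) \<Longrightarrow> expect p X f = expect p X g"
  unfolding expect_def by (intro sum.cong) auto

lemma expect_add: "expect p X (\<lambda>A. f A + g A) = expect p X f + expect p X g"
  by (simp add: expect_def sum.distrib algebra_simps)

lemma expect_diff: "expect p X (\<lambda>A. f A - g A) = expect p X f - expect p X g"
  by (simp add: expect_def sum_subtractf algebra_simps)

lemma expect_cmult: "expect p X (\<lambda>A. c * f A) = c * expect p X f"
  unfolding expect_def sum_distrib_left by (intro sum.cong refl) simp

lemma expect_cmult_right: "expect p X (\<lambda>A. f A * c) = expect p X f * c"
  unfolding expect_def sum_distrib_right by (intro sum.cong refl) simp

lemma expect_sum: "expect p X (\<lambda>A. \<Sum>i\<in>I. f i A) = (\<Sum>i\<in>I. expect p X (f i))"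
  unfolding expect_def sum_distrib_left by (rule sum.swap)

lemma expect_const: "finite X \<Longrightarrow> expect p X (\<lambda>A. c) = c"
  by (induction X rule: finite_induct) (simp_all add: expect_insert algebra_simps)

lemma expect_mono:
  assumes "0 \<le> p" "p \<le> 1" "\<And>A. A \<subseteq> X \<Longrightarrow> f A \<le> g A"
  shows "expect p X f \<le> expect p X g"
  unfolding expect_def using assms by (intro sum_mono mult_left_mono) auto

lemma expect_nonneg:
  assumes "0 \<le> p" "p \<le> 1" "\<And>A. A \<subseteq> X \<Longrightarrow> 0 \<le> f A"
  shows "0 \<le> expect p X f"
  unfolding expect_def using assms by (intro sum_nonneg mult_nonneg_nonneg) auto

lemma expect_abs:
  assumes "0 \<le> p" "p \<le> 1"
  shows "\<bar>expect p X f\<bar> \<le> expect p X (\<lambda>A. \<bar>f A\<bar>)"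
proof -
  have "expect p X f \<le> expect p X (\<lambda>A. \<bar>f A\<bar>)" using assms by (intro expect_mono) auto
  moreover have "expect p X (\<lambda>A. - f A) \<le> expect p X (\<lambda>A. \<bar>f A\<bar>)"
    using assms by (intro expect_mono) auto
  moreover have "expect p X (\<lambda>A. - f A) = - expect p X f"
    using expect_cmult[of p X "-1" f] by simp
  ultimately show ?thesis by linarith
qed

lemma expect_union:
  assumes "finite X" "finite Y" "X \<inter> Y = {}"
  shows "expect p (X \<union> Y) f = expect p X (\<lambda>A. expect p Y (\<lambda>B. f (A \<union> B)))"
  using assms(1,3)
proof (induction X arbitrary: f rule: finite_induct)
  case (insert x X)
  have "x \<notin> X \<union> Y" "finite (X \<union> Y)" using insert assms by auto
  then show ?case using insert by (simp add: expect_insert)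
qed simp

text \<open>Independent thinning: a point survives both selections with probability
  \<open>r * p\<close>. This collapses nested zero restrictions into one random set of density
  \<rho>^j / 2.\<close>

lemma expect_expect:
  assumes "finite X"
  shows "expect r X (\<lambda>A. expect p A f) = expect (r * p) X f"
  using assms
proof (induction X arbitrary: f rule: finite_induct)
  case (insert x X)
  have "expect r X (\<lambda>A. expect p (insert x A) f) =
      expect r X (\<lambda>A. p * expect p A (\<lambda>B. f (insert x B)) + (1 - p) * expect p A f)"
  proof (rule expect_cong)
    fix A assume "A \<subseteq> X"
    then have "finite A" "x \<notin> A" using insert.hyps finite_subset by auto
    then show "expect p (insert x A) f = p * expect p A (\<lambda>B. f (insert x B)) + (1 - p) * expect p A f"
      by (rule expect_insert)
  qed
  then have "expect r (insert x X) (\<lambda>A. expect p A f) =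
      r * (p * expect r X (\<lambda>A. expect p A (\<lambda>B. f (insert x B))) + (1 - p) * expect r X (\<lambda>A. expect p A f))
      + (1 - r) * expect r X (\<lambda>A. expect p A f)"
    unfolding expect_insert[OF insert.hyps] by (simp only: expect_add expect_cmult)
  also have "\<dots> = expect (r * p) (insert x X) f"
    using insert.hyps by (simp add: expect_insert insert.IH algebra_simps)
  finally show ?case .
qed simp

lemma expect_image:
  assumes "finite X" "inj_on h X"
  shows "expect p (h ` X) f = expect p X (\<lambda>A. f (h ` A))"
  using assms
proof (induction X arbitrary: f rule: finite_induct)
  case (insert x X)
  have "h x \<notin> h ` X" using insert by auto
  then show ?case using insert by (simp add: expect_insert)
qed simp

lemma expect_disjoint:
  assumes "finite X" "H \<subseteq> X"
  shows "expect r X (\<lambda>A. of_bool (A \<inter> H = {})) = (1 - r) ^ card H"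
proof -
  have H: "finite H" using assms finite_subset by auto
  have "expect r H (\<lambda>A. of_bool (A \<inter> H = {})) = (1 - r) ^ card H"
  proof -
    have "expect r H (\<lambda>A. of_bool (A \<inter> H = {})) =
       (\<Sum>A\<in>Pow H. if A = {} then (1 - r) ^ card H else 0)"
      unfolding expect_def by (intro sum.cong) auto
    then show ?thesis using H by simp
  qed
  moreover have "expect r (H \<union> (X - H)) (\<lambda>A. of_bool (A \<inter> H = {})) =
     expect r H (\<lambda>A. expect r (X - H) (\<lambda>B. of_bool ((A \<union> B) \<inter> H = {})))"
    using assms H by (intro expect_union) auto
  moreover have "\<dots> = expect r H (\<lambda>A. expect r (X - H) (\<lambda>B. of_bool (A \<inter> H = {})))"
    by (intro expect_cong arg_cong[where f = of_bool]) auto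
  moreover have "H \<union> (X - H) = X" using assms by auto
  ultimately show ?thesis using assms by (simp add: expect_const)
qed

text \<open>The Paley-Zygmund inequality. It is applied with \<open>K\<close> = 6 for averages over
  sphere points and with \<open>K\<close> = 9^k for squares of forms of degree k.\<close>

lemma second_moment_lower_bound:
  assumes p: "0 \<le> p" "p \<le> 1" and X: "finite X"
    and nn: "\<And>A. A \<subseteq> X \<Longrightarrow> 0 \<le> Y A"
    and m: "expect p X Y = \<mu>" "0 < \<mu>" "expect p X (\<lambda>A. (Y A)\<^sup>2) \<le> K * \<mu>\<^sup>2" "0 < K"
    and th: "0 \<le> \<theta>" "\<theta> \<le> 1"
  shows "(1 - \<theta>)\<^sup>2 / K \<le> expect p X (\<lambda>A. of_bool (\<theta> * \<mu> \<le> Y A))"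
proof -
  define P where "P = expect p X (\<lambda>A. of_bool (\<theta> * \<mu> \<le> Y A))"
  define a where "a = (1 - \<theta>) / (K * \<mu>)"
  text \<open>Pointwise \<open>2 a Y - a\<^sup>2 Y\<^sup>2 \<le> [Y \<ge> \<theta> \<mu>] + 2 a \<theta> \<mu> [Y < \<theta> \<mu>]\<close>; the value of \<open>a\<close> is optimal.\<close>
  have a0: "0 \<le> a" using m th by (simp add: a_def)
  have "expect p X (\<lambda>A. 2 * a * Y A - a\<^sup>2 * (Y A)\<^sup>2) \<le>
     expect p X (\<lambda>A. of_bool (\<theta> * \<mu> \<le> Y A) + 2 * a * \<theta> * \<mu>)"
  proof (rule expect_mono[OF p])
    fix A assume A: "A \<subseteq> X"
    have s: "2 * a * Y A - a\<^sup>2 * (Y A)\<^sup>2 \<le> 1"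
      using zero_le_power2[of "a * Y A - 1"] by (simp add: power2_eq_square algebra_simps)
    show "2 * a * Y A - a\<^sup>2 * (Y A)\<^sup>2 \<le> of_bool (\<theta> * \<mu> \<le> Y A) + 2 * a * \<theta> * \<mu>"
    proof (cases "\<theta> * \<mu> \<le> Y A")
      case True
      have "0 \<le> 2 * a * \<theta> * \<mu>" using a0 m(2) th(1) by (intro mult_nonneg_nonneg) auto
      moreover have "of_bool (\<theta> * \<mu> \<le> Y A) = (1::real)" using True by simp
      ultimately show ?thesis using s by linarith
    next
      case False
      then have "2 * a * Y A \<le> 2 * a * (\<theta> * \<mu>)" using a0 by (intro mult_left_mono) auto
      moreover have "0 \<le> a\<^sup>2 * (Y A)\<^sup>2" by simp
      moreover have "2 * a * (\<theta> * \<mu>) = 2 * a * \<theta> * \<mu>" by simp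
      moreover have "of_bool (\<theta> * \<mu> \<le> Y A) = (0::real)" using False by simp
      ultimately show ?thesis by linarith
    qed
  qed
  then have "2 * a * \<mu> - a\<^sup>2 * expect p X (\<lambda>A. (Y A)\<^sup>2) \<le> P + 2 * a * \<theta> * \<mu>"
    using X by (simp add: expect_diff expect_add expect_cmult expect_const m P_def)
  moreover have "a\<^sup>2 * expect p X (\<lambda>A. (Y A)\<^sup>2) \<le> a\<^sup>2 * (K * \<mu>\<^sup>2)"
    using m by (intro mult_left_mono) auto
  moreover have "a\<^sup>2 * (K * \<mu>\<^sup>2) = (1 - \<theta>)\<^sup>2 / K" "2 * a * \<mu> - 2 * a * \<theta> * \<mu> = 2 * ((1 - \<theta>)\<^sup>2 / K)"
    using m by (simp_all add: a_def field_simps power2_eq_square)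
  ultimately show ?thesis by (simp add: P_def)
qed

lemma markov_bound:
  assumes p: "0 \<le> p" "p \<le> 1" and nn: "\<And>A. A \<subseteq> X \<Longrightarrow> 0 \<le> Y A" and "0 < a"
  shows "expect p X (\<lambda>A. of_bool (a \<le> Y A)) \<le> expect p X Y / a"
proof -
  have "expect p X (\<lambda>A. a * of_bool (a \<le> Y A)) \<le> expect p X Y"
    using nn by (intro expect_mono[OF p]) auto
  then show ?thesis using assms(4) by (simp add: expect_cmult field_simps)
qed

section \<open>Multilinear forms and weighted norms of their coefficients\<close>

definition mlin :: "'a set \<Rightarrow> ('a set \<Rightarrow> real) \<Rightarrow> ('a \<Rightarrow> real) \<Rightarrow> real" where
  "mlin V c x = (\<Sum>S\<in>Pow V. c S * (\<Prod>v\<in>S. x v))"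

text \<open>The squared norm of the form after its degree-j part has been multiplied by
  \<open>g\<close> to the power j/2, as by a noise operator. Bounds by products of such norms
  tensorise over the variables.\<close>

definition wnorm :: "real \<Rightarrow> 'a set \<Rightarrow> ('a set \<Rightarrow> real) \<Rightarrow> real" where
  "wnorm g V c = (\<Sum>S\<in>Pow V. g ^ card S * (c S)\<^sup>2)"

abbreviation norm2 :: "'a set \<Rightarrow> ('a set \<Rightarrow> real) \<Rightarrow> real" where
  "norm2 \<equiv> wnorm 1"

lemma norm2_def: "norm2 V c = (\<Sum>S\<in>Pow V. (c S)\<^sup>2)"
  by (simp add: wnorm_def)

definition deg_le :: "'a set \<Rightarrow> nat \<Rightarrow> ('a set \<Rightarrow> real) \<Rightarrow> bool" where
  "deg_le V k c \<longleftrightarrow> (\<forall>S. S \<subseteq> V \<longrightarrow> c S \<noteq> 0 \<longrightarrow> card S \<le> k)"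

definition sg :: "'a set \<Rightarrow> 'a \<Rightarrow> real" where
  "sg A v = (if v \<in> A then 1 else -1)"

lemma sum_Pow_insert:
  fixes f :: "'a set \<Rightarrow> real"
  assumes "finite X" "x \<notin> X"
  shows "(\<Sum>S\<in>Pow (insert x X). f S) = (\<Sum>S\<in>Pow X. f S) + (\<Sum>S\<in>Pow X. f (insert x S))"
proof -
  have d: "Pow X \<inter> insert x ` Pow X = {}" using assms(2) by auto
  have inj: "inj_on (insert x) (Pow X)" using assms(2) by (auto simp: inj_on_def)
  have "(\<Sum>S\<in>Pow (insert x X). f S) = (\<Sum>S\<in>Pow X. f S) + (\<Sum>S\<in>insert x ` Pow X. f S)"
    unfolding Pow_insert using assms(1) d by (intro sum.union_disjoint) auto
  then show ?thesis by (simp add: sum.reindex[OF inj])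
qed

lemma mlin_empty [simp]: "mlin {} c x = c {}" by (simp add: mlin_def)

lemma wnorm_empty [simp]: "wnorm g {} c = (c {})\<^sup>2" by (simp add: wnorm_def)

lemma mlin_insert:
  assumes "finite V" "v \<notin> V"
  shows "mlin (insert v V) c x = mlin V c x + x v * mlin V (\<lambda>S. c (insert v S)) x"
proof -
  have "(\<Prod>u\<in>insert v S. x u) = x v * (\<Prod>u\<in>S. x u)" if "S \<in> Pow V" for S
  proof -
    have "finite S" "v \<notin> S" using that assms finite_subset by auto
    then show ?thesis by simp
  qed
  then show ?thesis
    unfolding mlin_def sum_Pow_insert[OF assms] sum_distrib_left
    by (intro arg_cong2[where f = "(+)"] sum.cong) auto
qed

lemma wnorm_insert:
  assumes "finite V" "v \<notin> V"
  shows "wnorm g (insert v V) c = wnorm g V c + g * wnorm g V (\<lambda>S. c (insert v S))"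
proof -
  have "card (insert v S) = Suc (card S)" if "S \<in> Pow V" for S
  proof -
    have "finite S" "v \<notin> S" using that assms finite_subset by auto
    then show ?thesis by simp
  qed
  then show ?thesis
    unfolding wnorm_def sum_Pow_insert[OF assms] sum_distrib_left
    by (intro arg_cong2[where f = "(+)"] sum.cong) auto
qed

lemma wnorm_nonneg: "0 \<le> g \<Longrightarrow> 0 \<le> wnorm g V c"
  by (auto simp: wnorm_def intro!: sum_nonneg)

lemma wnorm_le:
  assumes "deg_le V k c" "1 \<le> g"
  shows "wnorm g V c \<le> g ^ k * norm2 V c"
  unfolding wnorm_def sum_distrib_left
proof (rule sum_mono)
  fix S assume S: "S \<in> Pow V"
  show "g ^ card S * (c S)\<^sup>2 \<le> g ^ k * (1 ^ card S * (c S)\<^sup>2)"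
  proof (cases "c S = 0")
    case False
    then have "card S \<le> k" using assms S by (auto simp: deg_le_def)
    then show ?thesis using assms(2) by (auto intro!: mult_right_mono power_increasing)
  qed simp
qed

lemma mlin_cong: "(\<And>v. v \<in> V \<Longrightarrow> x v = y v) \<Longrightarrow> mlin V c x = mlin V c y"
  unfolding mlin_def by (intro sum.cong arg_cong2[where f = "(*)"] prod.cong) auto

section \<open>Multilinear forms in sums of independent signs\<close>

text \<open>Every variable \<open>v\<close> owns a block of independent signs indexed by
  \<open>I\<close>; one random subset of \<open>V \<times> I\<close> encodes all of them. The
  weights may depend on \<open>v\<close>, so that the hybrids of Lindeberg's method have the same
  form.\<close>

definition zlin :: "'i set \<Rightarrow> ('v \<Rightarrow> 'i \<Rightarrow> real) \<Rightarrow> ('v \<times> 'i) set \<Rightarrow> 'v \<Rightarrow> real" where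
  "zlin I w A v = (\<Sum>i\<in>I. w v i * sg A (v, i))"

text \<open>Averaging over one more sign shifts both combinations simultaneously by plus or minus
  their weights. All joint moments below follow from this by induction on \<open>I\<close>.\<close>

lemma expect_column_insert:
  assumes "finite I" "i \<notin> I"
  shows "expect (1/2) ({v} \<times> insert i I) (\<lambda>B. h (zlin (insert i I) w B v) (zlin (insert i I) w' B v)) =
    expect (1/2) ({v} \<times> I) (\<lambda>B. (h (zlin I w B v + w v i) (zlin I w' B v + w' v i) +
                                h (zlin I w B v - w v i) (zlin I w' B v - w' v i)) / 2)"
proof -
  have eq: "{v} \<times> insert i I = insert (v, i) ({v} \<times> I)" by auto
  have fin: "finite ({v} \<times> I)" "(v, i) \<notin> {v} \<times> I" using assms by auto
  have z: "zlin (insert i I) w (insert (v, i) B) v = zlin I w B v + w v i"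
          "zlin (insert i I) w B v = zlin I w B v - w v i" if "B \<subseteq> {v} \<times> I" for B w
  proof -
    have "(v, i) \<notin> B" using that assms by auto
    moreover have "(\<Sum>j\<in>I. w v j * sg (insert (v, i) B) (v, j)) = (\<Sum>j\<in>I. w v j * sg B (v, j))"
      using assms by (intro sum.cong) (auto simp: sg_def)
    ultimately show "zlin (insert i I) w (insert (v, i) B) v = zlin I w B v + w v i"
          "zlin (insert i I) w B v = zlin I w B v - w v i"
      using assms by (auto simp: zlin_def sg_def)
  qed
  show ?thesis
    unfolding eq expect_insert[OF fin]
    unfolding expect_cmult[symmetric] expect_add[symmetric]
    by (intro expect_cong) (simp add: z)
qed

lemma zlin_empty [simp]: "zlin {} w B v = 0"
  by (simp add: zlin_def)

lemma zlin_first_moment: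
  assumes "finite I"
  shows "expect (1/2) ({v} \<times> I) (\<lambda>B. zlin I w B v) = 0"
  using assms
proof (induction I rule: finite_induct)
  case (insert i I)
  show ?case
    unfolding expect_column_insert[OF insert.hyps(1,2), of v "\<lambda>x y. x" w w]
    using insert.IH by simp
qed simp

lemma zlin_second_moment:
  assumes "finite I"
  shows "expect (1/2) ({v} \<times> I) (\<lambda>B. zlin I w B v * zlin I w' B v) = (\<Sum>i\<in>I. w v i * w' v i)"
  using assms
proof (induction I rule: finite_induct)
  case (insert i I)
  have "((x + a) * (y + b) + (x - a) * (y - b)) / 2 = x * y + a * b" for x y a b :: real
    by (simp add: field_simps)
  note e = this
  show ?case
    unfolding expect_column_insert[OF insert.hyps(1,2), of v "\<lambda>x y. x * y" w w', unfolded e]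
    using insert by (simp add: expect_add expect_const)
qed simp

lemma zlin_variance:
  "finite I \<Longrightarrow> expect (1/2) ({v} \<times> I) (\<lambda>B. (zlin I w B v)\<^sup>2) = (\<Sum>i\<in>I. (w v i)\<^sup>2)"
  using zlin_second_moment[of I v w w] by (simp add: power2_eq_square)

lemma zlin_third_moment:
  assumes "finite I"
  shows "expect (1/2) ({v} \<times> I) (\<lambda>B. (zlin I w B v)\<^sup>2 * zlin I w' B v) = 0"
  using assms
proof (induction I rule: finite_induct)
  case (insert i I)
  have "((x + a)\<^sup>2 * (y + b) + (x - a)\<^sup>2 * (y - b)) / 2 = x\<^sup>2 * y + (a\<^sup>2 * y + 2 * a * b * x)" for x y a b :: real
    by (simp add: field_simps power2_eq_square)
  note e = this
  show ?case
    unfolding expect_column_insert[OF insert.hyps(1,2), of v "\<lambda>x y. x\<^sup>2 * y" w w', unfolded e]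
    using insert by (simp add: expect_add expect_cmult zlin_first_moment)
qed simp

text \<open>The right-hand side is the Gaussian value. For signs the exact moment is smaller by
  twice the sum of the \<open>(w v i * w' v i)\<^sup>2\<close>.\<close>

lemma zlin_fourth_moment:
  assumes "finite I"
  shows "expect (1/2) ({v} \<times> I) (\<lambda>B. (zlin I w B v)\<^sup>2 * (zlin I w' B v)\<^sup>2) \<le>
     (\<Sum>i\<in>I. (w v i)\<^sup>2) * (\<Sum>i\<in>I. (w' v i)\<^sup>2) + 2 * (\<Sum>i\<in>I. w v i * w' v i)\<^sup>2"
  using assms
proof (induction I rule: finite_induct)
  case (insert i I)
  have e: "((x + a)\<^sup>2 * (y + b)\<^sup>2 + (x - a)\<^sup>2 * (y - b)\<^sup>2) / 2 =
     x\<^sup>2 * y\<^sup>2 + (b\<^sup>2 * (x * x) + (a\<^sup>2 * (y * y) + (4 * a * b * (x * y) + a\<^sup>2 * b\<^sup>2)))" for x y a b :: real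
    by (simp add: field_simps power2_eq_square)
  have s: "(w v i * w' v i)\<^sup>2 \<ge> 0" by simp
  show ?case
    unfolding expect_column_insert[OF insert.hyps(1,2), of v "\<lambda>x y. x\<^sup>2 * y\<^sup>2" w w', unfolded e]
    using insert s by (simp add: expect_add expect_cmult expect_const zlin_second_moment power2_eq_square algebra_simps)
qed simp

lemma expect_column_union:
  assumes "finite V" "v \<notin> V" "finite I"
  shows "expect p (insert v V \<times> I) f = expect p (V \<times> I) (\<lambda>A. expect p ({v} \<times> I) (\<lambda>B. f (A \<union> B)))"
proof -
  have "insert v V \<times> I = V \<times> I \<union> {v} \<times> I" by auto
  then show ?thesis using assms by (auto intro: expect_union)
qed

lemma mlin_zlin_insert:
  assumes "finite V" "v \<notin> V" "A \<subseteq> V \<times> I" "B \<subseteq> {v} \<times> I"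
  shows "mlin (insert v V) c (zlin I w (A \<union> B)) =
     mlin V c (zlin I w A) + zlin I w B v * mlin V (\<lambda>S. c (insert v S)) (zlin I w A)"
proof -
  have "zlin I w (A \<union> B) u = zlin I w A u" if "u \<in> V" for u
    unfolding zlin_def using assms that by (intro sum.cong) (auto simp: sg_def)
  moreover have "zlin I w (A \<union> B) v = zlin I w B v"
    unfolding zlin_def using assms by (intro sum.cong) (auto simp: sg_def)
  ultimately show ?thesis
    unfolding mlin_insert[OF assms(1,2)] by (simp cong: mlin_cong)
qed

lemma expect_mlin_zlin_sq:
  assumes "finite V" "finite I" "\<And>v. v \<in> V \<Longrightarrow> (\<Sum>i\<in>I. (w v i)\<^sup>2) = 1"
  shows "expect (1/2) (V \<times> I) (\<lambda>A. (mlin V c (zlin I w A))\<^sup>2) = norm2 V c"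
  using assms(1,3)
proof (induction V arbitrary: c rule: finite_induct)
  case (insert v V)
  define a where "a A = mlin V c (zlin I w A)" for A
  define b where "b A = mlin V (\<lambda>S. c (insert v S)) (zlin I w A)" for A
  have e: "expect (1/2) ({v} \<times> I) (\<lambda>B. (mlin (insert v V) c (zlin I w (A \<union> B)))\<^sup>2) = (a A)\<^sup>2 + (b A)\<^sup>2"
    if A: "A \<subseteq> V \<times> I" for A
  proof -
    have "expect (1/2) ({v} \<times> I) (\<lambda>B. (mlin (insert v V) c (zlin I w (A \<union> B)))\<^sup>2) =
      expect (1/2) ({v} \<times> I) (\<lambda>B. (a A)\<^sup>2 + (2 * a A * b A * zlin I w B v + (b A)\<^sup>2 * (zlin I w B v * zlin I w B v)))"
      using insert.hyps A
      by (intro expect_cong) (simp add: mlin_zlin_insert a_def b_def power2_eq_square algebra_simps)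
    also have "\<dots> = (a A)\<^sup>2 + (b A)\<^sup>2"
      using assms(2) insert.prems[of v]
      by (simp add: expect_add expect_cmult expect_const zlin_first_moment zlin_second_moment power2_eq_square)
    finally show ?thesis .
  qed
  have "expect (1/2) (insert v V \<times> I) (\<lambda>A. (mlin (insert v V) c (zlin I w A))\<^sup>2) =
     expect (1/2) (V \<times> I) (\<lambda>A. (a A)\<^sup>2 + (b A)\<^sup>2)"
    unfolding expect_column_union[OF insert.hyps assms(2)] by (intro expect_cong e)
  then show ?case
    using insert by (simp add: expect_add a_def b_def wnorm_insert)
qed simp

text \<open>A substitute for hypercontractivity that also registers correlation, proved one variable
  at a time. With \<rho> = 1 it gives the usual bound with weight 3; for nearly orthogonal weight
  vectors \<open>g\<close> is close to 1, so the two squares are almost uncorrelated.\<close>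

lemma expect_mlin_zlin_sq_mult:
  fixes V :: "'v set" and I :: "'i set"
  assumes "finite V" and I: "finite I"
    and w: "\<And>v. v \<in> V \<Longrightarrow> (\<Sum>i\<in>I. (w v i)\<^sup>2) = 1" "\<And>v. v \<in> V \<Longrightarrow> (\<Sum>i\<in>I. (w' v i)\<^sup>2) = 1"
    and r: "\<And>v. v \<in> V \<Longrightarrow> \<bar>\<Sum>i\<in>I. w v i * w' v i\<bar> \<le> \<rho>" and "0 \<le> \<rho>" and g: "g = 1 + 2 * \<rho>"
  shows "expect (1/2) (V \<times> I) (\<lambda>A. (mlin V c (zlin I w A))\<^sup>2 * (mlin V d (zlin I w' A))\<^sup>2)
     \<le> wnorm g V c * wnorm g V d"
  using assms(1) w r
proof (induction V arbitrary: c d rule: finite_induct)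
  case (insert v V)
  define c' d' where "c' S = c (insert v S)" and "d' S = d (insert v S)" for S
  define M where "M c d = expect (1/2) (V \<times> I)
      (\<lambda>A. (mlin V c (zlin I w A))\<^sup>2 * (mlin V d (zlin I w' A))\<^sup>2)" for c d
  have IH: "M c d \<le> wnorm g V c * wnorm g V d" for c d
    unfolding M_def by (rule insert.IH) (use insert.prems in auto)
  define R where "R = (\<Sum>i\<in>I. w v i * w' v i)"
  have R: "\<bar>R\<bar> \<le> \<rho>" using insert.prems(3)[of v] by (simp add: R_def)
  then have R2: "R\<^sup>2 \<le> \<rho>\<^sup>2" using abs_le_square_iff[of R \<rho>] assms by simp
  have e: "expect (1/2) ({v} \<times> I)
       (\<lambda>B. (mlin (insert v V) c (zlin I w (A \<union> B)))\<^sup>2 * (mlin (insert v V) d (zlin I w' (A \<union> B)))\<^sup>2) \<le>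
     (mlin V c (zlin I w A))\<^sup>2 * (mlin V d (zlin I w' A))\<^sup>2
     + (1 + 2 * \<rho>) * ((mlin V c (zlin I w A))\<^sup>2 * (mlin V d' (zlin I w' A))\<^sup>2)
     + (1 + 2 * \<rho>) * ((mlin V c' (zlin I w A))\<^sup>2 * (mlin V d (zlin I w' A))\<^sup>2)
     + (1 + 2 * \<rho>\<^sup>2) * ((mlin V c' (zlin I w A))\<^sup>2 * (mlin V d' (zlin I w' A))\<^sup>2)"
    if A: "A \<subseteq> V \<times> I" for A
  proof -
    define a b where "a = mlin V c (zlin I w A)" and "b = mlin V c' (zlin I w A)"
    define a' b' where "a' = mlin V d (zlin I w' A)" and "b' = mlin V d' (zlin I w' A)"
    have poly_id: "(a + z * b)\<^sup>2 * (a' + z' * b')\<^sup>2 =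
        a\<^sup>2 * a'\<^sup>2 + (2 * a\<^sup>2 * a' * b' * z' + (a\<^sup>2 * b'\<^sup>2 * z'\<^sup>2 +
         (2 * a * b * a'\<^sup>2 * z + (4 * (a * b * a' * b') * (z * z') + (2 * a * b * b'\<^sup>2 * (z'\<^sup>2 * z) +
         (b\<^sup>2 * a'\<^sup>2 * z\<^sup>2 + (2 * b\<^sup>2 * a' * b' * (z\<^sup>2 * z') +
          b\<^sup>2 * b'\<^sup>2 * (z\<^sup>2 * z'\<^sup>2))))))))" for z z'
      by algebra
    have fin: "finite ({v} \<times> I)" using I by simp
    have var: "(\<Sum>i\<in>I. (w v i)\<^sup>2) = 1" "(\<Sum>i\<in>I. (w' v i)\<^sup>2) = 1"
      using insert.prems(1,2)[of v] by auto
    let ?z = "\<lambda>B. zlin I w B v" and ?z' = "\<lambda>B. zlin I w' B v"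
    have "expect (1/2) ({v} \<times> I)
       (\<lambda>B. (mlin (insert v V) c (zlin I w (A \<union> B)))\<^sup>2 * (mlin (insert v V) d (zlin I w' (A \<union> B)))\<^sup>2) =
      expect (1/2) ({v} \<times> I) (\<lambda>B. a\<^sup>2 * a'\<^sup>2 + (2 * a\<^sup>2 * a' * b' * ?z' B + (a\<^sup>2 * b'\<^sup>2 * (?z' B)\<^sup>2 +
         (2 * a * b * a'\<^sup>2 * ?z B + (4 * (a * b * a' * b') * (?z B * ?z' B) + (2 * a * b * b'\<^sup>2 * ((?z' B)\<^sup>2 * ?z B) +
         (b\<^sup>2 * a'\<^sup>2 * (?z B)\<^sup>2 + (2 * b\<^sup>2 * a' * b' * ((?z B)\<^sup>2 * ?z' B) +
          b\<^sup>2 * b'\<^sup>2 * ((?z B)\<^sup>2 * (?z' B)\<^sup>2)))))))))"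
      using insert.hyps A
      unfolding poly_id[symmetric]
      by (intro expect_cong)
         (simp add: mlin_zlin_insert a_def b_def a'_def b'_def c'_def[abs_def] d'_def[abs_def])
    also have "\<dots> = a\<^sup>2 * a'\<^sup>2 + a\<^sup>2 * b'\<^sup>2 + 4 * (a * b * a' * b') * R + b\<^sup>2 * a'\<^sup>2 +
         b\<^sup>2 * b'\<^sup>2 * expect (1/2) ({v} \<times> I) (\<lambda>B. (?z B)\<^sup>2 * (?z' B)\<^sup>2)"
      unfolding expect_add expect_cmult expect_const[OF fin] zlin_first_moment[OF I]
        zlin_second_moment[OF I] zlin_third_moment[OF I] zlin_variance[OF I] R_def[symmetric] var
      by (simp only: mult_zero_right mult_1_right add_0 add.assoc)
    also have "\<dots> \<le> a\<^sup>2 * a'\<^sup>2 + a\<^sup>2 * b'\<^sup>2 + 2 * \<rho> * (a\<^sup>2 * b'\<^sup>2 + b\<^sup>2 * a'\<^sup>2) + b\<^sup>2 * a'\<^sup>2 +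
         b\<^sup>2 * b'\<^sup>2 * (1 + 2 * \<rho>\<^sup>2)"
    proof -
      have "expect (1/2) ({v} \<times> I) (\<lambda>B. (?z B)\<^sup>2 * (?z' B)\<^sup>2) \<le> 1 + 2 * \<rho>\<^sup>2"
        using zlin_fourth_moment[OF I, of v w w'] insert.prems(1,2)[of v] R2 by (simp add: R_def)
      then have 1: "b\<^sup>2 * b'\<^sup>2 * expect (1/2) ({v} \<times> I) (\<lambda>B. (?z B)\<^sup>2 * (?z' B)\<^sup>2) \<le> b\<^sup>2 * b'\<^sup>2 * (1 + 2 * \<rho>\<^sup>2)"
        by (intro mult_left_mono) auto
      \<comment> \<open>The only term of indefinite sign is split by the inequality of arithmetic
        and geometric means between the two mixed products; this produces the weight 1 + 2
        \<rho>.\<close>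
      have "2 * (a * b * a' * b') * R \<le> 2 * \<bar>a * b * a' * b'\<bar> * \<rho>"
      proof -
        have "2 * (a * b * a' * b') * R \<le> \<bar>2 * (a * b * a' * b')\<bar> * \<bar>R\<bar>"
          unfolding abs_mult[symmetric] by (rule abs_ge_self)
        also have "\<dots> \<le> \<bar>2 * (a * b * a' * b')\<bar> * \<rho>" using R by (intro mult_left_mono) auto
        also have "\<bar>2 * (a * b * a' * b')\<bar> = 2 * \<bar>a * b * a' * b'\<bar>" by (simp only: abs_mult abs_numeral)
        finally show ?thesis .
      qed
      also have "\<dots> \<le> (a\<^sup>2 * b'\<^sup>2 + b\<^sup>2 * a'\<^sup>2) * \<rho>"
      proof (intro mult_right_mono)
        have "0 \<le> (a * b' - b * a')\<^sup>2" "0 \<le> (a * b' + b * a')\<^sup>2" by auto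
        moreover have "(a * b' - b * a')\<^sup>2 = a\<^sup>2 * b'\<^sup>2 + b\<^sup>2 * a'\<^sup>2 - 2 * (a * b * a' * b')"
          "(a * b' + b * a')\<^sup>2 = a\<^sup>2 * b'\<^sup>2 + b\<^sup>2 * a'\<^sup>2 + 2 * (a * b * a' * b')" by algebra+
        ultimately show "2 * \<bar>a * b * a' * b'\<bar> \<le> a\<^sup>2 * b'\<^sup>2 + b\<^sup>2 * a'\<^sup>2"
          by linarith
      qed (use assms in auto)
      finally show ?thesis using 1 by (simp add: algebra_simps)
    qed
    also have "\<dots> = a\<^sup>2 * a'\<^sup>2 + (1 + 2 * \<rho>) * (a\<^sup>2 * b'\<^sup>2) + (1 + 2 * \<rho>) * (b\<^sup>2 * a'\<^sup>2) +
        (1 + 2 * \<rho>\<^sup>2) * (b\<^sup>2 * b'\<^sup>2)"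
      by algebra
    finally show ?thesis unfolding a_def b_def a'_def b'_def .
  qed
  have "expect (1/2) (insert v V \<times> I) (\<lambda>A. (mlin (insert v V) c (zlin I w A))\<^sup>2 * (mlin (insert v V) d (zlin I w' A))\<^sup>2)
     \<le> M c d + (1 + 2 * \<rho>) * M c d' + (1 + 2 * \<rho>) * M c' d + (1 + 2 * \<rho>\<^sup>2) * M c' d'"
    unfolding expect_column_union[OF insert.hyps I] M_def expect_cmult[symmetric] expect_add[symmetric]
    by (intro expect_mono e) auto
  also have "\<dots> \<le> wnorm g V c * wnorm g V d + (1 + 2 * \<rho>) * (wnorm g V c * wnorm g V d')
      + (1 + 2 * \<rho>) * (wnorm g V c' * wnorm g V d) + (1 + 2 * \<rho>\<^sup>2) * (wnorm g V c' * wnorm g V d')"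
    using \<open>0 \<le> \<rho>\<close> by (intro add_mono mult_left_mono IH) auto
  \<comment> \<open>Enlarging 1 + 2 \<rho>^2 to \<open>g * g\<close> makes the sum factor into two
    instances of \<open>wnorm_insert\<close>.\<close>
  also have "\<dots> \<le> wnorm g V c * wnorm g V d + g * (wnorm g V c * wnorm g V d')
      + g * (wnorm g V c' * wnorm g V d) + g * g * (wnorm g V c' * wnorm g V d')"
  proof -
    have "0 \<le> \<rho> * \<rho>" by simp
    then have "1 + 2 * \<rho>\<^sup>2 \<le> g * g" using \<open>0 \<le> \<rho>\<close> by (simp add: g power2_eq_square algebra_simps)
    moreover have "0 \<le> g" using \<open>0 \<le> \<rho>\<close> g by simp
    ultimately show ?thesis unfolding g[symmetric]
      by (intro add_mono mult_right_mono mult_nonneg_nonneg wnorm_nonneg) auto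
  qed
  also have "\<dots> = wnorm g (insert v V) c * wnorm g (insert v V) d"
    unfolding wnorm_insert[OF insert.hyps] c'_def[abs_def, symmetric] d'_def[abs_def, symmetric] by algebra
  finally show ?case .
qed simp

lemma expect_marginal:
  assumes V: "finite V" and I: "finite I" "i \<in> I"
  shows "expect p (V \<times> I) (\<lambda>A. f {v \<in> V. (v, i) \<in> A}) = expect p V f"
proof -
  let ?h = "\<lambda>v. (v, i)"
  have eq: "V \<times> I = ?h ` V \<union> V \<times> (I - {i})" using I by auto
  have "expect p (V \<times> I) (\<lambda>A. f {v \<in> V. (v, i) \<in> A}) =
     expect p (?h ` V) (\<lambda>A. expect p (V \<times> (I - {i})) (\<lambda>B. f {v \<in> V. (v, i) \<in> A \<union> B}))"
    unfolding eq using V I by (intro expect_union) auto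
  also have "\<dots> = expect p (?h ` V) (\<lambda>A. expect p (V \<times> (I - {i})) (\<lambda>B. f {v \<in> V. (v, i) \<in> A}))"
    by (intro expect_cong arg_cong[where f = f]) auto
  also have "\<dots> = expect p (?h ` V) (\<lambda>A. f {v \<in> V. (v, i) \<in> A})"
    using V I by (simp add: expect_const)
  also have "\<dots> = expect p V (\<lambda>A. f {v \<in> V. (v, i) \<in> ?h ` A})"
    using V by (intro expect_image) (auto simp: inj_on_def)
  also have "\<dots> = expect p V f"
    by (intro expect_cong arg_cong[where f = f]) auto
  finally show ?thesis .
qed

text \<open>Unit weight vectors give back plain signs. So both ends of the Lindeberg comparison live
  on the same space \<open>V \<times> I\<close>, and moment bounds for plain signs are special
  cases.\<close>

lemma zlin_unit:
  assumes "finite I" "i \<in> I" "v \<in> V"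
  shows "zlin I (\<lambda>_ j. of_bool (j = i)) A v = sg {v \<in> V. (v, i) \<in> A} v"
proof -
  have "zlin I (\<lambda>_ j. of_bool (j = i)) A v = (\<Sum>j\<in>I. if j = i then sg A (v, j) else 0)"
    unfolding zlin_def by (intro sum.cong) auto
  then show ?thesis using assms by (simp add: sg_def)
qed

lemma mlin_zlin_unit:
  assumes "finite I" "i \<in> I"
  shows "mlin V c (zlin I (\<lambda>_ j. of_bool (j = i)) A) = mlin V c (sg {v \<in> V. (v, i) \<in> A})"
  by (intro mlin_cong zlin_unit assms)

lemma expect_mlin_sg_sq:
  assumes "finite V"
  shows "expect (1/2) V (\<lambda>A. (mlin V c (sg A))\<^sup>2) = norm2 V c"
proof -
  have "expect (1/2) V (\<lambda>A. (mlin V c (sg A))\<^sup>2) =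
     expect (1/2) (V \<times> {0::nat}) (\<lambda>A. (mlin V c (sg {v \<in> V. (v, 0) \<in> A}))\<^sup>2)"
    using assms by (intro expect_marginal[symmetric]) auto
  also have "\<dots> = expect (1/2) (V \<times> {0::nat}) (\<lambda>A. (mlin V c (zlin {0} (\<lambda>_ j. of_bool (j = 0)) A))\<^sup>2)"
    by (subst mlin_zlin_unit) auto
  also have "\<dots> = norm2 V c"
    using assms by (intro expect_mlin_zlin_sq) auto
  finally show ?thesis .
qed

lemma expect_mlin_sg_sq_mult:
  assumes "finite V"
  shows "expect (1/2) V (\<lambda>A. (mlin V c (sg A))\<^sup>2 * (mlin V d (sg A))\<^sup>2) \<le> wnorm 3 V c * wnorm 3 V d"
proof -
  have "expect (1/2) V (\<lambda>A. (mlin V c (sg A))\<^sup>2 * (mlin V d (sg A))\<^sup>2) =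
     expect (1/2) (V \<times> {0::nat})
       (\<lambda>A. (mlin V c (sg {v \<in> V. (v, 0) \<in> A}))\<^sup>2 * (mlin V d (sg {v \<in> V. (v, 0) \<in> A}))\<^sup>2)"
    using assms by (intro expect_marginal[symmetric]) auto
  also have "\<dots> = expect (1/2) (V \<times> {0::nat})
     (\<lambda>A. (mlin V c (zlin {0} (\<lambda>_ j. of_bool (j = 0)) A))\<^sup>2 * (mlin V d (zlin {0} (\<lambda>_ j. of_bool (j = 0)) A))\<^sup>2)"
    by (subst mlin_zlin_unit, simp, simp)+ simp
  also have "\<dots> \<le> wnorm 3 V c * wnorm 3 V d"
    using assms by (intro expect_mlin_zlin_sq_mult[where \<rho> = 1]) auto
  finally show ?thesis .
qed

section \<open>Lindeberg replacement\<close>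

text \<open>A smooth test function with maximum 1, attained only at 0: its mean at a form bounds
  from above the probability that the form vanishes, and it is bounded away from 1 where the form is
  large.\<close>

definition gauss :: "real \<Rightarrow> real" where
  "gauss x = exp (- x\<^sup>2)"

lemma gauss_taylor:
  "\<bar>gauss (a + h) - (gauss a + (-2 * a * gauss a) * h + (4 * a\<^sup>2 - 2) * gauss a / 2 * h\<^sup>2
      + (12 * a - 8 * a ^ 3) * gauss a / 6 * h ^ 3)\<bar> \<le> 23 / 6 * h ^ 4"
proof (cases "h = 0")
  case False
  define d where "d m x = (case m of 0 \<Rightarrow> gauss x | Suc 0 \<Rightarrow> -2 * x * gauss x | Suc (Suc 0) \<Rightarrow> (4 * x\<^sup>2 - 2) * gauss x
    | Suc (Suc (Suc 0)) \<Rightarrow> (12 * x - 8 * x ^ 3) * gauss x | _ \<Rightarrow> (16 * x ^ 4 - 48 * x\<^sup>2 + 12) * gauss x)" for m :: nat and x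
  have d_fun: "d 0 = gauss" "d 1 = (\<lambda>x. -2 * x * gauss x)" "d 2 = (\<lambda>x. (4 * x\<^sup>2 - 2) * gauss x)"
     "d 3 = (\<lambda>x. (12 * x - 8 * x ^ 3) * gauss x)" "d 4 = (\<lambda>x. (16 * x ^ 4 - 48 * x\<^sup>2 + 12) * gauss x)"
    by (auto simp: d_def numeral_eq_Suc fun_eq_iff)
  have suc: "Suc 0 = 1" "Suc 1 = 2" "Suc 2 = 3" "Suc 3 = 4" by auto
  have der: "DERIV (d m) x :> d (Suc m) x" if m: "m < 4" for m x
  proof -
    have g: "DERIV gauss x :> -2 * x * gauss x"
      unfolding gauss_def by (auto intro!: derivative_eq_intros)
    consider "m = 0" | "m = 1" | "m = 2" | "m = 3" using m by linarith
    then show ?thesis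
    proof cases
      case 1
      then show ?thesis using g unfolding 1 suc d_fun by simp
    next
      case 2
      have "DERIV (\<lambda>x. -2 * x * gauss x) x :> (4 * x\<^sup>2 - 2) * gauss x"
        by (rule derivative_eq_intros g refl)+ (simp add: algebra_simps power2_eq_square)
      then show ?thesis unfolding 2 suc d_fun .
    next
      case 3
      have "DERIV (\<lambda>x. (4 * x\<^sup>2 - 2) * gauss x) x :> (12 * x - 8 * x ^ 3) * gauss x"
        by (rule derivative_eq_intros g refl)+ (simp add: algebra_simps power2_eq_square power3_eq_cube)
      then show ?thesis unfolding 3 suc d_fun .
    next
      case 4
      have "DERIV (\<lambda>x. (12 * x - 8 * x ^ 3) * gauss x) x :> (16 * x ^ 4 - 48 * x\<^sup>2 + 12) * gauss x"
        by (rule derivative_eq_intros g refl)+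
          (simp add: algebra_simps power2_eq_square power3_eq_cube power4_eq_xxxx)
      then show ?thesis unfolding 4 suc d_fun .
    qed
  qed
  \<comment> \<open>With y = x^2 the polynomial factor is at most 92 times the quadratic Taylor
    polynomial of exp y, and \<open>gauss x\<close> is exp (- y). Division by 4! turns 92 into
    23/6.\<close>
  have bound: "\<bar>d 4 x\<bar> \<le> 92" for x
  proof -
    define y where "y = x\<^sup>2"
    have y: "0 \<le> y" by (simp add: y_def)
    have p: "x ^ 4 = y\<^sup>2" by (simp add: y_def)
    have "\<bar>16 * y\<^sup>2 - 48 * y + 12\<bar> \<le> 92 * (1 + y + y\<^sup>2 / 2)"
      using y zero_le_power2[of y] by (auto simp: abs_if)
    also have "\<dots> \<le> 92 * exp y"
      using exp_lower_Taylor_quadratic[OF y] by simp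
    finally have "\<bar>16 * y\<^sup>2 - 48 * y + 12\<bar> * exp (- y) \<le> 92 * exp y * exp (- y)"
      by (intro mult_right_mono) auto
    then show ?thesis
      by (simp add: d_fun gauss_def p y_def[symmetric] abs_mult mult.assoc flip: exp_add)
  qed
  obtain t where t: "gauss (a + h) = (\<Sum>m<4. d m a / fact m * (a + h - a) ^ m) + d 4 t / fact 4 * (a + h - a) ^ 4"
    using Taylor[of 4 d gauss "min a (a + h)" "max a (a + h)" a "a + h"] der d_fun(1) False by auto
  have s: "(\<Sum>m<4. d m a / fact m * h ^ m) = gauss a + (-2 * a * gauss a) * h + (4 * a\<^sup>2 - 2) * gauss a / 2 * h\<^sup>2
      + (12 * a - 8 * a ^ 3) * gauss a / 6 * h ^ 3"
    by (simp add: d_def eval_nat_numeral fact_reduce)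
  have "gauss (a + h) - (gauss a + (-2 * a * gauss a) * h + (4 * a\<^sup>2 - 2) * gauss a / 2 * h\<^sup>2
      + (12 * a - 8 * a ^ 3) * gauss a / 6 * h ^ 3) = d 4 t / 24 * h ^ 4"
    using t unfolding s[symmetric] by (simp add: eval_nat_numeral fact_reduce)
  also have "\<bar>\<dots>\<bar> \<le> 92 / 24 * h ^ 4"
    using mult_right_mono[OF bound[of t], of "h ^ 4"] by (simp add: abs_mult mult.commute)
  finally show ?thesis by simp
qed simp

text \<open>The first three moments of \<open>zlin\<close> are 0, 1, 0 for all unit weights, so the
  value compared with does not involve \<open>w\<close>, and any two unit weight vectors can be
  compared through it. The fourth moment, at most 3, turns 23/6 into 23/2.\<close>

lemma gauss_column:
  assumes I: "finite I" and w: "(\<Sum>i\<in>I. (w v i)\<^sup>2) = 1"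
  shows "\<bar>expect (1/2) ({v} \<times> I) (\<lambda>B. gauss (a + zlin I w B v * b)) - (gauss a + (4 * a\<^sup>2 - 2) * gauss a / 2 * b\<^sup>2)\<bar>
     \<le> 23 / 2 * b ^ 4"
proof -
  let ?z = "\<lambda>B. zlin I w B v"
  have fin: "finite ({v} \<times> I)" using I by simp
  have poly_id: "p + (q * b * z + (r * b\<^sup>2 * z\<^sup>2 + s * b ^ 3 * (z\<^sup>2 * z))) =
      p + q * (z * b) + r * (z * b)\<^sup>2 + s * (z * b) ^ 3" for p q r s z :: real
    by (simp add: power_mult_distrib power2_eq_square power3_eq_cube mult_ac)
  let ?T = "\<lambda>B. gauss a + ((-2 * a * gauss a) * b * ?z B + ((4 * a\<^sup>2 - 2) * gauss a / 2 * b\<^sup>2 * (?z B)\<^sup>2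
      + (12 * a - 8 * a ^ 3) * gauss a / 6 * b ^ 3 * ((?z B)\<^sup>2 * ?z B)))"
  have T: "expect (1/2) ({v} \<times> I) ?T = gauss a + (4 * a\<^sup>2 - 2) * gauss a / 2 * b\<^sup>2"
    unfolding expect_add expect_cmult expect_const[OF fin] zlin_first_moment[OF I]
      zlin_third_moment[OF I] zlin_variance[OF I] w by (simp only: mult_zero_right mult_1_right add_0 add_0_right)
  have "\<bar>expect (1/2) ({v} \<times> I) (\<lambda>B. gauss (a + ?z B * b)) - expect (1/2) ({v} \<times> I) ?T\<bar> \<le>
     expect (1/2) ({v} \<times> I) (\<lambda>B. \<bar>gauss (a + ?z B * b) - ?T B\<bar>)"
    unfolding expect_diff[symmetric] by (rule expect_abs) auto
  also have "\<dots> \<le> expect (1/2) ({v} \<times> I) (\<lambda>B. 23 / 6 * b ^ 4 * ((?z B)\<^sup>2 * (?z B)\<^sup>2))"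
  proof (intro expect_mono)
    fix B
    have "\<bar>gauss (a + ?z B * b) - ?T B\<bar> \<le> 23 / 6 * (?z B * b) ^ 4"
      unfolding poly_id by (rule gauss_taylor)
    then show "\<bar>gauss (a + ?z B * b) - ?T B\<bar> \<le> 23 / 6 * b ^ 4 * ((?z B)\<^sup>2 * (?z B)\<^sup>2)"
      by (simp add: power_mult_distrib power2_eq_square power4_eq_xxxx mult_ac)
  qed auto
  also have "\<dots> = 23 / 6 * b ^ 4 * expect (1/2) ({v} \<times> I) (\<lambda>B. (?z B)\<^sup>2 * (?z B)\<^sup>2)"
    by (rule expect_cmult)
  also have "\<dots> \<le> 23 / 6 * b ^ 4 * 3"
    using zlin_fourth_moment[OF I, of v w w] w by (intro mult_left_mono) (auto simp flip: power2_eq_square)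
  finally show ?thesis unfolding T by simp
qed

text \<open>One step of Lindeberg's replacement method: the signs being symmetric, the third moments vanish as well,
  so the error is of fourth order.\<close>

lemma lindeberg_step:
  assumes V: "finite V" "v \<in> V" and I: "finite I"
    and w: "\<And>u. u \<in> V \<Longrightarrow> (\<Sum>i\<in>I. (w u i)\<^sup>2) = 1" "\<And>u. u \<in> V \<Longrightarrow> (\<Sum>i\<in>I. (w' u i)\<^sup>2) = 1"
    and eq: "\<And>u. u \<in> V \<Longrightarrow> u \<noteq> v \<Longrightarrow> w u = w' u"
  shows "\<bar>expect (1/2) (V \<times> I) (\<lambda>A. gauss (mlin V c (zlin I w A))) - expect (1/2) (V \<times> I) (\<lambda>A. gauss (mlin V c (zlin I w' A)))\<bar>
     \<le> 23 * (wnorm 3 (V - {v}) (\<lambda>S. c (insert v S)))\<^sup>2"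
proof -
  define U where "U = V - {v}"
  have U: "finite U" "v \<notin> U" "V = insert v U" using V by (auto simp: U_def)
  define b where "b A = mlin U (\<lambda>S. c (insert v S)) (zlin I w A)" for A
  have zeq: "mlin U d (zlin I w' A) = mlin U d (zlin I w A)" for d A
  proof (intro mlin_cong)
    fix u assume "u \<in> U"
    then have "w u = w' u" using eq[of u] U by auto
    then show "zlin I w' A u = zlin I w A u" by (simp add: zlin_def)
  qed
  have "\<bar>expect (1/2) (V \<times> I) (\<lambda>A. gauss (mlin V c (zlin I w A))) - expect (1/2) (V \<times> I) (\<lambda>A. gauss (mlin V c (zlin I w' A)))\<bar>
    \<le> expect (1/2) (U \<times> I) (\<lambda>A. \<bar>expect (1/2) ({v} \<times> I) (\<lambda>B. gauss (mlin V c (zlin I w (A \<union> B)))) -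
         expect (1/2) ({v} \<times> I) (\<lambda>B. gauss (mlin V c (zlin I w' (A \<union> B))))\<bar>)"
    unfolding U(3) expect_column_union[OF U(1,2) I]
    unfolding expect_diff[symmetric] by (rule expect_abs) auto
  also have "\<dots> \<le> expect (1/2) (U \<times> I) (\<lambda>A. 23 * ((b A)\<^sup>2 * (b A)\<^sup>2))"
  proof (intro expect_mono)
    fix A assume A: "A \<subseteq> U \<times> I"
    let ?a = "mlin U c (zlin I w A)"
    have e: "expect (1/2) ({v} \<times> I) (\<lambda>B. gauss (mlin V c (zlin I w (A \<union> B)))) =
        expect (1/2) ({v} \<times> I) (\<lambda>B. gauss (?a + zlin I w B v * b A))"
      unfolding U(3) b_def by (intro expect_cong) (simp add: mlin_zlin_insert[OF U(1,2) A])
    have e': "expect (1/2) ({v} \<times> I) (\<lambda>B. gauss (mlin V c (zlin I w' (A \<union> B)))) =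
        expect (1/2) ({v} \<times> I) (\<lambda>B. gauss (?a + zlin I w' B v * b A))"
      unfolding U(3) b_def by (intro expect_cong) (simp add: mlin_zlin_insert[OF U(1,2) A] zeq)
    have "b A ^ 4 = (b A)\<^sup>2 * (b A)\<^sup>2" by (simp add: power2_eq_square power4_eq_xxxx mult_ac)
    then show "\<bar>expect (1/2) ({v} \<times> I) (\<lambda>B. gauss (mlin V c (zlin I w (A \<union> B)))) -
         expect (1/2) ({v} \<times> I) (\<lambda>B. gauss (mlin V c (zlin I w' (A \<union> B))))\<bar> \<le> 23 * ((b A)\<^sup>2 * (b A)\<^sup>2)"
      unfolding e e'
      using gauss_column[of I w v ?a "b A", OF I w(1)[OF V(2)]] gauss_column[of I w' v ?a "b A", OF I w(2)[OF V(2)]]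
      by linarith
  qed auto
  also have "\<dots> = 23 * expect (1/2) (U \<times> I) (\<lambda>A. (b A)\<^sup>2 * (b A)\<^sup>2)"
    by (rule expect_cmult)
  also have "\<dots> \<le> 23 * (wnorm 3 U (\<lambda>S. c (insert v S)) * wnorm 3 U (\<lambda>S. c (insert v S)))"
    unfolding b_def
    using U I w by (intro mult_left_mono expect_mlin_zlin_sq_mult[where \<rho> = 1]) (auto simp flip: power2_eq_square)
  finally show ?thesis by (simp add: U_def power2_eq_square)
qed

lemma lindeberg:
  assumes V: "finite V" and I: "finite I"
    and w: "\<And>u. u \<in> V \<Longrightarrow> (\<Sum>i\<in>I. (w u i)\<^sup>2) = 1" "\<And>u. u \<in> V \<Longrightarrow> (\<Sum>i\<in>I. (w' u i)\<^sup>2) = 1"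
  shows "\<bar>expect (1/2) (V \<times> I) (\<lambda>A. gauss (mlin V c (zlin I w A))) - expect (1/2) (V \<times> I) (\<lambda>A. gauss (mlin V c (zlin I w' A)))\<bar>
     \<le> (\<Sum>v\<in>V. 23 * (wnorm 3 (V - {v}) (\<lambda>S. c (insert v S)))\<^sup>2)"
proof -
  \<comment> \<open>The hybrid carries the new weights on \<open>U\<close>; enlarging
    \<open>U\<close> by one variable is a single Lindeberg step.\<close>
  define hyb where "hyb U v = (if v \<in> U then w' v else w v)" for U v
  let ?E = "\<lambda>w. expect (1/2) (V \<times> I) (\<lambda>A. gauss (mlin V c (zlin I w A)))"
  have "\<bar>?E w - ?E (hyb U)\<bar> \<le> (\<Sum>v\<in>U. 23 * (wnorm 3 (V - {v}) (\<lambda>S. c (insert v S)))\<^sup>2)" if "finite U" "U \<subseteq> V" for U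
    using that
  proof (induction U rule: finite_induct)
    case empty
    have "hyb {} = w" by (auto simp: hyb_def)
    then show ?case by simp
  next
    case (insert v U)
    have "\<bar>?E (hyb U) - ?E (hyb (insert v U))\<bar> \<le> 23 * (wnorm 3 (V - {v}) (\<lambda>S. c (insert v S)))\<^sup>2"
      using V I w insert by (intro lindeberg_step) (auto simp: hyb_def)
    then show ?case using insert by simp
  qed
  from this[of V] have "\<bar>?E w - ?E (hyb V)\<bar> \<le> (\<Sum>v\<in>V. 23 * (wnorm 3 (V - {v}) (\<lambda>S. c (insert v S)))\<^sup>2)"
    using V by simp
  moreover have "mlin V c (zlin I (hyb V) A) = mlin V c (zlin I w' A)" for A
    by (intro mlin_cong) (auto simp: zlin_def hyb_def)
  ultimately show ?thesis by simp
qed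

section \<open>Small values near a corner of a cube\<close>

text \<open>Dividing out a node s0 leaves a quotient q of smaller degree that is at most 2
  \<epsilon> / \<Delta> at the other nodes. Since p(0) = p(s0) - s0 q(0) and s0 lies in [0, 1],
  every node costs a factor of at most 1 + 2 / \<Delta>.\<close>

lemma poly_extrapolate:
  fixes p :: "real poly"
  assumes "degree p \<le> n" "finite S" "card S = Suc n" "S \<subseteq> {0..1}"
    and sep: "\<And>s s'. s \<in> S \<Longrightarrow> s' \<in> S \<Longrightarrow> s \<noteq> s' \<Longrightarrow> \<Delta> \<le> \<bar>s - s'\<bar>" and "0 < \<Delta>"
    and small: "\<And>s. s \<in> S \<Longrightarrow> \<bar>poly p s\<bar> \<le> \<epsilon>"
  shows "\<bar>poly p 0\<bar> \<le> \<epsilon> * (1 + 2 / \<Delta>) ^ n"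
  using assms(1-5,7)
proof (induction n arbitrary: p S \<epsilon>)
  case 0
  then obtain s where "s \<in> S" by fastforce
  moreover obtain a where "p = [:a:]" using 0(1) by (metis le_zero_eq degree_eq_zeroE)
  ultimately show ?case using 0(6)[of s] by simp
next
  case (Suc n)
  obtain s0 where s0: "s0 \<in> S" using Suc.prems(3) by fastforce
  define q where "q = synthetic_div p s0"
  have p: "p = [:- s0, 1:] * q + [:poly p s0:]"
    using synthetic_div_correct'[of s0 p] by (simp add: q_def)
  have pq: "poly p s = (s - s0) * poly q s + poly p s0" for s
    by (subst p) (simp add: algebra_simps)
  have e0: "0 \<le> \<epsilon>" using Suc.prems(6)[OF s0] by linarith
  have "\<bar>poly q 0\<bar> \<le> (2 * \<epsilon> / \<Delta>) * (1 + 2 / \<Delta>) ^ n"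
  proof (rule Suc.IH)
    show "degree q \<le> n" using Suc.prems(1) by (simp add: q_def degree_synthetic_div)
    show "finite (S - {s0})" "card (S - {s0}) = Suc n" "S - {s0} \<subseteq> {0..1}"
      using Suc.prems(2-4) s0 by auto
    fix s assume s: "s \<in> S - {s0}"
    then have d: "\<Delta> \<le> \<bar>s - s0\<bar>" using Suc.prems(5)[of s s0] s0 by auto
    have "\<Delta> * \<bar>poly q s\<bar> \<le> \<bar>s - s0\<bar> * \<bar>poly q s\<bar>" using d by (intro mult_right_mono) auto
    also have "\<dots> = \<bar>poly p s - poly p s0\<bar>" using pq[of s] by (simp flip: abs_mult)
    also have "\<dots> \<le> 2 * \<epsilon>" using Suc.prems(6)[of s] Suc.prems(6)[of s0] s s0 by auto
    finally show "\<bar>poly q s\<bar> \<le> 2 * \<epsilon> / \<Delta>" using \<open>0 < \<Delta>\<close> by (simp add: field_simps)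
  qed (use Suc.prems(5) in auto)
  moreover have "\<bar>poly p 0\<bar> \<le> \<epsilon> + \<bar>poly q 0\<bar>"
  proof -
    have "\<bar>s0 * poly q 0\<bar> \<le> 1 * \<bar>poly q 0\<bar>"
      unfolding abs_mult using s0 Suc.prems(4) by (intro mult_right_mono) auto
    moreover have "poly p 0 = poly p s0 - s0 * poly q 0" using pq[of 0] by simp
    ultimately show ?thesis using Suc.prems(6)[OF s0] by linarith
  qed
  moreover have "\<epsilon> * 1 \<le> \<epsilon> * (1 + 2 / \<Delta>) ^ n"
    using e0 \<open>0 < \<Delta>\<close> by (intro mult_left_mono one_le_power) auto
  ultimately show ?case by (simp add: algebra_simps)
qed

section \<open>The uniform measure on a cube and its contractions\<close>

definition sym_uniform :: "real measure" where
  "sym_uniform = uniform_measure lborel {-1..1}"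

lemma sets_sym_uniform [measurable_cong, simp]: "sets sym_uniform = sets borel"
  by (simp add: sym_uniform_def)

lemma space_sym_uniform [simp]: "space sym_uniform = UNIV"
  by (simp add: sym_uniform_def)

lemma prob_space_sym_uniform: "prob_space sym_uniform"
  unfolding sym_uniform_def by (rule prob_space_uniform_measure) auto

text \<open>A linear substitution with Jacobian 1 / s. As \<open>e\<close> lies in [-1, 1], the
  contraction maps the interval into itself, so the indicator of the interval can only grow.\<close>

lemma nn_integral_sym_uniform_contract:
  assumes [measurable]: "f \<in> borel_measurable borel" and s: "0 < s" "s \<le> 1" and e: "\<bar>e\<bar> \<le> 1"
  shows "(\<integral>\<^sup>+x. f (e + s * (x - e)) \<partial>sym_uniform) \<le> ennreal (1 / s) * (\<integral>\<^sup>+x. f x \<partial>sym_uniform)"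
proof -
  let ?I = "indicator {-1..1} :: real \<Rightarrow> ennreal"
  have ind: "?I x \<le> ?I ((e - s * e) + s * x)" for x
  proof (cases "x \<in> {-1..1}")
    case True
    have "\<bar>(1 - s) * e + s * x\<bar> \<le> (1 - s) * \<bar>e\<bar> + s * \<bar>x\<bar>"
      using s abs_triangle_ineq[of "(1 - s) * e" "s * x"] by (simp add: abs_mult)
    also have "\<dots> \<le> (1 - s) * 1 + s * 1"
      using True e s by (intro add_mono mult_left_mono) auto
    finally have "(e - s * e) + s * x \<in> {-1..1}" by (auto simp: algebra_simps)
    then show ?thesis by (auto simp: indicator_def)
  qed simp
  have "(\<integral>\<^sup>+x. f (e + s * (x - e)) * ?I x \<partial>lborel) \<le>
     (\<integral>\<^sup>+x. f ((e - s * e) + s * x) * ?I ((e - s * e) + s * x) \<partial>lborel)"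
    using ind by (intro nn_integral_mono mult_mono) (auto simp: algebra_simps)
  also have "\<dots> = ennreal (1 / s) * (ennreal s * \<dots>)"
    using s by (simp add: mult.assoc[symmetric] ennreal_mult[symmetric])
  also have "ennreal s * (\<integral>\<^sup>+x. f ((e - s * e) + s * x) * ?I ((e - s * e) + s * x) \<partial>lborel) =
     (\<integral>\<^sup>+x. f x * ?I x \<partial>lborel)"
    using s by (subst nn_integral_real_affine[of "\<lambda>x. f x * ?I x" s "e - s * e"]) auto
  finally have "(\<integral>\<^sup>+x. f (e + s * (x - e)) * ?I x \<partial>lborel) / 2 \<le> ennreal (1 / s) * (\<integral>\<^sup>+x. f x * ?I x \<partial>lborel) / 2"
    by (intro divide_right_mono_ennreal)
  then show ?thesis
    by (simp add: sym_uniform_def nn_integral_uniform_measure ennreal_times_divide)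
qed

abbreviation cube :: "'i set \<Rightarrow> ('i \<Rightarrow> real) measure" where
  "cube J \<equiv> PiM J (\<lambda>_. sym_uniform)"

definition contract :: "'i set \<Rightarrow> ('i \<Rightarrow> real) \<Rightarrow> real \<Rightarrow> ('i \<Rightarrow> real) \<Rightarrow> ('i \<Rightarrow> real)" where
  "contract J e s y = (\<lambda>i\<in>J. e i + s * (y i - e i))"

lemma measurable_contract [measurable]: "contract J e s \<in> cube J \<rightarrow>\<^sub>M cube J"
  unfolding contract_def by measurable

lemma nn_integral_cube_contract:
  assumes "finite J" and s: "0 < s" "s \<le> 1" and e: "\<And>i. i \<in> J \<Longrightarrow> \<bar>e i\<bar> \<le> 1"
    and f: "f \<in> borel_measurable (cube J)"
  shows "(\<integral>\<^sup>+y. f (contract J e s y) \<partial>cube J) \<le> ennreal (1 / s) ^ card J * (\<integral>\<^sup>+y. f y \<partial>cube J)"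
  using assms(1,4,5)
proof (induction J arbitrary: f rule: finite_induct)
  case empty
  have "contract {} e s y = y" if "y \<in> space (cube {})" for y
    using that by (auto simp: contract_def space_PiM)
  then show ?case by (simp cong: nn_integral_cong)
next
  case (insert i J)
  interpret prob_space sym_uniform by (rule prob_space_sym_uniform)
  interpret product_sigma_finite "\<lambda>_. sym_uniform" by standard
  note [measurable] = insert.prems(2)
  have upd: "contract (insert i J) e s (y(i := x)) = (contract J e s y)(i := e i + s * (x - e i))" for y x
    using insert.hyps by (auto simp: contract_def fun_eq_iff)
  define h where "h y = (\<integral>\<^sup>+x. f (y(i := x)) \<partial>sym_uniform)" for y
  have h: "h \<in> borel_measurable (cube J)" unfolding h_def by measurable
  have "(\<integral>\<^sup>+y. f (contract (insert i J) e s y) \<partial>cube (insert i J)) =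
     (\<integral>\<^sup>+y. (\<integral>\<^sup>+x. f ((contract J e s y)(i := e i + s * (x - e i))) \<partial>sym_uniform) \<partial>cube J)"
    unfolding upd[symmetric] using insert.hyps by (intro product_nn_integral_insert) measurable
  also have "\<dots> \<le> (\<integral>\<^sup>+y. ennreal (1 / s) * h (contract J e s y) \<partial>cube J)"
  proof (intro nn_integral_mono)
    fix y assume "y \<in> space (cube J)"
    then have y: "contract J e s y \<in> space (cube J)"
      by (rule measurable_space[OF measurable_contract])
    then have "(\<lambda>x. f ((contract J e s y)(i := x))) \<in> borel_measurable borel"
      using measurable_compose[OF measurable_component_update[OF y insert.hyps(2)] insert.prems(2)]
      by (simp cong: measurable_cong_sets)
    then show "(\<integral>\<^sup>+x. f ((contract J e s y)(i := e i + s * (x - e i))) \<partial>sym_uniform) \<le>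
        ennreal (1 / s) * h (contract J e s y)"
      unfolding h_def using insert.prems(1)[of i] s
      by (intro nn_integral_sym_uniform_contract[where f = "\<lambda>x. f ((contract J e s y)(i := x))"]) auto
  qed
  also have "\<dots> = ennreal (1 / s) * (\<integral>\<^sup>+y. h (contract J e s y) \<partial>cube J)"
    by (intro nn_integral_cmult measurable_compose[OF measurable_contract h])
  also have "\<dots> \<le> ennreal (1 / s) * (ennreal (1 / s) ^ card J * (\<integral>\<^sup>+y. h y \<partial>cube J))"
    using insert.prems(1) h by (intro mult_left_mono insert.IH) auto
  also have "(\<integral>\<^sup>+y. h y \<partial>cube J) = (\<integral>\<^sup>+y. f y \<partial>cube (insert i J))"
    unfolding h_def using insert.hyps insert.prems by (intro product_nn_integral_insert[symmetric])
  finally show ?case using insert.hyps by (simp add: mult.assoc)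
qed

lemma prob_space_cube: "prob_space (cube J)"
  by (intro prob_space_PiM prob_space_sym_uniform)

lemma prob_cube_contract:
  assumes J: "finite J" and s: "0 < s" "s \<le> 1" and e: "\<And>i. i \<in> J \<Longrightarrow> \<bar>e i\<bar> \<le> 1"
    and B: "B \<in> sets (cube J)"
  shows "measure (cube J) {y \<in> space (cube J). contract J e s y \<in> B} \<le> measure (cube J) B / s ^ card J"
proof -
  interpret prob_space "cube J" by (rule prob_space_cube)
  have "(\<integral>\<^sup>+y. indicator B (contract J e s y) \<partial>cube J) \<le>
      ennreal (1 / s) ^ card J * (\<integral>\<^sup>+y. indicator B y \<partial>cube J)"
    using B by (intro nn_integral_cube_contract[OF J s e]) auto
  moreover have "(\<integral>\<^sup>+y. indicator B (contract J e s y) \<partial>cube J) =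
      emeasure (cube J) {y \<in> space (cube J). contract J e s y \<in> B}"
  proof -
    have "{y \<in> space (cube J). contract J e s y \<in> B} = contract J e s -` B \<inter> space (cube J)" by auto
    then have "{y \<in> space (cube J). contract J e s y \<in> B} \<in> sets (cube J)"
      using measurable_sets[OF measurable_contract B] by simp
    then have "emeasure (cube J) {y \<in> space (cube J). contract J e s y \<in> B} =
       (\<integral>\<^sup>+y. indicator {y \<in> space (cube J). contract J e s y \<in> B} y \<partial>cube J)"
      by (rule nn_integral_indicator[symmetric])
    also have "\<dots> = (\<integral>\<^sup>+y. indicator B (contract J e s y) \<partial>cube J)"
      by (intro nn_integral_cong) (auto simp: indicator_def)
    finally show ?thesis ..
  qed
  ultimately have "emeasure (cube J) {y \<in> space (cube J). contract J e s y \<in> B} \<le>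
      ennreal (1 / s) ^ card J * emeasure (cube J) B"
    using B by simp
  then have "ennreal (measure (cube J) {y \<in> space (cube J). contract J e s y \<in> B}) \<le>
      ennreal ((1 / s) ^ card J * measure (cube J) B)"
    using s by (simp add: emeasure_eq_measure ennreal_power ennreal_mult[symmetric])
  then show ?thesis using s by (simp add: power_divide field_simps ennreal_le_iff)
qed

text \<open>A Remez-type inequality. The cube is star-shaped around the corner \<open>e\<close>, and contracting it towards \<open>e\<close>
  by a factor \<open>s\<close> close to \<open>1\<close> hardly changes the uniform measure. So some ray through \<open>e\<close> contains many
  points at which \<open>G\<close> is small.\<close>

lemma small_at_corner:
  fixes J :: "'i set"
  assumes J: "finite J" "J \<noteq> {}" and e: "\<And>i. i \<in> J \<Longrightarrow> \<bar>e i\<bar> \<le> 1"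
    and eJ: "e \<in> extensional J"
    and G [measurable]: "G \<in> borel_measurable (cube J)"
    and poly: "\<And>y. y \<in> extensional J \<Longrightarrow> \<exists>p. degree p \<le> n \<and> (\<forall>s. poly p s = G (contract J e s y))"
    and small: "1 / 2 \<le> measure (cube J) {y \<in> space (cube J). \<bar>G y\<bar> < \<epsilon>}"
  shows "\<bar>G e\<bar> \<le> \<epsilon> * real (1 + 8 * card J * (3 * (n + 1))) ^ n"
proof -
  interpret prob_space "cube J" by (rule prob_space_cube)
  define m where "m = card J"
  have m: "m > 0" using J by (simp add: m_def card_gt_0_iff)
  \<comment> \<open>Each contraction is bad with probability at most 2/3, so on some ray at most 2
    (n + 1) of these N are bad. This leaves the n + 1 nodes that degree n needs.\<close>
  define N where "N = 3 * (n + 1)"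
  have N: "N > 0" by (simp add: N_def)
  \<comment> \<open>The spacing keeps all N contraction factors so close to 1 that their m-th powers
    are at least 3/4 by Bernoulli. A bad set of measure 1/2 then pulls back to measure at most (1/2)
    / (3/4) = 2/3.\<close>
  define \<Delta> where "\<Delta> = 1 / (4 * real m * real N)"
  have D: "0 < \<Delta>" using m N by (simp add: \<Delta>_def)
  define s where "s l = 1 - real l * \<Delta>" for l :: nat
  have s: "0 < s l" "s l \<le> 1" "3 / 4 \<le> s l ^ m" if "l \<in> {1..N}" for l
  proof -
    have "real l * \<Delta> \<le> real N * \<Delta>" using that D by (intro mult_right_mono) auto
    also have "\<dots> = 1 / (4 * real m)" using N by (simp add: \<Delta>_def)
    finally have le: "real l * \<Delta> \<le> 1 / (4 * real m)" .
    also have "\<dots> \<le> 1 / 4" using m by (simp add: field_simps)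
    finally have l: "real l * \<Delta> \<le> 1 / 4" .
    then show "0 < s l" "s l \<le> 1" using D by (auto simp: s_def)
    have "1 + real m * (- (real l * \<Delta>)) \<le> (1 + - (real l * \<Delta>)) ^ m"
      using l by (intro Bernoulli_inequality) auto
    moreover have "real m * (real l * \<Delta>) \<le> 1 / 4"
      using mult_left_mono[OF le, of "real m"] m by simp
    ultimately show "3 / 4 \<le> s l ^ m" by (simp add: s_def)
  qed
  define B where "B = {y \<in> space (cube J). \<epsilon> \<le> \<bar>G y\<bar>}"
  have B: "B \<in> sets (cube J)" unfolding B_def by measurable
  have "{y \<in> space (cube J). \<bar>G y\<bar> < \<epsilon>} = space (cube J) - B" by (auto simp: B_def)
  then have pB: "measure (cube J) B \<le> 1 / 2" using small prob_compl[OF B] by simp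
  define Bl where "Bl l = {y \<in> space (cube J). contract J e (s l) y \<in> B}" for l
  have Bl: "Bl l \<in> sets (cube J)" for l unfolding Bl_def using B by measurable
  have pBl: "measure (cube J) (Bl l) \<le> 2 / 3" if l: "l \<in> {1..N}" for l
  proof -
    have "measure (cube J) (Bl l) \<le> measure (cube J) B / s l ^ m"
      unfolding Bl_def m_def using s[OF l] J e B by (intro prob_cube_contract) auto
    also have "\<dots> \<le> (1 / 2) / (3 / 4)"
      using s[OF l] pB by (intro frac_le) auto
    finally show ?thesis by simp
  qed
  have "\<exists>y\<in>space (cube J). (\<Sum>l\<in>{1..N}. indicator (Bl l) y) < real (2 * (n + 1) + 1)"
  proof (rule ccontr)
    assume "\<not> ?thesis"
    then have "real (2 * (n + 1) + 1) \<le> (\<integral>y. (\<Sum>l\<in>{1..N}. indicator (Bl l) y) \<partial>cube J)"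
      using Bl by (intro integral_ge_const Bochner_Integration.integrable_sum integrable_real_indicator)
        (auto simp: not_less emeasure_eq_measure)
    also have "\<dots> = (\<Sum>l\<in>{1..N}. measure (cube J) (Bl l))"
      using Bl by (subst Bochner_Integration.integral_sum)
        (auto intro!: integrable_real_indicator simp: emeasure_eq_measure)
    also have "\<dots> \<le> (\<Sum>l\<in>{1..N}. 2 / 3)" by (intro sum_mono pBl)
    also have "\<dots> = 2 * (n + 1)" by (simp add: N_def)
    finally show False by simp
  qed
  then obtain y where y: "y \<in> space (cube J)" "(\<Sum>l\<in>{1..N}. indicator (Bl l) y) < real (2 * (n + 1) + 1)" by blast
  have "(\<Sum>l\<in>{1..N}. indicator (Bl l) y) = real (card {l \<in> {1..N}. y \<in> Bl l})"
    by (simp add: indicator_def sum.If_cases Int_def flip: of_bool_def)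
  then have "card {l \<in> {1..N}. y \<in> Bl l} \<le> 2 * (n + 1)" using y by linarith
  moreover have "card {l \<in> {1..N}. y \<notin> Bl l} = N - card {l \<in> {1..N}. y \<in> Bl l}"
  proof -
    have "{l \<in> {1..N}. y \<notin> Bl l} = {1..N} - {l \<in> {1..N}. y \<in> Bl l}" by auto
    moreover have "card \<dots> = card {1..N} - card {l \<in> {1..N}. y \<in> Bl l}"
      by (rule card_Diff_subset) auto
    ultimately show ?thesis by simp
  qed
  ultimately have "Suc n \<le> card {l \<in> {1..N}. y \<notin> Bl l}"
    by (simp add: N_def)
  then obtain L where L: "L \<subseteq> {l \<in> {1..N}. y \<notin> Bl l}" "card L = Suc n" "finite L"
    by (meson obtain_subset_with_card_n)
  have yE: "y \<in> extensional J" using y(1) by (auto simp: space_PiM PiE_def)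
  obtain p where p: "degree p \<le> n" "\<And>s. poly p s = G (contract J e s y)" using poly[OF yE] by blast
  have inj: "inj_on s L" using D by (auto simp: inj_on_def s_def)
  have "\<bar>poly p 0\<bar> \<le> \<epsilon> * (1 + 2 / \<Delta>) ^ n"
  proof (rule poly_extrapolate)
    show "card (s ` L) = Suc n" using inj L by (simp add: card_image)
    show "s ` L \<subseteq> {0..1}" using L s by (force simp: less_imp_le)
    show "\<Delta> \<le> \<bar>x - x'\<bar>" if "x \<in> s ` L" "x' \<in> s ` L" "x \<noteq> x'" for x x'
    proof -
      obtain l l' where l: "x = s l" "x' = s l'" using \<open>x \<in> s ` L\<close> \<open>x' \<in> s ` L\<close> by blast
      then have "l \<noteq> l'" using \<open>x \<noteq> x'\<close> by auto
      then have "1 \<le> \<bar>real l - real l'\<bar>" by linarith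
      then have "1 * \<Delta> \<le> \<bar>real l - real l'\<bar> * \<Delta>" using D by (intro mult_right_mono) auto
      also have "\<dots> = \<bar>(real l - real l') * \<Delta>\<bar>" using D by (simp add: abs_mult)
      also have "\<dots> = \<bar>x - x'\<bar>" by (simp add: l s_def algebra_simps)
      finally show ?thesis by simp
    qed
    show "\<bar>poly p x\<bar> \<le> \<epsilon>" if x: "x \<in> s ` L" for x
    proof -
      obtain l where l: "x = s l" "l \<in> L" using x by blast
      then have "y \<notin> Bl l" using L by auto
      moreover have "contract J e (s l) y \<in> space (cube J)"
        using y(1) by (rule measurable_space[OF measurable_contract])
      ultimately show ?thesis using y(1) by (auto simp: l p Bl_def B_def)
    qed
  qed (use p L D in auto)
  moreover have "contract J e 0 y = e"
    using eJ by (auto simp: contract_def fun_eq_iff extensional_def)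
  moreover have "poly p 0 = G (contract J e 0 y)" by (rule p)
  moreover have "2 / \<Delta> = 8 * real m * real N" by (simp add: \<Delta>_def)
  moreover have eq: "real (1 + 8 * card J * (3 * (n + 1))) = 1 + 8 * real m * real N"
    by (simp add: m_def N_def)
  ultimately show ?thesis unfolding eq by simp
qed

section \<open>Anticoncentration for low influences\<close>

lemma expect_swap:
  "expect p X (\<lambda>A. expect q Y (\<lambda>B. f A B)) = expect q Y (\<lambda>B. expect p X (\<lambda>A. f A B))"
proof -
  have "expect p X (\<lambda>A. expect q Y (\<lambda>B. f A B)) =
     (\<Sum>A\<in>Pow X. \<Sum>B\<in>Pow Y. p ^ card A * (1 - p) ^ card (X - A) * (q ^ card B * (1 - q) ^ card (Y - B) * f A B))"
    unfolding expect_def sum_distrib_left ..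
  also have "\<dots> = (\<Sum>B\<in>Pow Y. \<Sum>A\<in>Pow X. q ^ card B * (1 - q) ^ card (Y - B) * (p ^ card A * (1 - p) ^ card (X - A) * f A B))"
    by (subst sum.swap) (intro sum.cong refl, simp)
  also have "\<dots> = expect q Y (\<lambda>B. expect p X (\<lambda>A. f A B))"
    unfolding expect_def sum_distrib_left ..
  finally show ?thesis .
qed

lemma exp_plus_exp_minus_le:
  fixes x :: real
  assumes "\<bar>x\<bar> \<le> 1"
  shows "(exp x + exp (- x)) / 2 \<le> exp (x\<^sup>2)"
proof -
  have *: "exp y + exp (- y) \<le> 2 * (1 + y\<^sup>2)" if y: "0 \<le> y" "y \<le> 1" for y :: real
  proof -
    have "(1 - y + y\<^sup>2) * (1 + y + y\<^sup>2 / 2) = 1 + y\<^sup>2 * (1 + y + y\<^sup>2) / 2"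
      by (simp add: field_simps power2_eq_square)
    moreover have "0 \<le> y\<^sup>2 * (1 + y + y\<^sup>2) / 2" using y by simp
    ultimately have "1 \<le> (1 - y + y\<^sup>2) * (1 + y + y\<^sup>2 / 2)" by linarith
    also have "\<dots> \<le> (1 - y + y\<^sup>2) * exp y"
      using y exp_lower_Taylor_quadratic[OF y(1)] by (intro mult_left_mono) auto
    finally have "exp (- y) \<le> 1 - y + y\<^sup>2"
      by (simp add: exp_minus field_simps)
    then show ?thesis using exp_bound[OF y] by simp
  qed
  have "exp x + exp (- x) \<le> 2 * (1 + x\<^sup>2)"
    using *[of x] *[of "- x"] assms by (cases "0 \<le> x") auto
  also have "\<dots> \<le> 2 * exp (x\<^sup>2)" by (intro mult_left_mono exp_ge_add_one_self) auto
  finally show ?thesis by simp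
qed

lemma expect_exp_sg:
  assumes "finite J" "\<And>i. i \<in> J \<Longrightarrow> \<bar>b i\<bar> \<le> 1"
  shows "expect (1/2) J (\<lambda>a. exp (\<Sum>i\<in>J. b i * sg a i)) \<le> exp (\<Sum>i\<in>J. (b i)\<^sup>2)"
  using assms
proof (induction J rule: finite_induct)
  case (insert i J)
  have e: "(\<Sum>j\<in>insert i J. b j * sg a j) = (\<Sum>j\<in>J. b j * sg a j) - b i"
          "(\<Sum>j\<in>insert i J. b j * sg (insert i a) j) = (\<Sum>j\<in>J. b j * sg a j) + b i" if "a \<subseteq> J" for a
  proof -
    have "(\<Sum>j\<in>J. b j * sg (insert i a) j) = (\<Sum>j\<in>J. b j * sg a j)"
      using insert.hyps by (intro sum.cong) (auto simp: sg_def)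
    then show "(\<Sum>j\<in>insert i J. b j * sg a j) = (\<Sum>j\<in>J. b j * sg a j) - b i"
          "(\<Sum>j\<in>insert i J. b j * sg (insert i a) j) = (\<Sum>j\<in>J. b j * sg a j) + b i"
      using insert.hyps that by (auto simp: sg_def)
  qed
  have "expect (1/2) (insert i J) (\<lambda>a. exp (\<Sum>j\<in>insert i J. b j * sg a j)) =
     1/2 * expect (1/2) J (\<lambda>a. exp (\<Sum>j\<in>insert i J. b j * sg (insert i a) j)) +
     (1 - 1/2) * expect (1/2) J (\<lambda>a. exp (\<Sum>j\<in>insert i J. b j * sg a j))"
    by (rule expect_insert[OF insert.hyps])
  also have "\<dots> = expect (1/2) J (\<lambda>a. (exp (b i) + exp (- b i)) / 2 * exp (\<Sum>j\<in>J. b j * sg a j))"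
    unfolding expect_cmult[symmetric] expect_add[symmetric]
    by (intro expect_cong) (simp add: e exp_add exp_diff exp_minus field_simps)
  also have "\<dots> = (exp (b i) + exp (- b i)) / 2 * expect (1/2) J (\<lambda>a. exp (\<Sum>j\<in>J. b j * sg a j))"
    by (rule expect_cmult)
  also have "\<dots> \<le> exp ((b i)\<^sup>2) * exp (\<Sum>j\<in>J. (b j)\<^sup>2)"
    using insert by (intro mult_mono exp_plus_exp_minus_le expect_nonneg) auto
  finally show ?case using insert.hyps by (simp add: exp_add)
qed simp

lemma sg_sq [simp]: "(sg a i)\<^sup>2 = 1" "sg a i * sg a i = 1" "\<bar>sg a i\<bar> = 1"
  by (auto simp: sg_def)

section \<open>Unit weights parametrised by stereographic projection\<close>

definition srad :: "nat \<Rightarrow> (nat \<Rightarrow> real) \<Rightarrow> real" where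
  "srad m y = (\<Sum>j=1..m. (y j)\<^sup>2) / m"

text \<open>Inverse stereographic projection of \<open>y / sqrt m\<close>; \<open>srad m y\<close> is the squared norm of that vector.\<close>

definition stereo :: "nat \<Rightarrow> (nat \<Rightarrow> real) \<Rightarrow> nat \<Rightarrow> real" where
  "stereo m y i = (if i = 0 then (srad m y - 1) / (1 + srad m y) else 2 * (y i / sqrt m) / (1 + srad m y))"

lemma srad_nonneg: "0 \<le> srad m y"
  by (auto simp: srad_def intro!: divide_nonneg_nonneg sum_nonneg)

lemma sum_from_0: "(\<Sum>i\<in>{0..m}. f i) = f 0 + (\<Sum>i=1..m. f i)" for f :: "nat \<Rightarrow> real"
  by (simp add: sum.atLeast_Suc_atMost)

lemma stereo_unit:
  assumes "0 < m"
  shows "(\<Sum>i\<in>{0..m}. (stereo m y i)\<^sup>2) = 1"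
proof -
  define r where "r = srad m y"
  have r: "0 \<le> r" by (simp add: r_def srad_nonneg)
  have "(\<Sum>i=1..m. (stereo m y i)\<^sup>2) = (\<Sum>i=1..m. 4 / (1 + r)\<^sup>2 * ((y i)\<^sup>2 / m))"
    by (intro sum.cong) (auto simp: stereo_def r_def[symmetric] power_mult_distrib power_divide)
  also have "\<dots> = 4 / (1 + r)\<^sup>2 * r"
    unfolding r_def srad_def sum_divide_distrib sum_distrib_left ..
  finally have s: "(\<Sum>i=1..m. (stereo m y i)\<^sup>2) = 4 / (1 + r)\<^sup>2 * r" .
  have "(stereo m y 0)\<^sup>2 = (r - 1)\<^sup>2 / (1 + r)\<^sup>2"
    by (simp add: stereo_def r_def[symmetric] power_divide)
  then have "(\<Sum>i\<in>{0..m}. (stereo m y i)\<^sup>2) = ((r - 1)\<^sup>2 + 4 * r) / (1 + r)\<^sup>2"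
    unfolding sum_from_0 s by (simp add: add_divide_distrib)
  also have "(r - 1)\<^sup>2 + 4 * r = (1 + r)\<^sup>2" by (simp add: power2_eq_square algebra_simps)
  finally show ?thesis using r by simp
qed

text \<open>The corners of the cube. There \<open>srad\<close> is 1, so the projection is the vector
  with 0 in place 0 and entries of absolute value 1 / sqrt m elsewhere.\<close>

definition sgv :: "nat \<Rightarrow> nat set \<Rightarrow> nat \<Rightarrow> real" where
  "sgv m a = (\<lambda>i\<in>{1..m}. sg a i)"

lemma srad_sgv: "0 < m \<Longrightarrow> srad m (sgv m a) = 1"
  by (simp add: srad_def sgv_def)

lemma stereo_sgv_prod:
  assumes "0 < m"
  shows "(\<Sum>i\<in>{0..m}. stereo m (sgv m a) i * stereo m (sgv m a') i) = (\<Sum>i=1..m. sg a i * sg a' i) / m"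
proof -
  have "stereo m (sgv m a) i = sg a i / sqrt m" if "i \<in> {1..m}" for i a
    using that assms by (simp add: stereo_def srad_sgv) (simp add: sgv_def)
  then have "(\<Sum>i=1..m. stereo m (sgv m a) i * stereo m (sgv m a') i) = (\<Sum>i=1..m. sg a i * sg a' i / m)"
    by (intro sum.cong) (auto simp: real_sqrt_mult_self)
  moreover have "stereo m (sgv m a) 0 = 0" using assms by (simp add: stereo_def srad_sgv)
  ultimately show ?thesis
    unfolding sum_from_0 by (simp add: sum_divide_distrib)
qed

definition qform :: "'v set \<Rightarrow> ('v set \<Rightarrow> real) \<Rightarrow> nat \<Rightarrow> (nat \<Rightarrow> real) \<Rightarrow> ('v \<times> nat) set \<Rightarrow> real" where
  "qform V c m y A = mlin V c (zlin {0..m} (\<lambda>_. stereo m y) A)"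

text \<open>For two corners whose sign vectors have inner product \<sigma>, the correlation of the
  weights is \<sigma> / m, so the mean product of squares is at most (1 + 2 |\<sigma>| / m)^(2k).
  For random corners this averages to at most 2 e \<le> 6, and Paley-Zygmund with threshold 1/4
  yields (3/4)^2 / 6 = 3/32.\<close>

lemma qform_sgv_large:
  assumes V: "finite V" and k: "0 < k" and deg: "deg_le V k c" and n: "norm2 V c = 1" and m: "m = 16 * k\<^sup>2"
  shows "3 / 32 \<le> expect (1/2) (V \<times> {0..m})
     (\<lambda>A. of_bool (1 / 4 \<le> expect (1/2) {1..m} (\<lambda>a. (qform V c m (sgv m a) A)\<^sup>2)))"
proof -
  have m0: "0 < m" using k m by simp
  let ?E = "expect (1/2) (V \<times> {0..m})" and ?S = "expect (1/2) {1..m}"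
  let ?q = "\<lambda>a. qform V c m (sgv m a)"
  \<comment> \<open>The bound for a pair is exp (\<kappa> |\<sigma>|), and its exponential moment is
    controlled by m \<kappa>^2. The choice m = 16 k^2 makes this exactly 1.\<close>
  define \<kappa> where "\<kappa> = 4 * real k / real m"
  have lam: "0 \<le> \<kappa>" "\<kappa> \<le> 1" "real m * \<kappa>\<^sup>2 = 1"
    using k by (simp_all add: \<kappa>_def m field_simps power2_eq_square)
  have E1: "?E (\<lambda>A. (?q a A)\<^sup>2) = 1" for a
    unfolding qform_def using V m0 n by (subst expect_mlin_zlin_sq) (auto simp: stereo_unit)
  have mean: "?E (\<lambda>A. ?S (\<lambda>a. (?q a A)\<^sup>2)) = 1"
    by (subst expect_swap) (simp add: E1 expect_const)
  have pair: "?E (\<lambda>A. (?q a A)\<^sup>2 * (?q a' A)\<^sup>2) \<le>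
      exp (\<Sum>i\<in>{1..m}. (\<kappa> * sg a i) * sg a' i) + exp (\<Sum>i\<in>{1..m}. (- \<kappa> * sg a i) * sg a' i)" for a a'
  proof -
    define \<sigma> where "\<sigma> = (\<Sum>i=1..m. sg a i * sg a' i)"
    define \<rho> where "\<rho> = \<bar>\<sigma> / m\<bar>"
    define g where "g = 1 + 2 * \<rho>"
    have g: "1 \<le> g" by (simp add: g_def \<rho>_def)
    have "?E (\<lambda>A. (?q a A)\<^sup>2 * (?q a' A)\<^sup>2) \<le> wnorm g V c * wnorm g V c"
      unfolding qform_def using V m0
      by (intro expect_mlin_zlin_sq_mult[where \<rho> = \<rho>])
        (auto simp: stereo_unit stereo_sgv_prod \<rho>_def g_def \<sigma>_def)
    also have "\<dots> \<le> g ^ k * g ^ k"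
      using wnorm_le[OF deg g] n g wnorm_nonneg[of g V c] by (intro mult_mono) auto
    also have "\<dots> \<le> exp (2 * \<rho>) ^ k * exp (2 * \<rho>) ^ k"
      using g exp_ge_add_one_self[of "2 * \<rho>"] by (intro mult_mono power_mono) (auto simp: g_def)
    also have "\<dots> = exp (\<bar>\<kappa> * \<sigma>\<bar>)"
      by (simp add: \<rho>_def \<kappa>_def abs_mult flip: exp_of_nat_mult exp_add)
    also have "\<dots> \<le> exp (\<kappa> * \<sigma>) + exp (- \<kappa> * \<sigma>)"
      by (auto simp: abs_if)
    finally show ?thesis by (simp add: \<sigma>_def sum_distrib_left sum_negf mult.assoc)
  qed
  have ex: "?S (\<lambda>a'. exp (\<Sum>i\<in>{1..m}. (b * sg a i) * sg a' i)) \<le> exp 1" if b: "\<bar>b\<bar> = \<kappa>" for b a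
  proof -
    have "?S (\<lambda>a'. exp (\<Sum>i\<in>{1..m}. (b * sg a i) * sg a' i)) \<le> exp (\<Sum>i\<in>{1..m}. (b * sg a i)\<^sup>2)"
      using b lam by (intro expect_exp_sg) (auto simp: abs_mult)
    also have "(\<Sum>i\<in>{1..m}. (b * sg a i)\<^sup>2) = 1"
      using b lam by (simp add: power_mult_distrib) (metis power2_abs)
    finally show ?thesis .
  qed
  have "?E (\<lambda>A. (?S (\<lambda>a. (?q a A)\<^sup>2))\<^sup>2) = ?E (\<lambda>A. ?S (\<lambda>a. ?S (\<lambda>a'. (?q a A)\<^sup>2 * (?q a' A)\<^sup>2)))"
    unfolding power2_eq_square[of "?S _"] by (simp add: expect_cmult expect_cmult_right)
  also have "\<dots> = ?S (\<lambda>a. ?S (\<lambda>a'. ?E (\<lambda>A. (?q a A)\<^sup>2 * (?q a' A)\<^sup>2)))"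
    by (subst expect_swap) (subst expect_swap, rule refl)
  also have "\<dots> \<le> ?S (\<lambda>a. ?S (\<lambda>a'. exp (\<Sum>i\<in>{1..m}. (\<kappa> * sg a i) * sg a' i) + exp (\<Sum>i\<in>{1..m}. (- \<kappa> * sg a i) * sg a' i)))"
    by (intro expect_mono pair) auto
  also have "\<dots> \<le> ?S (\<lambda>a. exp 1 + exp 1)"
    unfolding expect_add using lam by (intro add_mono expect_mono ex) auto
  also have "\<dots> \<le> 6" using exp_le by (simp add: expect_const)
  finally have sq: "?E (\<lambda>A. (?S (\<lambda>a. (?q a A)\<^sup>2))\<^sup>2) \<le> 6" .
  have "(1 - 1 / 4)\<^sup>2 / 6 \<le> ?E (\<lambda>A. of_bool (1 / 4 * 1 \<le> ?S (\<lambda>a. (?q a A)\<^sup>2)))"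
    using V sq by (intro second_moment_lower_bound mean expect_nonneg) auto
  then show ?thesis by (simp add: power2_eq_square)
qed

text \<open>Stereographic projection is rational with common denominator 1 + \<open>srad\<close>.
  The k-th power clears it: along a line every factor of a monomial and every remaining factor 1 +
  \<open>srad\<close> is quadratic, and there are k of them in total.\<close>

lemma qform_along_ray:
  assumes V: "finite V" and deg: "deg_le V k c" and m: "0 < m"
  shows "\<exists>p. degree p \<le> 2 * k \<and> (\<forall>s. poly p s =
     (1 + srad m (contract {1..m} e s y)) ^ k * qform V c m (contract {1..m} e s y) A)"
proof -
  define l where "l i = [:e i, y i - e i:]" for i
  define R where "R = (\<Sum>j=1..m. smult (1 / m) (l j ^ 2))"
  define L where "L v = smult (sg A (v, 0)) (R - 1) + (\<Sum>i=1..m. smult (2 * sg A (v, i) / sqrt m) (l i))" for v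
  define p where "p = (\<Sum>S\<in>Pow V. if c S = 0 then 0 else smult (c S) ((\<Prod>v\<in>S. L v) * (1 + R) ^ (k - card S)))"
  have l: "poly (l i) s = contract {1..m} e s y i" if "i \<in> {1..m}" for i s
    using that by (simp add: l_def contract_def algebra_simps)
  have R: "poly R s = srad m (contract {1..m} e s y)" for s
    by (simp add: R_def poly_sum srad_def sum_divide_distrib l)
  have dl: "degree (l i) \<le> 1" for i by (simp add: l_def)
  have dR: "degree R \<le> 2" unfolding R_def
  proof (intro degree_sum_le)
    fix j assume "j \<in> {1..m}"
    have "degree (l j ^ 2) \<le> 1 * 2" using dl[of j] by (intro order_trans[OF degree_power_le] mult_right_mono) auto
    then show "degree (smult (1 / m) (l j ^ 2)) \<le> 2" by (intro order_trans[OF degree_smult_le]) auto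
  qed simp
  have dL: "degree (L v) \<le> 2" for v
    unfolding L_def
  proof (intro degree_add_le degree_sum_le order_trans[OF degree_smult_le])
    show "degree (R - 1) \<le> 2" using dR by (intro degree_diff_le) auto
    show "degree (l i) \<le> 2" for i using dl[of i] by simp
  qed simp
  have "degree p \<le> 2 * k"
    unfolding p_def
  proof (intro degree_sum_le)
    fix S assume S: "S \<in> Pow V"
    show "degree (if c S = 0 then 0 else smult (c S) ((\<Prod>v\<in>S. L v) * (1 + R) ^ (k - card S))) \<le> 2 * k"
    proof (cases "c S = 0")
      case False
      then have card: "card S \<le> k" using deg S by (auto simp: deg_le_def)
      have "finite S" using S V finite_subset by auto
      then have "degree (\<Prod>v\<in>S. L v) \<le> (\<Sum>v\<in>S. degree (L v))" using degree_prod_sum_le[of S L] by (simp add: o_def)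
      also have "\<dots> \<le> (\<Sum>v\<in>S. 2)" by (intro sum_mono dL)
      finally have 1: "degree (\<Prod>v\<in>S. L v) \<le> card S * 2" by simp
      have "degree (1 + R) \<le> 2" using dR by (intro degree_add_le) auto
      then have 2: "degree ((1 + R) ^ (k - card S)) \<le> 2 * (k - card S)"
        by (intro order_trans[OF degree_power_le] mult_right_mono) auto
      have "degree ((\<Prod>v\<in>S. L v) * (1 + R) ^ (k - card S)) \<le> card S * 2 + 2 * (k - card S)"
        using 1 2 by (intro order_trans[OF degree_mult_le] add_mono) auto
      also have "\<dots> = 2 * k" using card by (simp add: algebra_simps)
      finally show ?thesis using False by simp
    qed simp
  qed (use V in simp)
  moreover have "poly p s = (1 + srad m (contract {1..m} e s y)) ^ k * qform V c m (contract {1..m} e s y) A" for s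
  proof -
    define Y where "Y = contract {1..m} e s y"
    define r where "r = srad m Y"
    define z where "z = zlin {0..m} (\<lambda>_::'a. stereo m Y) A"
    have Rr: "poly R s = r" by (simp only: R r_def Y_def)
    have lY: "poly (l i) s = Y i" if "i \<in> {1..m}" for i using l[OF that] by (simp only: Y_def)
    have r: "1 + r \<noteq> 0" using srad_nonneg[of m Y] by (simp add: r_def)
    have Lz: "poly (L v) s = (1 + r) * z v" for v
    proof -
      have "(1 + r) * z v = (1 + r) * (stereo m Y 0 * sg A (v, 0)) +
        (\<Sum>i=1..m. (1 + r) * (stereo m Y i * sg A (v, i)))"
        by (simp add: z_def zlin_def sum_from_0 sum_distrib_left distrib_left)
      also have "(1 + r) * (stereo m Y 0 * sg A (v, 0)) = sg A (v, 0) * (r - 1)"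
        using r by (simp add: stereo_def r_def[symmetric])
      also have "(\<Sum>i=1..m. (1 + r) * (stereo m Y i * sg A (v, i))) =
         (\<Sum>i=1..m. 2 * sg A (v, i) / sqrt m * poly (l i) s)"
        using r by (intro sum.cong) (auto simp: stereo_def r_def[symmetric] lY)
      finally show ?thesis by (simp add: L_def poly_sum Rr)
    qed
    have "poly p s = (\<Sum>S\<in>Pow V. (1 + r) ^ k * (c S * (\<Prod>v\<in>S. z v)))"
      unfolding p_def poly_sum
    proof (intro sum.cong refl)
      fix S assume S: "S \<in> Pow V"
      show "poly (if c S = 0 then 0 else smult (c S) ((\<Prod>v\<in>S. L v) * (1 + R) ^ (k - card S))) s =
         (1 + r) ^ k * (c S * (\<Prod>v\<in>S. z v))"
      proof (cases "c S = 0")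
        case False
        then have card: "card S \<le> k" using deg S by (auto simp: deg_le_def)
        have "poly (\<Prod>v\<in>S. L v) s = (1 + r) ^ card S * (\<Prod>v\<in>S. z v)"
          by (simp add: poly_prod Lz prod.distrib)
        moreover have "(1 + r) ^ k = (1 + r) ^ card S * (1 + r) ^ (k - card S)"
          using card by (simp flip: power_add)
        ultimately show ?thesis using False by (simp add: Rr)
      qed simp
    qed
    then show ?thesis
      by (simp add: qform_def mlin_def sum_distrib_left r_def z_def Y_def)
  qed
  ultimately show ?thesis by blast
qed

lemma measurable_srad [measurable]: "srad m \<in> borel_measurable (cube {1..m})"
  unfolding srad_def[abs_def] by measurable

lemma measurable_stereo: "i \<in> {0..m} \<Longrightarrow> (\<lambda>y. stereo m y i) \<in> borel_measurable (cube {1..m})"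
proof (cases "i = 0")
  case True
  show ?thesis unfolding stereo_def if_P[OF True] by measurable
next
  case False
  assume "i \<in> {0..m}"
  with False have [measurable]: "(\<lambda>y. y i) \<in> borel_measurable (cube {1..m})"
    using measurable_component_singleton[of i "{1..m}" "\<lambda>_. sym_uniform"] by (simp cong: measurable_cong_sets)
  show ?thesis unfolding stereo_def if_not_P[OF False] by measurable
qed

lemma measurable_qform: "(\<lambda>y. qform V c m y A) \<in> borel_measurable (cube {1..m})"
  unfolding qform_def mlin_def zlin_def
  by (intro borel_measurable_sum borel_measurable_times borel_measurable_prod borel_measurable_const measurable_stereo)

lemma AE_cube_bounded: "finite J \<Longrightarrow> AE y in cube J. \<forall>i\<in>J. \<bar>y i\<bar> \<le> 1"
proof (intro AE_finite_allI AE_PiM_component prob_space_sym_uniform)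
  show "AE x in sym_uniform. \<bar>x\<bar> \<le> 1"
    unfolding sym_uniform_def by (intro AE_uniform_measureI) auto
qed auto

lemma expect_divide: "expect p X (\<lambda>A. f A / c) = expect p X f / c"
  unfolding divide_inverse by (rule expect_cmult_right)

text \<open>The loss in \<open>small_at_corner\<close> for dimension 16 k^2 and degree 2k: the base
  is 1 + 768 k^3 + 384 k^2, at most 1153 k^3. The factor 4 brings the extrapolated corner value
  below 1/3.\<close>

definition spread :: "nat \<Rightarrow> real" where
  "spread k = 1 / (4 * real (1153 * k ^ 3) ^ (2 * k))"

lemma
  assumes "prob_space M" and S: "\<And>A. S A \<in> sets M"
  shows integrable_expect_indicator: "integrable M (\<lambda>y. expect p X (\<lambda>A. indicator (S A) y))"
    and integral_expect_indicator: "(\<integral>y. expect p X (\<lambda>A. indicator (S A) y) \<partial>M) = expect p X (\<lambda>A. measure M (S A))"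
proof -
  interpret prob_space M by fact
  have int: "integrable M (indicator (S A) :: _ \<Rightarrow> real)" for A
    using S[of A] by (intro integrable_real_indicator) (auto simp: emeasure_eq_measure)
  show "integrable M (\<lambda>y. expect p X (\<lambda>A. indicator (S A) y))"
    unfolding expect_def by (intro Bochner_Integration.integrable_sum integrable_mult_right int)
  have "(\<integral>y. expect p X (\<lambda>A. indicator (S A) y) \<partial>M) =
     (\<Sum>A\<in>Pow X. \<integral>y. p ^ card A * (1 - p) ^ card (X - A) * indicator (S A) y \<partial>M)"
    unfolding expect_def by (intro Bochner_Integration.integral_sum integrable_mult_right int)
  then show "(\<integral>y. expect p X (\<lambda>A. indicator (S A) y) \<partial>M) = expect p X (\<lambda>A. measure M (S A))"
    unfolding expect_def using S by simp
qed

text \<open>For at least 3/32 of the sign patterns \<open>A\<close> some corner has a value above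
  1/3, but that corner depends on \<open>A\<close>. By the contrapositive of
  \<open>small_at_corner\<close>, half of the cube is then good for this \<open>A\<close>.
  Exchanging the averages gives one \<open>y\<close> that is good for many \<open>A\<close> at once,
  because 3/64 > 1/25.\<close>

lemma exists_spread_weights:
  assumes V: "finite V" and k: "0 < k" and deg: "deg_le V k c" and n: "norm2 V c = 1" and m: "m = 16 * k\<^sup>2"
  shows "\<exists>y. 1 / 25 \<le> expect (1/2) (V \<times> {0..m}) (\<lambda>A. of_bool (spread k \<le> \<bar>qform V c m y A\<bar>))"
proof (rule ccontr)
  assume contra: "\<not> ?thesis"
  let ?M = "cube {1..m}" and ?E = "expect (1/2) (V \<times> {0..m})"
  let ?S = "\<lambda>A. {y \<in> space ?M. spread k \<le> \<bar>qform V c m y A\<bar>}"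
  interpret prob_space ?M by (rule prob_space_cube)
  note [measurable] = measurable_qform
  have m0: "0 < m" using k m by simp
  have S: "?S A \<in> sets ?M" for A by measurable
  have half: "of_bool (1 / 4 \<le> expect (1/2) {1..m} (\<lambda>a. (qform V c m (sgv m a) A)\<^sup>2)) / 2 \<le> measure ?M (?S A)" for A
  proof (cases "1 / 4 \<le> expect (1/2) {1..m} (\<lambda>a. (qform V c m (sgv m a) A)\<^sup>2)")
    case True
    define G where "G y = (1 + srad m y) ^ k * qform V c m y A" for y
    have G [measurable]: "G \<in> borel_measurable ?M" unfolding G_def by measurable
    have "\<exists>a. 1 / 8 < (qform V c m (sgv m a) A)\<^sup>2"
    proof (rule ccontr)
      assume "\<not> ?thesis"
      then have "expect (1/2) {1..m} (\<lambda>a. (qform V c m (sgv m a) A)\<^sup>2) \<le> expect (1/2) {1..m} (\<lambda>a. 1 / 8)"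
        by (intro expect_mono) (auto simp: not_less)
      then show False using True by (simp add: expect_const)
    qed
    then obtain a where a: "1 / 8 < (qform V c m (sgv m a) A)\<^sup>2" by blast
    have q3: "1 / 3 < \<bar>qform V c m (sgv m a) A\<bar>"
    proof (rule ccontr)
      assume "\<not> ?thesis"
      then have "\<bar>qform V c m (sgv m a) A\<bar> ^ 2 \<le> (1 / 3) ^ 2" by (intro power_mono) auto
      then show False using a by (simp add: power2_eq_square)
    qed
    have Ge: "\<bar>G (sgv m a)\<bar> = 2 ^ k * \<bar>qform V c m (sgv m a) A\<bar>"
      using m0 by (simp add: G_def srad_sgv abs_mult)
    \<comment> \<open>The cleared denominator equals 2^k at the corner and is at most 2^k on the
      cube, so passing between \<open>G\<close> and \<open>qform\<close> loses nothing.\<close>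
    define \<epsilon> where "\<epsilon> = 2 ^ k * spread k"
    define b where "b = real (1 + 8 * card {1..m} * (3 * (2 * k + 1)))"
    have "1 + 8 * card {1..m} * (3 * (2 * k + 1)) = 1 + 768 * k ^ 3 + 384 * k ^ 2"
      by (simp add: m power2_eq_square power3_eq_cube algebra_simps)
    also have "\<dots> \<le> k ^ 3 + 768 * k ^ 3 + 384 * k ^ 3"
      using k by (intro add_mono mult_left_mono power_increasing) auto
    finally have b: "b \<le> real (1153 * k ^ 3)" unfolding b_def by (simp only: of_nat_le_iff)
    have eb: "\<epsilon> * b ^ (2 * k) \<le> 2 ^ k * (1 / 4)"
    proof -
      have "b ^ (2 * k) \<le> real (1153 * k ^ 3) ^ (2 * k)"
        using b by (intro power_mono) (auto simp: b_def)
      then have "spread k * b ^ (2 * k) \<le> 1 / 4"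
        using k by (simp add: spread_def field_simps)
      then show ?thesis by (simp add: \<epsilon>_def mult.assoc)
    qed
    have "measure ?M {y \<in> space ?M. \<bar>G y\<bar> < \<epsilon>} < 1 / 2"
    proof (rule ccontr)
      assume "\<not> ?thesis"
      then have small: "1 / 2 \<le> measure ?M {y \<in> space ?M. \<bar>G y\<bar> < \<epsilon>}" by (simp only: not_less)
      have "\<bar>G (sgv m a)\<bar> \<le> \<epsilon> * b ^ (2 * k)"
        unfolding b_def
      proof (rule small_at_corner[OF _ _ _ _ G _ small])
        show "{1..m} \<noteq> {}" using m0 by simp
        show "\<bar>sgv m a i\<bar> \<le> 1" if "i \<in> {1..m}" for i using that by (simp add: sgv_def)
        show "sgv m a \<in> extensional {1..m}" by (simp add: sgv_def)
        show "\<exists>p. degree p \<le> 2 * k \<and> (\<forall>s. poly p s = G (contract {1..m} (sgv m a) s y))" for y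
          unfolding G_def by (rule qform_along_ray[OF V deg m0])
      qed simp
      also note eb
      finally have "2 ^ k * \<bar>qform V c m (sgv m a) A\<bar> \<le> 2 ^ k * (1 / 4)" unfolding Ge .
      then have "\<bar>qform V c m (sgv m a) A\<bar> \<le> 1 / 4" by (simp only: mult_le_cancel_left_pos zero_less_power zero_less_numeral)
      then show False using q3 by linarith
    qed
    moreover have "measure ?M {y \<in> space ?M. \<epsilon> \<le> \<bar>G y\<bar>} = 1 - measure ?M {y \<in> space ?M. \<bar>G y\<bar> < \<epsilon>}"
    proof -
      have "{y \<in> space ?M. \<bar>G y\<bar> < \<epsilon>} \<in> events" by measurable
      from prob_compl[OF this] show ?thesis
        by (rule back_subst[where P = "\<lambda>X. measure ?M X = _"]) auto
    qed
    moreover have "measure ?M {y \<in> space ?M. \<epsilon> \<le> \<bar>G y\<bar>} \<le> measure ?M (?S A)"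
    proof (rule finite_measure_mono_AE[OF _ S])
      show "AE y in ?M. y \<in> {y \<in> space ?M. \<epsilon> \<le> \<bar>G y\<bar>} \<longrightarrow> y \<in> ?S A"
        using AE_cube_bounded[OF finite_atLeastAtMost[of 1 m]]
      proof eventually_elim
        case (elim y)
        have "srad m y \<le> (\<Sum>j=1..m. 1) / m"
          unfolding srad_def using elim by (intro divide_right_mono sum_mono) (auto simp: abs_square_le_1)
        then have "srad m y \<le> 1" using m0 by simp
        then have "(1 + srad m y) ^ k \<le> 2 ^ k" using srad_nonneg[of m y] by (intro power_mono) auto
        then have "\<bar>G y\<bar> \<le> 2 ^ k * \<bar>qform V c m y A\<bar>"
          unfolding G_def abs_mult using srad_nonneg[of m y] by (intro mult_right_mono) auto
        then have "spread k \<le> \<bar>qform V c m y A\<bar>" if "\<epsilon> \<le> \<bar>G y\<bar>"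
        proof -
          have "2 ^ k * spread k \<le> 2 ^ k * \<bar>qform V c m y A\<bar>"
            using that \<open>\<bar>G y\<bar> \<le> _\<close> unfolding \<epsilon>_def by (rule order_trans)
          then show ?thesis by (simp only: mult_le_cancel_left_pos zero_less_power zero_less_numeral)
        qed
        then show ?case by auto
      qed
    qed
    ultimately show ?thesis using True by simp
  qed simp
  have "3 / 32 / 2 \<le> ?E (\<lambda>A. of_bool (1 / 4 \<le> expect (1/2) {1..m} (\<lambda>a. (qform V c m (sgv m a) A)\<^sup>2))) / 2"
    using qform_sgv_large[OF V k deg n m] by (intro divide_right_mono) auto
  also have "\<dots> \<le> ?E (\<lambda>A. measure ?M (?S A))"
    unfolding expect_divide[symmetric] by (intro expect_mono half) auto
  also have "\<dots> = (\<integral>y. ?E (\<lambda>A. indicator (?S A) y) \<partial>?M)"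
    by (rule integral_expect_indicator[where S = ?S, OF prob_space_cube S, symmetric])
  also have "\<dots> \<le> (\<integral>y. 1 / 25 \<partial>?M)"
  proof (rule integral_mono)
    show "integrable ?M (\<lambda>y. ?E (\<lambda>A. indicator (?S A) y))"
      by (rule integrable_expect_indicator[where S = ?S, OF prob_space_cube S])
    fix y assume y: "y \<in> space ?M"
    have "indicator (?S A) y = (of_bool (spread k \<le> \<bar>qform V c m y A\<bar>) :: real)" for A
      unfolding indicator_def using y by simp
    then have eq: "?E (\<lambda>A. indicator (?S A) y) = ?E (\<lambda>A. of_bool (spread k \<le> \<bar>qform V c m y A\<bar>))"
      by (rule expect_cong)
    have "\<not> 1 / 25 \<le> ?E (\<lambda>A. of_bool (spread k \<le> \<bar>qform V c m y A\<bar>))" using contra by blast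
    then show "?E (\<lambda>A. indicator (?S A) y) \<le> 1 / 25" unfolding eq by (rule linorder_not_le[THEN iffD1, THEN less_imp_le])
  qed (rule integrable_const)
  also have "\<dots> = 1 / 25" by (simp only: lebesgue_integral_const prob_space) simp
  finally have "(3 / 32 / 2 :: real) \<le> 1 / 25" .
  then show False by simp
qed

section \<open>Influences and regular forms\<close>

definition infl :: "'v set \<Rightarrow> ('v set \<Rightarrow> real) \<Rightarrow> 'v \<Rightarrow> real" where
  "infl V c v = norm2 (V - {v}) (\<lambda>S. c (insert v S))"

lemma infl_nonneg: "0 \<le> infl V c v"
  by (simp add: infl_def wnorm_nonneg)

text \<open>With this bound on the squared influences the Lindeberg error, at most 23 * 9^k /
  \<open>spread k\<close>^4 times their sum, is at most 23/4000. It has to stay below 1/50 -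
  1/100.\<close>

definition reg :: "nat \<Rightarrow> real" where
  "reg k = spread k ^ 4 / (4000 * 9 ^ k)"

lemma spread_pos: "0 < k \<Longrightarrow> 0 < spread k"
  by (simp add: spread_def)

lemma mlin_scale: "mlin V (\<lambda>S. c S / t) x = mlin V c x / t"
  by (simp add: mlin_def sum_divide_distrib)

lemma wnorm_scale: "wnorm g V (\<lambda>S. c S / t) = wnorm g V c / t\<^sup>2"
  by (simp add: wnorm_def sum_divide_distrib power_divide)

lemma infl_scale: "infl V (\<lambda>S. c S / t) v = infl V c v / t\<^sup>2"
  by (simp add: infl_def wnorm_scale)

text \<open>Two weight choices are compared through the mean of \<open>gauss\<close> of the form
  divided by \<open>spread k\<close>. For the weights of \<open>exists_spread_weights\<close> the
  mean is at most 1 - 1/50, since with probability 1/25 the argument is at least 1 in absolute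
  value. For unit weights it is at least the probability of vanishing.\<close>

lemma regular_nonzero_normalized:
  assumes V: "finite V" and k: "0 < k" and deg: "deg_le V k c" and n: "norm2 V c = 1"
    and reg: "(\<Sum>v\<in>V. (infl V c v)\<^sup>2) \<le> reg k"
  shows "1 / 100 \<le> expect (1/2) V (\<lambda>A. of_bool (mlin V c (sg A) \<noteq> 0))"
proof -
  define t where "t = spread k"
  have t: "0 < t" using k by (simp add: t_def spread_pos)
  define m where "m = 16 * k\<^sup>2"
  have m: "0 < m" using k by (simp add: m_def)
  let ?I = "{0..m}" and ?c = "\<lambda>S. c S / t"
  let ?E = "expect (1/2) (V \<times> ?I)"
  obtain y where y: "1 / 25 \<le> ?E (\<lambda>A. of_bool (t \<le> \<bar>qform V c m y A\<bar>))"
    using exists_spread_weights[OF V k deg n m_def] unfolding t_def by blast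
  have fin: "finite (V \<times> ?I)" using V by simp
  have "?E (\<lambda>A. gauss (mlin V ?c (zlin ?I (\<lambda>_. stereo m y) A))) \<le>
     ?E (\<lambda>A. 1 - 1 / 2 * of_bool (t \<le> \<bar>qform V c m y A\<bar>))"
  proof (intro expect_mono)
    fix A
    have eq: "mlin V ?c (zlin ?I (\<lambda>_. stereo m y) A) = qform V c m y A / t"
      by (simp add: mlin_scale qform_def)
    show "gauss (mlin V ?c (zlin ?I (\<lambda>_. stereo m y) A)) \<le> 1 - 1 / 2 * of_bool (t \<le> \<bar>qform V c m y A\<bar>)"
    proof (cases "t \<le> \<bar>qform V c m y A\<bar>")
      case True
      then have "1 \<le> \<bar>qform V c m y A / t\<bar>" using t by (simp add: field_simps)
      then have "1 \<le> (qform V c m y A / t)\<^sup>2" using abs_le_square_iff[of 1 "qform V c m y A / t"] by simp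
      then have "gauss (qform V c m y A / t) \<le> exp (- 1)" by (simp add: gauss_def)
      also have "\<dots> \<le> 1 / 2" using exp_ge_add_one_self[of 1] by (simp add: exp_minus field_simps)
      finally show ?thesis using True by (simp add: eq)
    next
      case False
      then show ?thesis by (simp add: eq gauss_def)
    qed
  qed auto
  also have "\<dots> = 1 - 1 / 2 * ?E (\<lambda>A. of_bool (t \<le> \<bar>qform V c m y A\<bar>))"
    by (simp only: expect_diff expect_cmult expect_const[OF fin])
  also have "\<dots> \<le> 1 - 1 / 50" using y by linarith
  finally have up: "?E (\<lambda>A. gauss (mlin V ?c (zlin ?I (\<lambda>_. stereo m y) A))) \<le> 1 - 1 / 50" .
  let ?w = "\<lambda>_ j. of_bool (j = (0::nat))"
  have "?E (\<lambda>A. gauss (mlin V ?c (zlin ?I ?w A))) = ?E (\<lambda>A. gauss (mlin V ?c (sg {v \<in> V. (v, 0) \<in> A})))"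
  proof (rule expect_cong)
    fix A
    show "gauss (mlin V ?c (zlin ?I ?w A)) = gauss (mlin V ?c (sg {v \<in> V. (v, 0) \<in> A}))"
      by (subst mlin_zlin_unit[of ?I 0]) auto
  qed
  also have "\<dots> = expect (1/2) V (\<lambda>A. gauss (mlin V ?c (sg A)))"
    using V by (intro expect_marginal[where f = "\<lambda>B. gauss (mlin V ?c (sg B))"]) auto
  finally have mar: "?E (\<lambda>A. gauss (mlin V ?c (zlin ?I ?w A))) = expect (1/2) V (\<lambda>A. gauss (mlin V ?c (sg A)))" .
  have "expect (1/2) V (\<lambda>A. 1 - of_bool (mlin V c (sg A) \<noteq> 0)) \<le> expect (1/2) V (\<lambda>A. gauss (mlin V ?c (sg A)))"
    by (intro expect_mono) (auto simp: gauss_def mlin_scale)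
  then have low: "1 - expect (1/2) V (\<lambda>A. of_bool (mlin V c (sg A) \<noteq> 0)) \<le> expect (1/2) V (\<lambda>A. gauss (mlin V ?c (sg A)))"
    by (simp only: expect_diff expect_const[OF V])
  have "\<bar>?E (\<lambda>A. gauss (mlin V ?c (zlin ?I (\<lambda>_. stereo m y) A))) - ?E (\<lambda>A. gauss (mlin V ?c (zlin ?I ?w A)))\<bar>
     \<le> (\<Sum>v\<in>V. 23 * (wnorm 3 (V - {v}) (\<lambda>S. ?c (insert v S)))\<^sup>2)"
  proof (rule lindeberg[OF V])
    show "(\<Sum>i\<in>?I. (stereo m y i)\<^sup>2) = 1" by (rule stereo_unit[OF m])
    show "(\<Sum>i\<in>?I. (of_bool (i = (0::nat)))\<^sup>2) = (1::real)" by (simp add: sum_from_0)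
  qed simp
  also have "\<dots> \<le> (\<Sum>v\<in>V. 23 * 9 ^ k / t ^ 4 * (infl V c v)\<^sup>2)"
  proof (rule sum_mono)
    fix v assume v: "v \<in> V"
    have "deg_le (V - {v}) k (\<lambda>S. ?c (insert v S))"
      unfolding deg_le_def
    proof (intro allI impI)
      fix S assume S: "S \<subseteq> V - {v}" "c (insert v S) / t \<noteq> 0"
      moreover from S(1) v have "insert v S \<subseteq> V" by auto
      ultimately have "card (insert v S) \<le> k" using deg by (auto simp: deg_le_def)
      moreover have "finite S" using S(1) V by (meson finite_Diff finite_subset)
      ultimately show "card S \<le> k" using card_insert_le[of S v] by linarith
    qed
    then have "wnorm 3 (V - {v}) (\<lambda>S. ?c (insert v S)) \<le> 3 ^ k * infl V ?c v"
      unfolding infl_def by (rule wnorm_le) simp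
    then have "(wnorm 3 (V - {v}) (\<lambda>S. ?c (insert v S)))\<^sup>2 \<le> (3 ^ k * infl V ?c v)\<^sup>2"
      by (intro power_mono wnorm_nonneg) auto
    also have "\<dots> = (3 ^ k)\<^sup>2 / t ^ 4 * (infl V c v)\<^sup>2"
      by (simp add: infl_scale power_mult_distrib power_divide flip: power_mult)
    also have "((3::real) ^ k)\<^sup>2 = 9 ^ k" by (simp add: power2_eq_square flip: power_mult_distrib)
    finally show "23 * (wnorm 3 (V - {v}) (\<lambda>S. ?c (insert v S)))\<^sup>2 \<le> 23 * 9 ^ k / t ^ 4 * (infl V c v)\<^sup>2" by simp
  qed
  also have "\<dots> = 23 * 9 ^ k / t ^ 4 * (\<Sum>v\<in>V. (infl V c v)\<^sup>2)" by (simp add: sum_distrib_left)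
  also have "\<dots> \<le> 23 * 9 ^ k / t ^ 4 * reg k" using reg t by (intro mult_left_mono) auto
  also have "\<dots> = 23 / 4000" using t by (simp add: reg_def t_def[symmetric])
  finally show ?thesis using up low unfolding mar by linarith
qed

lemma regular_nonzero:
  assumes V: "finite V" and k: "0 < k" and deg: "deg_le V k c" and n: "0 < norm2 V c"
    and reg: "(\<Sum>v\<in>V. (infl V c v)\<^sup>2) \<le> reg k * (norm2 V c)\<^sup>2"
  shows "1 / 100 \<le> expect (1/2) V (\<lambda>A. of_bool (mlin V c (sg A) \<noteq> 0))"
proof -
  define t where "t = sqrt (norm2 V c)"
  have t: "0 < t" "t\<^sup>2 = norm2 V c" using n by (auto simp: t_def)
  have "1 / 100 \<le> expect (1/2) V (\<lambda>A. of_bool (mlin V (\<lambda>S. c S / t) (sg A) \<noteq> 0))"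
  proof (rule regular_nonzero_normalized[OF V k])
    show "deg_le V k (\<lambda>S. c S / t)" using deg by (auto simp: deg_le_def)
    show "norm2 V (\<lambda>S. c S / t) = 1" using n by (simp add: wnorm_scale t)
    have eq: "(\<Sum>v\<in>V. (infl V (\<lambda>S. c S / t) v)\<^sup>2) = (\<Sum>v\<in>V. (infl V c v)\<^sup>2) / (norm2 V c)\<^sup>2"
      by (simp add: infl_scale t power_divide sum_divide_distrib)
    show "(\<Sum>v\<in>V. (infl V (\<lambda>S. c S / t) v)\<^sup>2) \<le> reg k"
      unfolding eq using reg n by (simp add: pos_divide_le_eq)
  qed
  then show ?thesis using t by (simp add: mlin_scale)
qed

text \<open>The coefficients, on the remaining variables, of the form after the variables of
  \<open>H\<close> have received the signs of \<open>A\<close>. Each coefficient is itself a form in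
  these signs, so moment bounds apply to it.\<close>

definition rst :: "'v set \<Rightarrow> ('v set \<Rightarrow> real) \<Rightarrow> 'v set \<Rightarrow> 'v set \<Rightarrow> real" where
  "rst H c A T = mlin H (\<lambda>U. c (T \<union> U)) (sg A)"

lemma mlin_union:
  assumes "finite W" "finite H" "H \<inter> W = {}"
  shows "mlin (H \<union> W) c x = mlin W (\<lambda>T. mlin H (\<lambda>U. c (T \<union> U)) x) x"
  using assms(1,3)
proof (induction W arbitrary: c rule: finite_induct)
  case (insert w W)
  have "w \<notin> H \<union> W" "finite (H \<union> W)" using insert assms by auto
  then show ?case using insert by (simp add: mlin_insert)
qed simp

lemma norm2_union:
  assumes "finite W" "finite H" "H \<inter> W = {}"
  shows "norm2 (H \<union> W) c = (\<Sum>T\<in>Pow W. norm2 H (\<lambda>U. c (T \<union> U)))"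
  using assms(1,3)
proof (induction W arbitrary: c rule: finite_induct)
  case (insert w W)
  have "w \<notin> H \<union> W" "finite (H \<union> W)" using insert assms by auto
  then show ?case using insert by (simp add: wnorm_insert sum_Pow_insert)
qed simp

lemma mlin_rst:
  assumes "finite V" "H \<subseteq> V" "A \<subseteq> H" "B \<subseteq> V - H"
  shows "mlin V c (sg (A \<union> B)) = mlin (V - H) (rst H c A) (sg B)"
proof -
  have "mlin V c (sg (A \<union> B)) = mlin (H \<union> (V - H)) c (sg (A \<union> B))"
    using assms by (simp add: Un_absorb1)
  also have "\<dots> = mlin (V - H) (\<lambda>T. mlin H (\<lambda>U. c (T \<union> U)) (sg (A \<union> B))) (sg (A \<union> B))"
    using assms finite_subset by (intro mlin_union) auto
  also have "\<dots> = mlin (V - H) (rst H c A) (sg (A \<union> B))"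
    unfolding rst_def using assms
    by (intro arg_cong2[where f = "mlin (V - H)"] refl ext mlin_cong) (auto simp: sg_def)
  also have "\<dots> = mlin (V - H) (rst H c A) (sg B)"
    using assms by (intro mlin_cong) (auto simp: sg_def)
  finally show ?thesis .
qed

lemma deg_le_rst:
  assumes "finite V" "H \<subseteq> V" "deg_le V k c"
  shows "deg_le (V - H) k (rst H c A)"
  unfolding deg_le_def
proof (intro allI impI)
  fix T assume T: "T \<subseteq> V - H" "rst H c A T \<noteq> 0"
  have "\<exists>U. U \<subseteq> H \<and> c (T \<union> U) \<noteq> 0"
  proof (rule ccontr)
    assume "\<not> ?thesis"
    then have "rst H c A T = 0" unfolding rst_def mlin_def by (intro sum.neutral) auto
    with T show False by simp
  qed
  then obtain U where U: "U \<subseteq> H" "c (T \<union> U) \<noteq> 0" by blast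
  have TU: "T \<union> U \<subseteq> V" using assms T U by auto
  then have "card (T \<union> U) \<le> k" using assms U by (auto simp: deg_le_def)
  moreover have "finite (T \<union> U)" using TU assms finite_subset by auto
  then have "card T \<le> card (T \<union> U)" by (intro card_mono) auto
  ultimately show "card T \<le> k" by simp
qed

lemma infl_eq:
  assumes "finite V" "v \<in> V"
  shows "infl V c v = (\<Sum>S\<in>Pow V. of_bool (v \<in> S) * (c S)\<^sup>2)"
proof -
  have V: "V = insert v (V - {v})" "finite (V - {v})" "v \<notin> V - {v}" using assms by auto
  have "(\<Sum>S\<in>Pow V. of_bool (v \<in> S) * (c S)\<^sup>2) = (\<Sum>S\<in>Pow (V - {v}). of_bool (v \<in> S) * (c S)\<^sup>2) +
     (\<Sum>S\<in>Pow (V - {v}). of_bool (v \<in> insert v S) * (c (insert v S))\<^sup>2)"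
    using sum_Pow_insert[OF V(2,3), of "\<lambda>S. of_bool (v \<in> S) * (c S)\<^sup>2"] V(1) by simp
  moreover have "(\<Sum>S\<in>Pow (V - {v}). of_bool (v \<in> S) * (c S)\<^sup>2) = 0" by (intro sum.neutral) auto
  ultimately show ?thesis by (simp add: infl_def norm2_def)
qed

lemma sum_of_bool_mem:
  fixes f :: "'v set \<Rightarrow> real"
  assumes "finite W"
  shows "(\<Sum>v\<in>W. \<Sum>T\<in>Pow W. of_bool (v \<in> T) * f T) = (\<Sum>T\<in>Pow W. real (card T) * f T)"
proof -
  have "(\<Sum>v\<in>W. \<Sum>T\<in>Pow W. of_bool (v \<in> T) * f T) = (\<Sum>T\<in>Pow W. \<Sum>v\<in>W. of_bool (v \<in> T) * f T)"
    by (rule sum.swap)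
  also have "\<dots> = (\<Sum>T\<in>Pow W. real (card T) * f T)"
  proof (intro sum.cong refl)
    fix S assume S: "S \<in> Pow W"
    then have "{v \<in> W. v \<in> S} = S" by auto
    then have "(\<Sum>v\<in>W. of_bool (v \<in> S)) = real (card S)"
      using assms by (simp add: sum.inter_filter[symmetric] of_bool_def)
    then show "(\<Sum>v\<in>W. of_bool (v \<in> S) * f S) = real (card S) * f S"
      unfolding sum_distrib_right[symmetric] by simp
  qed
  finally show ?thesis .
qed

lemma sum_infl:
  assumes V: "finite V"
  shows "(\<Sum>v\<in>V. infl V c v) = (\<Sum>S\<in>Pow V. real (card S) * (c S)\<^sup>2)"
  unfolding sum_of_bool_mem[OF V, symmetric] by (intro sum.cong refl infl_eq V)

lemma sum_infl_le:
  assumes "finite V" "deg_le V k c"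
  shows "(\<Sum>v\<in>V. infl V c v) \<le> k * norm2 V c"
  unfolding sum_infl[OF assms(1)] norm2_def sum_distrib_left
proof (rule sum_mono)
  fix S assume "S \<in> Pow V"
  then show "real (card S) * (c S)\<^sup>2 \<le> real k * (c S)\<^sup>2"
    using assms(2) by (cases "c S = 0") (auto simp: deg_le_def intro!: mult_right_mono)
qed

text \<open>A greedy choice: adding a variable of large influence to \<open>H\<close> shrinks the total influence outside \<open>H\<close>.\<close>

lemma influential_set:
  assumes V: "finite V" and deg: "deg_le V k c" and \<tau>: "0 < \<tau>" "\<tau> \<le> 1"
  shows "\<exists>H\<subseteq>V. card H \<le> j \<and> ((\<Sum>v\<in>V - H. infl V c v) \<le> (1 - \<tau>) ^ j * (k * norm2 V c) \<or>
     (\<forall>v\<in>V - H. infl V c v \<le> \<tau> * (\<Sum>u\<in>V - H. infl V c u)))"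
proof (induction j)
  case 0
  show ?case using sum_infl_le[OF V deg] by (intro exI[of _ "{}"]) auto
next
  case (Suc j)
  then obtain H where H: "H \<subseteq> V" "card H \<le> j" and
    alt: "(\<Sum>v\<in>V - H. infl V c v) \<le> (1 - \<tau>) ^ j * (k * norm2 V c) \<or>
     (\<forall>v\<in>V - H. infl V c v \<le> \<tau> * (\<Sum>u\<in>V - H. infl V c u))" by blast
  show ?case
  proof (cases "\<forall>v\<in>V - H. infl V c v \<le> \<tau> * (\<Sum>u\<in>V - H. infl V c u)")
    case True
    then show ?thesis using H by (intro exI[of _ H]) auto
  next
    case False
    then obtain v where v: "v \<in> V - H" "\<tau> * (\<Sum>u\<in>V - H. infl V c u) < infl V c v" by (auto simp: not_le)
    have "(\<Sum>u\<in>V - insert v H. infl V c u) = (\<Sum>u\<in>V - H. infl V c u) - infl V c v"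
    proof -
      have "V - insert v H = (V - H) - {v}" by auto
      then show ?thesis using v V by (simp add: sum_diff1)
    qed
    also have "\<dots> \<le> (1 - \<tau>) * (\<Sum>u\<in>V - H. infl V c u)" using v by (simp add: algebra_simps)
    also have "\<dots> \<le> (1 - \<tau>) * ((1 - \<tau>) ^ j * (k * norm2 V c))"
      using alt False \<tau> by (intro mult_left_mono) auto
    finally have "(\<Sum>u\<in>V - insert v H. infl V c u) \<le> (1 - \<tau>) ^ Suc j * (k * norm2 V c)" by (simp add: mult.assoc)
    moreover have "card (insert v H) \<le> Suc j" using H card_insert_le_m1[of "Suc j" H v] by simp
    ultimately show ?thesis using v H by (intro exI[of _ "insert v H"]) auto
  qed
qed

section \<open>Restricting influential variables\<close>

text \<open>The denominator is 8 * 9^k (Markov) times 9^k (second moment) times 4 k^2 (the square of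
  the factor 2k lost when the norm is bounded below by the total influence); all three arise in
  \<open>round_regular\<close>.\<close>

definition damp :: "nat \<Rightarrow> real" where
  "damp k = reg k / (32 * 81 ^ k * (real k)\<^sup>2)"

text \<open>This is 256 * 9^k * k divided by \<open>damp k\<close>, written as a natural number by
  clearing denominators. So many greedy steps bring the influence outside \<open>H\<close> down to
  the level that \<open>round_small_tail\<close> asks for.\<close>

definition depth :: "nat \<Rightarrow> nat" where
  "depth k = 32 * 81 ^ k * k\<^sup>2 * (4000 * 9 ^ k * (4 * (1153 * k ^ 3) ^ (2 * k)) ^ 4) * (256 * 9 ^ k * k)"

lemma depth_damp: "0 < k \<Longrightarrow> real (depth k) * damp k = 256 * 9 ^ k * real k"
  by (simp add: depth_def damp_def reg_def spread_def power_divide field_simps)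

lemma damp_bounds:
  assumes "0 < k"
  shows "0 < damp k" "damp k \<le> 1"
proof -
  have "spread k \<le> 1"
  proof -
    have "1 \<le> 1153 * k ^ 3" using assms by simp
    then have "real 1 \<le> real (1153 * k ^ 3)" by (rule of_nat_mono)
    then have "1 \<le> real (1153 * k ^ 3) ^ (2 * k)" by (intro one_le_power) (simp only: of_nat_1)
    moreover define Y where "Y = real (1153 * k ^ 3) ^ (2 * k)"
    ultimately have "1 \<le> Y" by simp
    then show ?thesis unfolding spread_def Y_def[symmetric] by simp
  qed
  then have s: "spread k ^ 4 \<le> 1" using spread_pos[OF assms] by (intro power_le_one) auto
  have k: "(1::real) \<le> 81 ^ k" "(1::real) \<le> 9 ^ k" "1 \<le> (real k)\<^sup>2" using assms by auto
  have "reg k \<le> 1" 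
  proof -
    have "spread k ^ 4 \<le> 4000 * 9 ^ k" using s k(2) by linarith
    then show ?thesis unfolding reg_def by (simp add: divide_le_eq)
  qed
  moreover define Y where "Y = 32 * 81 ^ k * (real k)\<^sup>2"
  have "1 * 1 \<le> (81::real) ^ k * (real k)\<^sup>2" using k by (intro mult_mono) auto
  then have "1 \<le> Y" by (simp add: Y_def)
  ultimately show "damp k \<le> 1" unfolding damp_def Y_def[symmetric] by (simp add: divide_le_eq)
  show "0 < damp k" unfolding damp_def reg_def using assms spread_pos[OF assms] by simp
qed

lemma of_bool_diff_le: "(P \<Longrightarrow> \<not> Q \<Longrightarrow> R) \<Longrightarrow> of_bool P - of_bool Q \<le> (of_bool R :: real)"
  by auto

lemma expect_split:
  assumes "finite V" "H \<subseteq> V"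
  shows "expect p V f = expect p H (\<lambda>A. expect p (V - H) (\<lambda>B. f (A \<union> B)))"
proof -
  have "expect p (H \<union> (V - H)) f = expect p H (\<lambda>A. expect p (V - H) (\<lambda>B. f (A \<union> B)))"
    using assms finite_subset by (intro expect_union) auto
  then show ?thesis using assms by (simp add: Un_absorb1)
qed

context
  fixes V H :: "'v set" and k :: nat and c :: "'v set \<Rightarrow> real" and W :: "'v set" and n :: "'v set \<Rightarrow> real"
  assumes V: "finite V" and H: "H \<subseteq> V" and deg: "deg_le V k c"
  defines "W \<equiv> V - H" and "n T \<equiv> norm2 H (\<lambda>U. c (T \<union> U))"
begin

lemma finite_H: "finite H" using V H finite_subset by auto

lemma n_nonneg: "0 \<le> n T" by (simp add: n_def wnorm_nonneg)

lemma expect_rst_sq: "expect (1/2) H (\<lambda>A. (rst H c A T)\<^sup>2) = n T"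
  unfolding rst_def n_def by (rule expect_mlin_sg_sq[OF finite_H])

lemma deg_le_shift: "T \<subseteq> W \<Longrightarrow> deg_le H k (\<lambda>U. c (T \<union> U))"
  unfolding deg_le_def
proof (intro allI impI)
  fix U assume T: "T \<subseteq> W" and U: "U \<subseteq> H" "c (T \<union> U) \<noteq> 0"
  have TU: "T \<union> U \<subseteq> V" using T U H by (auto simp: W_def)
  then have "card (T \<union> U) \<le> k" using deg U by (auto simp: deg_le_def)
  moreover have "finite (T \<union> U)" using TU V finite_subset by auto
  then have "card U \<le> card (T \<union> U)" by (intro card_mono) auto
  ultimately show "card U \<le> k" by simp
qed

lemma expect_rst_sq_mult:
  assumes "T \<subseteq> W" "T' \<subseteq> W"
  shows "expect (1/2) H (\<lambda>A. (rst H c A T)\<^sup>2 * (rst H c A T')\<^sup>2) \<le> 9 ^ k * (n T * n T')"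
proof -
  have "expect (1/2) H (\<lambda>A. (rst H c A T)\<^sup>2 * (rst H c A T')\<^sup>2) \<le>
      wnorm 3 H (\<lambda>U. c (T \<union> U)) * wnorm 3 H (\<lambda>U. c (T' \<union> U))"
    unfolding rst_def by (rule expect_mlin_sg_sq_mult[OF finite_H])
  also have "\<dots> \<le> (3 ^ k * n T) * (3 ^ k * n T')"
    unfolding n_def using assms
    by (intro mult_mono wnorm_le deg_le_shift wnorm_nonneg mult_nonneg_nonneg) auto
  also have "\<dots> = (3 ^ k * 3 ^ k) * (n T * n T')" by simp
  also have "(3::real) ^ k * 3 ^ k = 9 ^ k" by (simp flip: power_mult_distrib)
  finally show ?thesis .
qed

text \<open>With the weights \<open>card T\<close> the sum is the total influence left after the
  restriction, with membership of \<open>v\<close> in \<open>T\<close> it is the influence of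
  \<open>v\<close>. The second moment is at most 9^k times the squared mean because all restricted
  coefficients have degree at most k in the signs on \<open>H\<close>.\<close>

lemma expect_rst_family:
  assumes "F \<subseteq> Pow W" and a: "\<And>T. T \<in> F \<Longrightarrow> 0 \<le> a T"
  shows "expect (1/2) H (\<lambda>A. \<Sum>T\<in>F. a T * (rst H c A T)\<^sup>2) = (\<Sum>T\<in>F. a T * n T)"
    and "expect (1/2) H (\<lambda>A. (\<Sum>T\<in>F. a T * (rst H c A T)\<^sup>2)\<^sup>2) \<le> 9 ^ k * (\<Sum>T\<in>F. a T * n T)\<^sup>2"
proof -
  show "expect (1/2) H (\<lambda>A. \<Sum>T\<in>F. a T * (rst H c A T)\<^sup>2) = (\<Sum>T\<in>F. a T * n T)"
    by (simp only: expect_sum expect_cmult expect_rst_sq)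
  have "expect (1/2) H (\<lambda>A. (\<Sum>T\<in>F. a T * (rst H c A T)\<^sup>2)\<^sup>2) =
     expect (1/2) H (\<lambda>A. \<Sum>T\<in>F. \<Sum>T'\<in>F. (a T * a T') * ((rst H c A T)\<^sup>2 * (rst H c A T')\<^sup>2))"
    unfolding power2_eq_square[of "sum _ _"] sum_product
    by (intro expect_cong sum.cong refl) (simp add: mult_ac)
  also have "\<dots> = (\<Sum>T\<in>F. \<Sum>T'\<in>F. (a T * a T') * expect (1/2) H (\<lambda>A. (rst H c A T)\<^sup>2 * (rst H c A T')\<^sup>2))"
    by (simp only: expect_sum expect_cmult)
  also have "\<dots> \<le> (\<Sum>T\<in>F. \<Sum>T'\<in>F. (a T * a T') * (9 ^ k * (n T * n T')))"
    using assms by (intro sum_mono mult_left_mono expect_rst_sq_mult) auto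
  also have "\<dots> = 9 ^ k * (\<Sum>T\<in>F. a T * n T)\<^sup>2"
  proof -
    have "(\<Sum>T\<in>F. a T * n T)\<^sup>2 = (\<Sum>T\<in>F. \<Sum>T'\<in>F. (a T * n T) * (a T' * n T'))"
      unfolding power2_eq_square by (rule sum_product)
    then show ?thesis unfolding sum_distrib_left by (simp add: sum_distrib_left mult_ac)
  qed
  finally show "expect (1/2) H (\<lambda>A. (\<Sum>T\<in>F. a T * (rst H c A T)\<^sup>2)\<^sup>2) \<le> 9 ^ k * (\<Sum>T\<in>F. a T * n T)\<^sup>2" .
qed

lemma infl_n:
  assumes v: "v \<in> W"
  shows "infl V c v = (\<Sum>T\<in>Pow W. of_bool (v \<in> T) * n T)"
proof -
  have "infl V c v = norm2 (H \<union> W) (\<lambda>S. of_bool (v \<in> S) * c S)"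
  proof -
    have "H \<union> W = V" "v \<in> V" using v H by (auto simp: W_def)
    then show ?thesis
      unfolding norm2_def infl_eq[OF V \<open>v \<in> V\<close>] by (intro sum.cong) auto
  qed
  also have "\<dots> = (\<Sum>T\<in>Pow W. norm2 H (\<lambda>U. of_bool (v \<in> T \<union> U) * c (T \<union> U)))"
    using V finite_H by (intro norm2_union) (auto simp: W_def)
  also have "\<dots> = (\<Sum>T\<in>Pow W. of_bool (v \<in> T) * n T)"
  proof (intro sum.cong refl)
    fix T
    have "norm2 H (\<lambda>U. of_bool (v \<in> T \<union> U) * c (T \<union> U)) = norm2 H (\<lambda>U. of_bool (v \<in> T) * c (T \<union> U))"
      unfolding norm2_def using v by (intro sum.cong) (auto simp: W_def)
    then show "norm2 H (\<lambda>U. of_bool (v \<in> T \<union> U) * c (T \<union> U)) = of_bool (v \<in> T) * n T"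
      by (cases "v \<in> T") (simp_all add: n_def norm2_def)
  qed
  finally show ?thesis .
qed

lemma norm2_n: "norm2 V c = (\<Sum>T\<in>Pow W. n T)"
proof -
  have "norm2 (H \<union> W) c = (\<Sum>T\<in>Pow W. n T)"
    unfolding n_def using V finite_H by (intro norm2_union) (auto simp: W_def)
  then show ?thesis using H by (simp add: W_def Un_absorb1)
qed

lemma finite_W: "finite W" using V by (simp add: W_def)

lemma tail_n: "(\<Sum>v\<in>W. infl V c v) = (\<Sum>T\<in>Pow W. real (card T) * n T)"
  unfolding sum_of_bool_mem[OF finite_W, symmetric] by (intro sum.cong refl infl_n)

text \<open>When the influence outside \<open>H\<close> is tiny, the conditional mean given the values on \<open>H\<close> dominates.\<close>

lemma round_small_tail:
  assumes N: "0 < norm2 V c" and tail: "(\<Sum>v\<in>W. infl V c v) \<le> norm2 V c / (256 * 9 ^ k)"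
  shows "1 / (8 * 9 ^ k) \<le> expect (1/2) H (\<lambda>A. of_bool (1 / 100 \<le>
     expect (1/2) W (\<lambda>B. of_bool (mlin W (rst H c A) (sg B) \<noteq> 0))))"
proof -
  define N where "N = norm2 V c"
  have N0: "0 < N" using N by (simp add: N_def)
  define F where "F = Pow W - {{}}"
  have F: "F \<subseteq> Pow W" "finite F" using finite_W by (auto simp: F_def)
  have PowW: "Pow W = insert {} F" "{} \<notin> F" by (auto simp: F_def)
  have nine: "(1::real) \<le> 9 ^ k" by simp
  define X where "X A = (rst H c A {})\<^sup>2" for A
  have X_nonneg: "0 \<le> X A" for A by (simp add: X_def)
  define Z where "Z A = (\<Sum>T\<in>F. 1 * (rst H c A T)\<^sup>2)" for A
  have tailF: "(\<Sum>T\<in>F. n T) \<le> N / (256 * 9 ^ k)"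
  proof -
    have "(\<Sum>T\<in>F. n T) \<le> (\<Sum>T\<in>F. real (card T) * n T)"
    proof (rule sum_mono)
      fix T assume T: "T \<in> F"
      then have "finite T" "T \<noteq> {}" using finite_W finite_subset by (auto simp: F_def)
      then have "1 \<le> real (card T)" by (simp add: Suc_le_eq card_gt_0_iff)
      from mult_right_mono[OF this n_nonneg[of T]] show "n T \<le> real (card T) * n T" by simp
    qed
    also have "\<dots> = (\<Sum>T\<in>Pow W. real (card T) * n T)" using F by (simp add: PowW)
    finally show ?thesis using tail by (simp add: tail_n N_def)
  qed
  have Nsum: "N = n {} + (\<Sum>T\<in>F. n T)" using F PowW by (simp add: N_def norm2_n)
  have "N / (256 * 9 ^ k) \<le> N / 256" using N0 nine by (intro divide_left_mono) auto
  then have mu: "N / 2 \<le> n {}" using tailF Nsum N0 by linarith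
  have EX: "expect (1/2) H X = n {}" unfolding X_def by (rule expect_rst_sq)
  have "expect (1/2) H (\<lambda>A. (X A)\<^sup>2) \<le> 9 ^ k * (n {})\<^sup>2"
    using expect_rst_sq_mult[of "{}" "{}"] by (simp add: X_def power2_eq_square)
  then have "(1 - 1 / 2)\<^sup>2 / 9 ^ k \<le> expect (1/2) H (\<lambda>A. of_bool (1 / 2 * n {} \<le> X A))"
    using mu N0 by (intro second_moment_lower_bound[OF _ _ finite_H _ EX]) (simp_all add: X_nonneg)
  then have P1: "1 / (4 * 9 ^ k) \<le> expect (1/2) H (\<lambda>A. of_bool (1 / 2 * n {} \<le> X A))"
    by (simp add: power2_eq_square)
  have EZ: "expect (1/2) H Z = (\<Sum>T\<in>F. n T)"
    using expect_rst_family(1)[OF F(1), of "\<lambda>_. 1"] by (simp add: Z_def[abs_def])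
  have P2: "expect (1/2) H (\<lambda>A. of_bool (N / 32 \<le> Z A)) \<le> 1 / (8 * 9 ^ k)"
  proof -
    have "expect (1/2) H (\<lambda>A. of_bool (N / 32 \<le> Z A)) \<le> expect (1/2) H Z / (N / 32)"
      using N0 by (intro markov_bound) (auto simp: Z_def intro!: sum_nonneg)
    also have "\<dots> \<le> (N / (256 * 9 ^ k)) / (N / 32)"
      unfolding EZ using tailF N0 by (intro divide_right_mono) auto
    also have "\<dots> = 1 / (8 * 9 ^ k)" using N0 by (simp add: field_simps)
    finally show ?thesis .
  qed
  \<comment> \<open>Here the squared mean is at least N/4 and the variance below N/32. The form
    vanishes only if its centred part cancels the mean, which by Chebyshev has probability at most
    1/8.\<close>
  have good: "1 / 100 \<le> expect (1/2) W (\<lambda>B. of_bool (mlin W (rst H c A) (sg B) \<noteq> 0))"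
    if A: "1 / 2 * n {} \<le> X A" "Z A < N / 32" for A
  proof -
    have XA: "0 < X A" "N / 4 \<le> X A" using A mu N0 by auto
    define r where "r T = (if T = {} then 0 else rst H c A T)" for T
    have r0: "r {} = 0" by (simp add: r_def)
    have rF: "r T = rst H c A T" if "T \<in> F" for T using that by (auto simp: r_def F_def)
    have split: "mlin W (rst H c A) (sg B) = rst H c A {} + mlin W r (sg B)" for B
      unfolding mlin_def PowW(1) sum.insert[OF F(2) PowW(2)] r0 by (simp add: rF cong: sum.cong)
    have "norm2 W r = Z A"
      unfolding norm2_def PowW(1) Z_def sum.insert[OF F(2) PowW(2)] r0 by (simp add: rF cong: sum.cong)
    then have Er: "expect (1/2) W (\<lambda>B. (mlin W r (sg B))\<^sup>2) = Z A"
      by (simp add: expect_mlin_sg_sq[OF finite_W])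
    have "expect (1/2) W (\<lambda>B. of_bool (X A \<le> (mlin W r (sg B))\<^sup>2)) \<le> Z A / X A"
      unfolding Er[symmetric] using XA by (intro markov_bound) auto
    also have "\<dots> \<le> (N / 32) / (N / 4)" using A XA N0 by (intro frac_le) auto
    also have "\<dots> = 1 / 8" using N0 by simp
    finally have m: "expect (1/2) W (\<lambda>B. of_bool (X A \<le> (mlin W r (sg B))\<^sup>2)) \<le> 1 / 8" .
    have "expect (1/2) W (\<lambda>B. 1 - of_bool (X A \<le> (mlin W r (sg B))\<^sup>2)) \<le>
       expect (1/2) W (\<lambda>B. of_bool (mlin W (rst H c A) (sg B) \<noteq> 0))"
    proof (intro expect_mono)
      fix B
      have "X A = (mlin W r (sg B))\<^sup>2" if "mlin W (rst H c A) (sg B) = 0"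
      proof -
        have "rst H c A {} = - mlin W r (sg B)" using that split[of B] by simp
        then show ?thesis by (simp add: X_def)
      qed
      then show "1 - of_bool (X A \<le> (mlin W r (sg B))\<^sup>2) \<le> (of_bool (mlin W (rst H c A) (sg B) \<noteq> 0) :: real)"
        by auto
    qed auto
    then have "1 - expect (1/2) W (\<lambda>B. of_bool (X A \<le> (mlin W r (sg B))\<^sup>2)) \<le>
       expect (1/2) W (\<lambda>B. of_bool (mlin W (rst H c A) (sg B) \<noteq> 0))"
      by (simp only: expect_diff expect_const[OF finite_W])
    then show ?thesis using m by linarith
  qed
  \<comment> \<open>A large mean has probability at least 1 / (4 * 9^k) and a large variance at most
    half of that. The difference remains for both good events together.\<close>
  have "expect (1/2) H (\<lambda>A. of_bool (1 / 2 * n {} \<le> X A) - of_bool (N / 32 \<le> Z A)) \<le>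
     expect (1/2) H (\<lambda>A. of_bool (1 / 100 \<le>
     expect (1/2) W (\<lambda>B. of_bool (mlin W (rst H c A) (sg B) \<noteq> 0))))"
  proof (intro expect_mono)
    fix A
    show "of_bool (1 / 2 * n {} \<le> X A) - of_bool (N / 32 \<le> Z A) \<le>
      (of_bool (1 / 100 \<le> expect (1/2) W (\<lambda>B. of_bool (mlin W (rst H c A) (sg B) \<noteq> 0))) :: real)"
      by (rule of_bool_diff_le) (rule good, simp_all only: not_le)
  qed auto
  moreover have "1 / (4 * 9 ^ k) - 1 / (8 * 9 ^ k) = (1 / (8 * 9 ^ k) :: real)" by (simp add: field_simps)
  ultimately show ?thesis using P1 P2 unfolding expect_diff by linarith
qed

text \<open>The total influence \<open>Y\<close> keeps half its mean with probability at least 1 /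
  (4 * 9^k), while Markov controls the sum \<open>Z\<close> of squared influences, whose mean is
  small because every single influence is. As the degree is at most k, \<open>Y\<close> is at most k
  times the norm, so a large \<open>Y\<close> forces the norm to be large and the restricted form is
  regular.\<close>

lemma round_regular:
  assumes k: "0 < k" and tail0: "0 < (\<Sum>v\<in>W. infl V c v)"
    and tail: "\<And>v. v \<in> W \<Longrightarrow> infl V c v \<le> damp k * (\<Sum>u\<in>W. infl V c u)"
  shows "1 / (8 * 9 ^ k) \<le> expect (1/2) H (\<lambda>A. of_bool (1 / 100 \<le>
     expect (1/2) W (\<lambda>B. of_bool (mlin W (rst H c A) (sg B) \<noteq> 0))))"
proof -
  define t where "t = (\<Sum>u\<in>W. infl V c u)"
  have t: "0 < t" using tail0 by (simp add: t_def)
  define Y where "Y A = (\<Sum>T\<in>Pow W. real (card T) * (rst H c A T)\<^sup>2)" for A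
  define Z where "Z A = (\<Sum>v\<in>W. (infl W (rst H c A) v)\<^sup>2)" for A
  define a where "a = 8 * 9 ^ k * (9 ^ k * damp k * t\<^sup>2)"
  have a0: "0 < a" using t damp_bounds(1)[OF k] by (simp add: a_def)
  have Y_nonneg: "0 \<le> Y A" for A by (auto simp: Y_def intro!: sum_nonneg)
  have EY: "expect (1/2) H Y = t" "expect (1/2) H (\<lambda>A. (Y A)\<^sup>2) \<le> 9 ^ k * t\<^sup>2"
    unfolding t_def tail_n Y_def[abs_def] by (rule expect_rst_family; simp)+
  have "(1 - 1 / 2)\<^sup>2 / 9 ^ k \<le> expect (1/2) H (\<lambda>A. of_bool (1 / 2 * t \<le> Y A))"
    using t EY(2) by (intro second_moment_lower_bound[OF _ _ finite_H _ EY(1)]) (simp_all add: Y_nonneg)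
  then have P1: "1 / (4 * 9 ^ k) \<le> expect (1/2) H (\<lambda>A. of_bool (1 / 2 * t \<le> Y A))"
    by (simp add: power2_eq_square)
  have EZ: "expect (1/2) H Z \<le> 9 ^ k * damp k * t\<^sup>2"
  proof -
    have "expect (1/2) H Z = (\<Sum>v\<in>W. expect (1/2) H (\<lambda>A. (infl W (rst H c A) v)\<^sup>2))"
      unfolding Z_def[abs_def] by (rule expect_sum)
    also have "\<dots> \<le> (\<Sum>v\<in>W. 9 ^ k * (damp k * t) * infl V c v)"
    proof (rule sum_mono)
      fix v assume v: "v \<in> W"
      have "expect (1/2) H (\<lambda>A. (infl W (rst H c A) v)\<^sup>2) =
         expect (1/2) H (\<lambda>A. (\<Sum>T\<in>Pow W. of_bool (v \<in> T) * (rst H c A T)\<^sup>2)\<^sup>2)"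
        by (simp only: infl_eq[OF finite_W v])
      also have "\<dots> \<le> 9 ^ k * (infl V c v)\<^sup>2"
        unfolding infl_n[OF v] by (rule expect_rst_family(2)) auto
      also have "\<dots> \<le> 9 ^ k * (damp k * t * infl V c v)"
        unfolding power2_eq_square t_def using tail[OF v] infl_nonneg by (intro mult_left_mono mult_right_mono) auto
      finally show "expect (1/2) H (\<lambda>A. (infl W (rst H c A) v)\<^sup>2) \<le> 9 ^ k * (damp k * t) * infl V c v"
        by (simp add: mult.assoc)
    qed
    also have "\<dots> = 9 ^ k * damp k * t\<^sup>2"
      by (simp add: t_def power2_eq_square flip: sum_distrib_left)
    finally show ?thesis .
  qed
  have P2: "expect (1/2) H (\<lambda>A. of_bool (a \<le> Z A)) \<le> 1 / (8 * 9 ^ k)"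
  proof -
    have "expect (1/2) H (\<lambda>A. of_bool (a \<le> Z A)) \<le> expect (1/2) H Z / a"
      using a0 by (intro markov_bound) (auto simp: Z_def intro!: sum_nonneg)
    also have "\<dots> \<le> (9 ^ k * damp k * t\<^sup>2) / a" using EZ a0 by (intro divide_right_mono) auto
    also have "\<dots> = 1 / (8 * 9 ^ k)" using t damp_bounds(1)[OF k] by (simp add: a_def)
    finally show ?thesis .
  qed
  have good: "1 / 100 \<le> expect (1/2) W (\<lambda>B. of_bool (mlin W (rst H c A) (sg B) \<noteq> 0))"
    if A: "1 / 2 * t \<le> Y A" "Z A < a" for A
  proof (rule regular_nonzero[OF finite_W k])
    define M where "M = norm2 W (rst H c A)"
    show d: "deg_le W k (rst H c A)" unfolding W_def by (rule deg_le_rst[OF V H deg])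
    have "Y A = (\<Sum>v\<in>W. infl W (rst H c A) v)"
      unfolding Y_def by (rule sum_infl[OF finite_W, symmetric])
    also have "\<dots> \<le> k * M" unfolding M_def by (rule sum_infl_le[OF finite_W d])
    finally have YM: "Y A \<le> k * M" .
    then have "0 < real k * M" using A t by linarith
    then show M0: "0 < norm2 W (rst H c A)" unfolding M_def[symmetric] using k by (simp add: zero_less_mult_iff)
    have "t\<^sup>2 \<le> (2 * (k * M))\<^sup>2" using A YM t by (intro power_mono) auto
    also have "\<dots> = 4 * ((real k)\<^sup>2 * M\<^sup>2)" by (simp add: power_mult_distrib)
    finally have t2: "t\<^sup>2 \<le> 4 * ((real k)\<^sup>2 * M\<^sup>2)" .
    have "a \<le> 8 * 9 ^ k * (9 ^ k * damp k * (4 * ((real k)\<^sup>2 * M\<^sup>2)))"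
      unfolding a_def using t2 damp_bounds(1)[OF k] by (intro mult_left_mono) auto
    also have "\<dots> = (9 ^ k * 9 ^ k) * (32 * damp k * (real k)\<^sup>2) * M\<^sup>2" by simp
    also have "(9::real) ^ k * 9 ^ k = 81 ^ k" by (simp flip: power_mult_distrib)
    also have "81 ^ k * (32 * damp k * (real k)\<^sup>2) = reg k" using k by (simp add: damp_def)
    finally show "(\<Sum>v\<in>W. (infl W (rst H c A) v)\<^sup>2) \<le> reg k * (norm2 W (rst H c A))\<^sup>2"
      using A(2) by (simp add: Z_def M_def)
  qed
  have "expect (1/2) H (\<lambda>A. of_bool (1 / 2 * t \<le> Y A) - of_bool (a \<le> Z A)) \<le>
     expect (1/2) H (\<lambda>A. of_bool (1 / 100 \<le>
     expect (1/2) W (\<lambda>B. of_bool (mlin W (rst H c A) (sg B) \<noteq> 0))))"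
  proof (intro expect_mono)
    fix A
    show "of_bool (1 / 2 * t \<le> Y A) - of_bool (a \<le> Z A) \<le>
      (of_bool (1 / 100 \<le> expect (1/2) W (\<lambda>B. of_bool (mlin W (rst H c A) (sg B) \<noteq> 0))) :: real)"
      by (rule of_bool_diff_le) (rule good, simp_all only: not_le)
  qed auto
  moreover have "1 / (4 * 9 ^ k) - 1 / (8 * 9 ^ k) = (1 / (8 * 9 ^ k) :: real)" by (simp add: field_simps)
  ultimately show ?thesis using P1 P2 unfolding expect_diff by linarith
qed

end

lemma depth_decay:
  assumes "0 < k"
  shows "(1 - damp k) ^ depth k * real k \<le> 1 / (256 * 9 ^ k)"
proof -
  have "(1 - damp k) ^ depth k \<le> exp (- damp k) ^ depth k"
    using damp_bounds[OF assms] exp_ge_add_one_self[of "- damp k"] by (intro power_mono) auto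
  also have "\<dots> = exp (- (real (depth k) * damp k))" by (simp flip: exp_of_nat_mult)
  also have "\<dots> = inverse (exp (256 * 9 ^ k * real k))" by (simp only: depth_damp[OF assms] exp_minus)
  also have "\<dots> \<le> inverse (256 * 9 ^ k * real k)"
  proof (rule le_imp_inverse_le)
    show "256 * 9 ^ k * real k \<le> exp (256 * 9 ^ k * real k)"
      using exp_ge_add_one_self[of "256 * 9 ^ k * real k"] by linarith
  qed (use assms in simp)
  finally have "(1 - damp k) ^ depth k * real k \<le> inverse (256 * 9 ^ k * real k) * real k"
    by (intro mult_right_mono) auto
  then show ?thesis using assms by (simp add: field_simps)
qed

text \<open>The two outcomes of the greedy choice after \<open>depth k\<close> steps correspond to
  the two kinds of successful round.\<close>

lemma restriction_round:
  assumes V: "finite V" and k: "0 < k" and deg: "deg_le V k c" and N: "0 < norm2 V c"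
  shows "\<exists>H\<subseteq>V. card H \<le> depth k \<and> 1 / (8 * 9 ^ k) \<le> expect (1/2) H (\<lambda>A. of_bool (1 / 100 \<le>
     expect (1/2) (V - H) (\<lambda>B. of_bool (mlin (V - H) (rst H c A) (sg B) \<noteq> 0))))"
proof -
  obtain H where H: "H \<subseteq> V" "card H \<le> depth k" and
    alt: "(\<Sum>v\<in>V - H. infl V c v) \<le> (1 - damp k) ^ depth k * (k * norm2 V c) \<or>
     (\<forall>v\<in>V - H. infl V c v \<le> damp k * (\<Sum>u\<in>V - H. infl V c u))"
    using influential_set[OF V deg damp_bounds[OF k], of "depth k"] by blast
  show ?thesis
  proof (intro exI[of _ H] conjI H)
    show "1 / (8 * 9 ^ k) \<le> expect (1/2) H (\<lambda>A. of_bool (1 / 100 \<le>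
     expect (1/2) (V - H) (\<lambda>B. of_bool (mlin (V - H) (rst H c A) (sg B) \<noteq> 0))))"
    proof (cases "(\<Sum>v\<in>V - H. infl V c v) \<le> norm2 V c / (256 * 9 ^ k)")
      case True
      then show ?thesis by (intro round_small_tail[OF V H(1) deg N])
    next
      case False
      have "(1 - damp k) ^ depth k * (k * norm2 V c) \<le> norm2 V c / (256 * 9 ^ k)"
        using mult_right_mono[OF depth_decay[OF k], of "norm2 V c"] N by (simp add: mult.assoc)
      then have "\<forall>v\<in>V - H. infl V c v \<le> damp k * (\<Sum>u\<in>V - H. infl V c u)" using alt False by linarith
      moreover have "0 < norm2 V c / (256 * 9 ^ k)" using N by simp
      then have "0 < (\<Sum>v\<in>V - H. infl V c v)" using False by linarith
      ultimately show ?thesis by (intro round_regular[OF V H(1) deg k]) auto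
    qed
  qed
qed

section \<open>Zero restrictions\<close>

text \<open>Only coefficients of larger sets could contribute besides \<open>c S\<close>, and these
  vanish. So top coefficients outside \<open>H\<close> survive every assignment, and rounds can be
  iterated.\<close>

lemma rst_top:
  assumes V: "finite V" and H: "H \<subseteq> V" and deg: "deg_le V s c" and S: "S \<subseteq> V" "S \<inter> H = {}" "card S = s"
  shows "rst H c A S = c S"
proof -
  have H': "finite H" using V H finite_subset by auto
  have z: "c (S \<union> U) = 0" if U: "U \<subseteq> H" "U \<noteq> {}" for U
  proof (rule ccontr)
    assume "c (S \<union> U) \<noteq> 0"
    moreover have "S \<union> U \<subseteq> V" using S U H by auto
    ultimately have "card (S \<union> U) \<le> s" using deg by (auto simp: deg_le_def)
    moreover have f: "finite S" "finite U" using V S(1) H' U finite_subset by auto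
    then have "card (S \<union> U) = card S + card U" using S U by (intro card_Un_disjoint) auto
    ultimately have "card U = 0" using S by simp
    then show False using f U by simp
  qed
  have "rst H c A S = (\<Sum>U\<in>{{}}. c (S \<union> U) * (\<Prod>v\<in>U. sg A v))"
    unfolding rst_def mlin_def using H' by (intro sum.mono_neutral_right) (auto simp: z)
  then show ?thesis by simp
qed

lemma card_disjoint_meeting:
  assumes "disjoint F" "finite H" "\<And>S. S \<in> F \<Longrightarrow> S \<inter> H \<noteq> {}"
  shows "card F \<le> card H"
proof -
  define f where "f S = (SOME x. x \<in> S \<inter> H)" for S
  have f: "f S \<in> S \<inter> H" if "S \<in> F" for S
  proof -
    have "\<exists>x. x \<in> S \<inter> H" using assms(3)[OF that] by blast
    then show ?thesis unfolding f_def by (rule someI_ex)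
  qed
  have "inj_on f F"
  proof (rule inj_onI)
    fix S T assume ST: "S \<in> F" "T \<in> F" "f S = f T"
    have "f S \<in> S" using f[OF ST(1)] by blast
    moreover have "f S \<in> T" using f[OF ST(2)] ST(3) by simp
    ultimately have "S \<inter> T \<noteq> {}" by blast
    then show "S = T" using disjointD[OF assms(1) ST(1,2)] by blast
  qed
  moreover have "f ` F \<subseteq> H" using f by blast
  ultimately show ?thesis by (rule card_inj_on_le[OF _ _ assms(2)])
qed

text \<open>By disjointness a round destroys at most \<open>depth k\<close> members of
  \<open>F\<close>, one per fixed variable, so \<open>F\<close> pays for \<open>j\<close> rounds.
  The actual degree \<open>s\<close> is kept apart from \<open>k\<close>, which fixes the constants
  while the degree drops in the restriction chain.\<close>

lemma many_top_coeffs: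
  assumes "finite V" "0 < k" "s \<le> k" "deg_le V s c" "F \<subseteq> Pow V" "disjoint F"
    and "\<And>S. S \<in> F \<Longrightarrow> card S = s \<and> c S \<noteq> 0" and "j * depth k < card F"
  shows "(1 - (1 - 1 / (8 * 9 ^ k)) ^ j) / 100 \<le> expect (1/2) V (\<lambda>A. of_bool (mlin V c (sg A) \<noteq> 0))"
  using assms
proof (induction j arbitrary: V c F)
  case 0
  have "0 \<le> expect (1/2) V (\<lambda>A. of_bool (mlin V c (sg A) \<noteq> 0))" by (intro expect_nonneg) auto
  then show ?case by simp
next
  case (Suc j)
  note V = Suc.prems(1) and k = Suc.prems(2) and deg = Suc.prems(4) and F = Suc.prems(5-7)
  have degk: "deg_le V k c" using deg \<open>s \<le> k\<close> unfolding deg_le_def by (meson le_trans)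
  have "F \<noteq> {}" using Suc.prems(8) by auto
  then obtain S0 where S0: "S0 \<in> F" by blast
  have "(c S0)\<^sup>2 \<le> norm2 V c"
    unfolding norm2_def using S0 F(1) V by (intro member_le_sum[where f = "\<lambda>S. (c S)\<^sup>2"]) auto
  moreover have "0 < (c S0)\<^sup>2" using F(3)[OF S0] by simp
  ultimately have N: "0 < norm2 V c" by linarith
  obtain H where H: "H \<subseteq> V" "card H \<le> depth k" and
    good: "1 / (8 * 9 ^ k) \<le> expect (1/2) H (\<lambda>A. of_bool (1 / 100 \<le>
       expect (1/2) (V - H) (\<lambda>B. of_bool (mlin (V - H) (rst H c A) (sg B) \<noteq> 0))))"
    using restriction_round[OF V k degk N] by blast
  have H': "finite H" using V H finite_subset by auto
  define p where "p A = expect (1/2) (V - H) (\<lambda>B. of_bool (mlin (V - H) (rst H c A) (sg B) \<noteq> 0))" for A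
  define g where "g = 1 / (8 * 9 ^ k :: real)"
  define \<beta> where "\<beta> = 1 - (1 - g) ^ j"
  have nine: "(1::real) \<le> 9 ^ k" by simp
  then have e: "1 \<le> 8 * (9::real) ^ k" by linarith
  have g: "0 < g" "g \<le> 1" by (simp_all add: g_def divide_le_eq e)
  then have b1: "\<beta> \<le> 1" by (simp add: \<beta>_def)
  \<comment> \<open>This holds for every assignment and not just for typical ones, so the gain of a
    successful round is added on top of it: \<beta> becomes \<beta> + (1 - \<beta>) g.\<close>
  have IH: "\<beta> / 100 \<le> p A" for A
    unfolding \<beta>_def p_def g_def
  proof (rule Suc.IH[where F = "{S \<in> F. S \<inter> H = {}}"])
    show "finite (V - H)" "0 < k" "s \<le> k" using V k \<open>s \<le> k\<close> by auto
    show "deg_le (V - H) s (rst H c A)" by (rule deg_le_rst[OF V H(1) deg])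
    show "{S \<in> F. S \<inter> H = {}} \<subseteq> Pow (V - H)" using F(1) by auto
    show "disjoint {S \<in> F. S \<inter> H = {}}" using F(2) by (auto simp: disjoint_def)
    show "card S = s \<and> rst H c A S \<noteq> 0" if "S \<in> {S \<in> F. S \<inter> H = {}}" for S
    proof -
      have S: "S \<in> F" "S \<inter> H = {}" using that by auto
      then have "S \<subseteq> V" using F(1) by blast
      then have "rst H c A S = c S" using S F(3)[OF S(1)] by (intro rst_top[OF V H(1) deg]) auto
      then show ?thesis using F(3)[OF S(1)] by simp
    qed
    have finF: "finite F" using F(1) V by (meson finite_Pow_iff finite_subset)
    have "disjoint {S \<in> F. S \<inter> H \<noteq> {}}" using F(2) by (auto simp: disjoint_def)
    then have "card {S \<in> F. S \<inter> H \<noteq> {}} \<le> card H"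
      using H' by (intro card_disjoint_meeting) auto
    moreover have "card F = card {S \<in> F. S \<inter> H = {}} + card {S \<in> F. S \<inter> H \<noteq> {}}"
    proof -
      have "F = {S \<in> F. S \<inter> H = {}} \<union> {S \<in> F. S \<inter> H \<noteq> {}}" by blast
      moreover have "card ({S \<in> F. S \<inter> H = {}} \<union> {S \<in> F. S \<inter> H \<noteq> {}}) =
          card {S \<in> F. S \<inter> H = {}} + card {S \<in> F. S \<inter> H \<noteq> {}}"
        using finF by (intro card_Un_disjoint) auto
      ultimately show ?thesis by simp
    qed
    ultimately show "j * depth k < card {S \<in> F. S \<inter> H = {}}"
      using Suc.prems(8) H(2) by simp
  qed
  have "(1 - (1 - g) ^ Suc j) / 100 = (\<beta> + (1 - \<beta>) * g) / 100"
    by (simp add: \<beta>_def algebra_simps)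
  also have "\<dots> \<le> (\<beta> + (1 - \<beta>) * expect (1/2) H (\<lambda>A. of_bool (1 / 100 \<le> p A))) / 100"
  proof -
    have "g \<le> expect (1/2) H (\<lambda>A. of_bool (1 / 100 \<le> p A))" unfolding p_def g_def by (rule good)
    then show ?thesis using b1 by (intro divide_right_mono add_left_mono mult_left_mono) simp_all
  qed
  also have "\<dots> = expect (1/2) H (\<lambda>A. (\<beta> + (1 - \<beta>) * of_bool (1 / 100 \<le> p A)) / 100)"
    by (simp only: expect_divide expect_add expect_cmult expect_const[OF H'])
  also have "\<dots> \<le> expect (1/2) H p"
  proof (intro expect_mono)
    fix A
    show "(\<beta> + (1 - \<beta>) * of_bool (1 / 100 \<le> p A)) / 100 \<le> p A"
      using IH[of A] by (cases "1 / 100 \<le> p A") auto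
  qed auto
  also have "\<dots> = expect (1/2) V (\<lambda>A. of_bool (mlin V c (sg A) \<noteq> 0))"
    unfolding expect_split[OF V H(1), of _ "\<lambda>A. of_bool (mlin V c (sg A) \<noteq> 0)"]
  proof (rule expect_cong)
    fix A assume A: "A \<subseteq> H"
    show "p A = expect (1/2) (V - H) (\<lambda>B. of_bool (mlin V c (sg (A \<union> B)) \<noteq> 0))"
      unfolding p_def by (rule expect_cong) (simp only: mlin_rst[OF V H(1) A])
  qed
  finally show ?case by (simp add: g_def)
qed

text \<open>The value at the 0/1 indicator vector of \<open>A\<close>. Setting variables to zero
  means shrinking the ambient set of \<open>A\<close> and leaves \<open>c\<close> unchanged, in
  contrast to \<open>rst\<close>.\<close>

definition setval :: "('v set \<Rightarrow> real) \<Rightarrow> 'v set \<Rightarrow> real" where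
  "setval c A = (\<Sum>S\<in>Pow A. c S)"

text \<open>Change of basis from the variables \<open>x\<close> with values \<open>0/1\<close> to the signs \<open>2 x - 1\<close>.\<close>

definition sgcoeff :: "'v set \<Rightarrow> ('v set \<Rightarrow> real) \<Rightarrow> 'v set \<Rightarrow> real" where
  "sgcoeff X c T = (\<Sum>S\<in>{S \<in> Pow X. T \<subseteq> S}. c S / 2 ^ card S)"

lemma setval_eq_mlin:
  assumes X: "finite X" and A: "A \<subseteq> X"
  shows "setval c A = mlin X (sgcoeff X c) (sg A)"
proof -
  \<comment> \<open>Expansion of the product of (1 + sign) / 2 over \<open>S\<close>, which is the
    monomial of \<open>S\<close> at a 0/1 point.\<close>
  have one: "(\<Sum>T\<in>Pow S. (\<Prod>v\<in>T. sg A v)) / 2 ^ card S = of_bool (S \<subseteq> A)" if "S \<subseteq> X" for S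
  proof -
    have S: "finite S" using that X finite_subset by auto
    have "(\<Sum>T\<in>Pow S. (\<Prod>v\<in>T. sg A v)) = (\<Prod>v\<in>S. sg A v + 1)"
      using prod_add[OF S, of "sg A" "\<lambda>_. 1"] by simp
    also have "\<dots> = (\<Prod>v\<in>S. 2 * of_bool (v \<in> A))"
      by (intro prod.cong) (auto simp: sg_def)
    also have "\<dots> = 2 ^ card S * of_bool (S \<subseteq> A)"
    proof (cases "S \<subseteq> A")
      case True
      then have "(\<Prod>v\<in>S. 2 * of_bool (v \<in> A)) = (\<Prod>v\<in>S. 2::real)" by (intro prod.cong) auto
      then show ?thesis using True by simp
    next
      case False
      then show ?thesis using S by (auto intro!: prod_zero)
    qed
    finally show ?thesis by simp
  qed
  have "mlin X (sgcoeff X c) (sg A) =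
     (\<Sum>T\<in>Pow X. \<Sum>S\<in>Pow X. if T \<subseteq> S then c S / 2 ^ card S * (\<Prod>v\<in>T. sg A v) else 0)"
    unfolding mlin_def sgcoeff_def sum_distrib_right using X
    by (intro sum.cong refl sum.inter_filter) auto
  also have "\<dots> = (\<Sum>S\<in>Pow X. \<Sum>T\<in>Pow X. if T \<subseteq> S then c S / 2 ^ card S * (\<Prod>v\<in>T. sg A v) else 0)"
    by (rule sum.swap)
  also have "\<dots> = (\<Sum>S\<in>Pow X. c S * of_bool (S \<subseteq> A))"
  proof (intro sum.cong refl)
    fix S assume S: "S \<in> Pow X"
    have "(\<Sum>T\<in>Pow X. if T \<subseteq> S then c S / 2 ^ card S * (\<Prod>v\<in>T. sg A v) else 0) =
       (\<Sum>T\<in>{T \<in> Pow X. T \<subseteq> S}. c S / 2 ^ card S * (\<Prod>v\<in>T. sg A v))"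
      using X by (intro sum.inter_filter[symmetric]) auto
    also have "{T \<in> Pow X. T \<subseteq> S} = Pow S" using S by auto
    also have "(\<Sum>T\<in>Pow S. c S / 2 ^ card S * (\<Prod>v\<in>T. sg A v)) =
       c S * ((\<Sum>T\<in>Pow S. (\<Prod>v\<in>T. sg A v)) / 2 ^ card S)"
      by (simp add: sum_distrib_left sum_divide_distrib)
    finally show "(\<Sum>T\<in>Pow X. if T \<subseteq> S then c S / 2 ^ card S * (\<Prod>v\<in>T. sg A v) else 0) = c S * of_bool (S \<subseteq> A)"
      using S by (simp only: one PowD)
  qed
  also have "\<dots> = (\<Sum>S\<in>Pow A. c S)"
    using X A by (intro sum.mono_neutral_cong_right) auto
  finally show ?thesis by (simp add: setval_def)
qed

lemma deg_le_sgcoeff: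
  assumes X: "finite X" and deg: "deg_le X s c"
  shows "deg_le X s (sgcoeff X c)"
  unfolding deg_le_def
proof (intro allI impI)
  fix T assume T: "T \<subseteq> X" "sgcoeff X c T \<noteq> 0"
  have "\<exists>S\<subseteq>X. T \<subseteq> S \<and> c S \<noteq> 0"
  proof (rule ccontr)
    assume "\<not> ?thesis"
    then have "sgcoeff X c T = 0" unfolding sgcoeff_def by (intro sum.neutral) auto
    then show False using T by simp
  qed
  then obtain S where S: "S \<subseteq> X" "T \<subseteq> S" "c S \<noteq> 0" by blast
  then have "card T \<le> card S" using X finite_subset by (intro card_mono) auto
  also have "\<dots> \<le> s" using S deg by (auto simp: deg_le_def)
  finally show "card T \<le> s" .
qed

text \<open>The change of basis only scales the top coefficients, so disjoint top monomials in 0/1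
  variables remain such in the signs.\<close>

lemma sgcoeff_top:
  assumes X: "finite X" and deg: "deg_le X s c" and T: "T \<subseteq> X" "card T = s"
  shows "sgcoeff X c T = c T / 2 ^ s"
proof -
  have z: "c S = 0" if S: "S \<subseteq> X" "T \<subseteq> S" "S \<noteq> T" for S
  proof (rule ccontr)
    assume "c S \<noteq> 0"
    then have "card S \<le> s" using deg S(1) unfolding deg_le_def by blast
    moreover have "finite S" using S(1) X by (rule finite_subset)
    then have "card T < card S" by (rule psubset_card_mono) (use S in blast)
    ultimately show False using T by simp
  qed
  have "sgcoeff X c T = (\<Sum>S\<in>{T}. c S / 2 ^ card S)"
    unfolding sgcoeff_def
  proof (rule sum.mono_neutral_right)
    show "\<forall>S\<in>{S \<in> Pow X. T \<subseteq> S} - {T}. c S / 2 ^ card S = 0" using z by simp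
    show "finite {S \<in> Pow X. T \<subseteq> S}" using X by simp
    show "{T} \<subseteq> {S \<in> Pow X. T \<subseteq> S}" using T(1) by simp
  qed
  then show ?thesis unfolding T(2)[symmetric] by simp
qed

text \<open>Enough monomials for 8 * 9^k rounds. As each succeeds with probability at least 1 / (8 *
  9^k), all fail with probability at most 1/e.\<close>

definition rank_bound :: "nat \<Rightarrow> nat" where
  "rank_bound k = 8 * 9 ^ k * depth k"

lemma many_top_monomials:
  assumes X: "finite X" and k: "0 < k" "s \<le> k" and deg: "deg_le X s c" and F: "F \<subseteq> Pow X" "disjoint F"
    and top: "\<And>S. S \<in> F \<Longrightarrow> card S = s \<and> c S \<noteq> 0" and card: "rank_bound k < card F"
  shows "1 / 200 \<le> expect (1/2) X (\<lambda>A. of_bool (setval c A \<noteq> 0))"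
proof -
  define B where "B = (8 * 9 ^ k :: nat)"
  have B: "1 \<le> B" by (simp add: B_def)
  have "(1 - 1 / real B) ^ B \<le> exp (- (1 / real B)) ^ B"
    using B exp_ge_add_one_self[of "- (1 / real B)"] by (intro power_mono) auto
  also have "\<dots> = exp (- 1)" using B by (simp flip: exp_of_nat_mult)
  also have "\<dots> \<le> 1 / 2" using exp_ge_add_one_self[of 1] by (simp add: exp_minus field_simps)
  finally have "1 / 200 \<le> (1 - (1 - 1 / real B) ^ B) / 100" by simp
  also have "\<dots> \<le> expect (1/2) X (\<lambda>A. of_bool (mlin X (sgcoeff X c) (sg A) \<noteq> 0))"
  proof -
    have "(1 - (1 - 1 / (8 * 9 ^ k)) ^ B) / 100 \<le> expect (1/2) X (\<lambda>A. of_bool (mlin X (sgcoeff X c) (sg A) \<noteq> 0))"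
    proof (rule many_top_coeffs[OF X k deg_le_sgcoeff[OF X deg] F])
      show "card S = s \<and> sgcoeff X c S \<noteq> 0" if "S \<in> F" for S
        using top[OF that] sgcoeff_top[OF X deg, of S] F(1) that by auto
      show "B * depth k < card F" using card by (simp add: B_def rank_bound_def)
    qed
    then show ?thesis by (simp add: B_def)
  qed
  also have "\<dots> = expect (1/2) X (\<lambda>A. of_bool (setval c A \<noteq> 0))"
    by (intro expect_cong arg_cong[where f = of_bool]) (simp add: setval_eq_mlin[OF X])
  finally show ?thesis .
qed

text \<open>Zeroing all but a random \<open>\<rho>\<close>-fraction of the variables. If the monomials of top degree contain no large
  disjoint family, then a small set \<open>H\<close> hits them all, and the restriction most likely avoids \<open>H\<close> and
  so lowers the degree.\<close>

lemma restriction_chain: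
  fixes \<rho> :: real and X :: "'v set"
  assumes "finite X" "c {} \<noteq> 0" "deg_le X s c" "s \<le> k" "0 < k" "0 \<le> \<rho>" "\<rho> * real (rank_bound k * k) \<le> 1"
    and "\<rho> \<le> 1"
  shows "(1 - \<rho> * real (rank_bound k * k)) ^ s / 200 \<le> (\<Sum>j\<le>s. expect (\<rho> ^ j / 2) X (\<lambda>A. of_bool (setval c A \<noteq> 0)))"
  using assms
proof (induction s arbitrary: X)
  case 0
  have "setval c A = c {}" if A: "A \<subseteq> X" for A
  proof -
    have z: "c S = 0" if "S \<subseteq> A" "S \<noteq> {}" for S
    proof (rule ccontr)
      assume "c S \<noteq> 0"
      then have "card S = 0" using 0(3) that A by (auto simp: deg_le_def)
      moreover have "finite S" using that A 0(1) by (meson finite_subset)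
      ultimately show False using that by simp
    qed
    have "finite A" using A 0(1) finite_subset by auto
    then have "setval c A = (\<Sum>S\<in>{{}}. c S)"
      unfolding setval_def by (intro sum.mono_neutral_right) (auto simp: z)
    then show ?thesis by simp
  qed
  then have "expect (1/2) X (\<lambda>A. of_bool (setval c A \<noteq> 0)) = expect (1/2) X (\<lambda>A. 1)"
    using 0(2) by (intro expect_cong) simp
  then show ?case using 0(1) by (simp add: expect_const)
next
  case (Suc s)
  note X = Suc.prems(1) and deg = Suc.prems(3)
  define R where "R = rank_bound k"
  define f where "f A = (of_bool (setval c A \<noteq> 0) :: real)" for A
  have p01: "0 \<le> \<rho> ^ j / 2" "\<rho> ^ j / 2 \<le> 1" for j
    using \<open>0 \<le> \<rho>\<close> \<open>\<rho> \<le> 1\<close> power_le_one[of \<rho> j] by auto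
  have nn: "0 \<le> expect (\<rho> ^ j / 2) X f" for j
    using p01 by (intro expect_nonneg) (auto simp: f_def)
  define a where "a = 1 - \<rho> * real (R * k)"
  have a: "0 \<le> a" "a \<le> 1" using Suc.prems(6,7) by (simp_all add: a_def R_def)
  define P where "P F \<longleftrightarrow> F \<subseteq> Pow X \<and> disjoint F \<and> (\<forall>S\<in>F. card S = Suc s \<and> c S \<noteq> 0)" for F
  have "a ^ Suc s / 200 \<le> (\<Sum>j\<le>Suc s. expect (\<rho> ^ j / 2) X f)"
  proof (cases "\<exists>F. P F \<and> R < card F")
    case True
    then obtain F where F: "P F" "R < card F" by blast
    have "1 / 200 \<le> expect (1/2) X f"
      unfolding f_def using F Suc.prems(4,5)
      by (intro many_top_monomials[OF X _ _ deg, of k F]) (auto simp: P_def R_def)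
    moreover have "expect (\<rho> ^ 0 / 2) X f \<le> (\<Sum>j\<le>Suc s. expect (\<rho> ^ j / 2) X f)"
      using nn by (intro member_le_sum) auto
    moreover have "a ^ Suc s / 200 \<le> 1 / 200" using a by (intro divide_right_mono power_le_one) auto
    ultimately show ?thesis by simp
  next
    case False
    \<comment> \<open>Sizes are bounded by \<open>R\<close> in this case, so a family of maximum
      size exists. Its union has at most \<open>R * k\<close> elements and meets every top
      monomial.\<close>
    have "P {}" by (simp add: P_def disjoint_def)
    moreover have "\<forall>F. P F \<longrightarrow> card F < Suc R" using False by auto
    ultimately obtain F where F: "P F" "\<And>F'. P F' \<Longrightarrow> card F' \<le> card F"
      using ex_has_greatest_nat[of P "{}" card "Suc R"] by auto
    define H where "H = \<Union>F"
    have finF: "finite F" using F(1) X unfolding P_def by (meson finite_Pow_iff finite_subset)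
    have HX: "H \<subseteq> X" using F(1) by (auto simp: P_def H_def)
    have "card H \<le> (\<Sum>S\<in>F. card S)" unfolding H_def by (rule card_Union_le_sum_card)
    also have "\<dots> = card F * Suc s" using F(1) by (simp add: P_def)
    also have "\<dots> \<le> R * k" using F(1) False Suc.prems(4) by (intro mult_le_mono) (auto simp: not_less)
    finally have cH: "card H \<le> R * k" .
    \<comment> \<open>If \<open>Y\<close> avoids \<open>H\<close>, a monomial of degree
      \<open>Suc s\<close> inside \<open>Y\<close> would be nonempty and disjoint from all of
      \<open>F\<close>, against maximality. So the degree on \<open>Y\<close> is at most
      \<open>s\<close>.\<close>
    have step: "a ^ s / 200 * of_bool (Y \<inter> H = {}) \<le> (\<Sum>j\<le>s. expect (\<rho> ^ j / 2) Y f)" if Y: "Y \<subseteq> X" for Y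
    proof (cases "Y \<inter> H = {}")
      case True
      have "deg_le Y s c"
        unfolding deg_le_def
      proof (intro allI impI)
        fix S assume S: "S \<subseteq> Y" "c S \<noteq> 0"
        then have "card S \<le> Suc s" using deg Y by (auto simp: deg_le_def)
        moreover have "card S \<noteq> Suc s"
        proof
          assume cS: "card S = Suc s"
          then have "S \<noteq> {}" by auto
          then have "S \<notin> F" using S True by (auto simp: H_def)
          moreover have "disjoint (insert S F)"
            using F(1) S True by (auto simp: P_def disjoint_def H_def)
          then have "P (insert S F)" using F(1) S Y cS by (auto simp: P_def)
          then have "card (insert S F) \<le> card F" by (rule F(2))
          ultimately show False using finF by simp
        qed
        ultimately show "card S \<le> s" by simp
      qed
      then have "a ^ s / 200 \<le> (\<Sum>j\<le>s. expect (\<rho> ^ j / 2) Y f)"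
        unfolding a_def R_def f_def using Y X Suc.prems finite_subset[OF Y X]
        by (intro Suc.IH) auto
      then show ?thesis using True by simp
    next
      case False
      then show ?thesis using p01 by (auto intro!: sum_nonneg expect_nonneg simp: f_def)
    qed
    have "a ^ Suc s / 200 \<le> (1 - \<rho>) ^ card H * (a ^ s / 200)"
    proof -
      have "1 + real (card H) * (- \<rho>) \<le> (1 + - \<rho>) ^ card H"
        using \<open>\<rho> \<le> 1\<close> by (intro Bernoulli_inequality) auto
      moreover have "real (card H) * \<rho> \<le> real (R * k) * \<rho>"
        using cH \<open>0 \<le> \<rho>\<close> by (intro mult_right_mono) (simp_all only: of_nat_le_iff)
      ultimately have "a \<le> (1 - \<rho>) ^ card H" by (simp add: a_def mult.commute)
      then have "a * (a ^ s / 200) \<le> (1 - \<rho>) ^ card H * (a ^ s / 200)"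
        using a by (intro mult_right_mono) auto
      then show ?thesis by simp
    qed
    also have "\<dots> = expect \<rho> X (\<lambda>Y. a ^ s / 200 * of_bool (Y \<inter> H = {}))"
      unfolding expect_cmult expect_disjoint[OF X HX] by (rule mult.commute)
    also have "\<dots> \<le> expect \<rho> X (\<lambda>Y. \<Sum>j\<le>s. expect (\<rho> ^ j / 2) Y f)"
      using \<open>0 \<le> \<rho>\<close> \<open>\<rho> \<le> 1\<close> by (intro expect_mono step)
    \<comment> \<open>Stage j inside the random \<open>Y\<close> is stage j + 1 inside
      \<open>X\<close>.\<close>
    also have "\<dots> = (\<Sum>j\<le>s. expect (\<rho> ^ Suc j / 2) X f)"
      by (simp add: expect_sum expect_expect[OF X])
    also have "\<dots> \<le> (\<Sum>j\<le>Suc s. expect (\<rho> ^ j / 2) X f)"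
      unfolding sum.atMost_Suc_shift using nn[of 0] by simp
    finally show ?thesis .
  qed
  then show ?case unfolding a_def R_def f_def[abs_def] .
qed

section \<open>Probabilistic polynomials\<close>

text \<open>On 0/1 points all positive powers of a variable agree, so the monomials are merged
  according to their support.\<close>

definition setcoeff :: "'v real_mpoly \<Rightarrow> 'v set \<Rightarrow> real" where
  "setcoeff p S = (\<Sum>m\<in>{m \<in> Poly_Mapping.keys p. Poly_Mapping.keys m = S}. Poly_Mapping.lookup p m)"

abbreviation setev :: "'v real_mpoly \<Rightarrow> 'v set \<Rightarrow> real" where
  "setev p A \<equiv> mpoly_eval p (\<lambda>v. of_bool (v \<in> A))"

lemma mpoly_eval_indicator:
  assumes "finite A"
  shows "setev p A = setval (setcoeff p) A"
proof -
  let ?K = "Poly_Mapping.keys p" and ?k = "Poly_Mapping.keys :: ('a \<Rightarrow>\<^sub>0 nat) \<Rightarrow> 'a set"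
  have "(\<Prod>v\<in>?k m. of_bool (v \<in> A) ^ Poly_Mapping.lookup m v) = (of_bool (?k m \<subseteq> A) :: real)" for m
  proof (cases "?k m \<subseteq> A")
    case True
    then have "(\<Prod>v\<in>?k m. of_bool (v \<in> A) ^ Poly_Mapping.lookup m v) = (\<Prod>v\<in>?k m. (1::real))"
      by (intro prod.cong) auto
    then show ?thesis using True by simp
  next
    case False
    then obtain v where v: "v \<in> ?k m" "v \<notin> A" by blast
    then have "0 < Poly_Mapping.lookup m v" by (simp add: in_keys_iff)
    with v have "\<exists>v\<in>?k m. of_bool (v \<in> A) ^ Poly_Mapping.lookup m v = (0::real)" by (intro bexI[of _ v]) auto
    then have "(\<Prod>v\<in>?k m. of_bool (v \<in> A) ^ Poly_Mapping.lookup m v) = (0::real)"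
      by (intro prod_zero) auto
    then show ?thesis using False by simp
  qed
  then have "setev p A = (\<Sum>m\<in>?K. if ?k m \<subseteq> A then Poly_Mapping.lookup p m else 0)"
    unfolding mpoly_eval_def by (intro sum.cong) auto
  also have "\<dots> = (\<Sum>m\<in>{m \<in> ?K. ?k m \<subseteq> A}. Poly_Mapping.lookup p m)"
    by (intro sum.inter_filter[symmetric]) auto
  also have "\<dots> = (\<Sum>S\<in>Pow A. \<Sum>m\<in>{m \<in> {m \<in> ?K. ?k m \<subseteq> A}. ?k m = S}. Poly_Mapping.lookup p m)"
    using assms by (intro sum.group[symmetric]) auto
  also have "\<dots> = setval (setcoeff p) A"
    unfolding setval_def setcoeff_def by (intro sum.cong) auto
  finally show ?thesis .
qed

lemma setcoeff_degree:
  assumes "setcoeff p S \<noteq> 0"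
  shows "card S \<le> mpoly_degree p"
proof -
  have "\<exists>m\<in>Poly_Mapping.keys p. Poly_Mapping.keys m = S"
  proof (rule ccontr)
    assume "\<not> ?thesis"
    then have "setcoeff p S = 0" unfolding setcoeff_def by (intro sum.neutral) auto
    then show False using assms by simp
  qed
  then obtain m where m: "m \<in> Poly_Mapping.keys p" "Poly_Mapping.keys m = S" by blast
  have "card S = (\<Sum>v\<in>Poly_Mapping.keys m. 1)" by (simp add: m)
  also have "\<dots> \<le> (\<Sum>v\<in>Poly_Mapping.keys m. Poly_Mapping.lookup m v)"
    by (intro sum_mono) (simp add: in_keys_iff Suc_le_eq)
  also have "\<dots> \<le> mpoly_degree p"
    unfolding mpoly_degree_def using m(1) by (intro Max_ge) auto
  finally show ?thesis .
qed

section \<open>Degrees of functions on subsets\<close>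

definition setpoly :: "'v set \<Rightarrow> nat \<Rightarrow> ('v set \<Rightarrow> real) \<Rightarrow> bool" where
  "setpoly X d f \<longleftrightarrow> (\<exists>c. deg_le X d c \<and> (\<forall>A\<subseteq>X. f A = setval c A))"

text \<open>Since x^2 = x on 0/1 values, monomials multiply by taking the union of their
  supports.\<close>

lemma setpoly_mult:
  assumes X: "finite X" and f: "setpoly X a f" and g: "setpoly X b g"
  shows "setpoly X (a + b) (\<lambda>A. f A * g A)"
proof -
  obtain c where c: "deg_le X a c" "\<And>A. A \<subseteq> X \<Longrightarrow> f A = setval c A" using f by (auto simp: setpoly_def)
  obtain d where d: "deg_le X b d" "\<And>A. A \<subseteq> X \<Longrightarrow> g A = setval d A" using g by (auto simp: setpoly_def)
  define e where "e U = (\<Sum>(S, T)\<in>{ST \<in> Pow U \<times> Pow U. fst ST \<union> snd ST = U}. c S * d T)" for U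
  have "deg_le X (a + b) e"
    unfolding deg_le_def
  proof (intro allI impI)
    fix U assume U: "U \<subseteq> X" "e U \<noteq> 0"
    have "\<exists>S T. S \<union> T = U \<and> c S \<noteq> 0 \<and> d T \<noteq> 0"
    proof (rule ccontr)
      assume "\<not> ?thesis"
      then have "e U = 0" unfolding e_def by (intro sum.neutral) auto
      then show False using U by simp
    qed
    then obtain S T where ST: "S \<union> T = U" "c S \<noteq> 0" "d T \<noteq> 0" by blast
    then have "S \<subseteq> X" "T \<subseteq> X" using U by auto
    then have "card S \<le> a" "card T \<le> b" using c(1) d(1) ST by (auto simp: deg_le_def)
    then show "card U \<le> a + b" using card_Un_le[of S T] ST by simp
  qed
  moreover have "f A * g A = setval e A" if A: "A \<subseteq> X" for A
  proof -
    have fin: "finite A" using A X by (rule finite_subset)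
    have "f A * g A = (\<Sum>(S, T)\<in>Pow A \<times> Pow A. c S * d T)"
      unfolding c(2)[OF A] d(2)[OF A] setval_def sum_product sum.cartesian_product ..
    also have "\<dots> = (\<Sum>U\<in>Pow A. \<Sum>(S, T)\<in>{ST \<in> Pow A \<times> Pow A. fst ST \<union> snd ST = U}. c S * d T)"
      using fin by (intro sum.group[symmetric]) auto
    also have "\<dots> = setval e A"
      unfolding setval_def e_def by (intro sum.cong refl) auto
    finally show ?thesis .
  qed
  ultimately show ?thesis unfolding setpoly_def by blast
qed

lemma setpoly_one:
  fixes X :: "'v set"
  assumes X: "finite X"
  shows "setpoly X 0 (\<lambda>A. 1)"
proof -
  have "setval (\<lambda>S. of_bool (S = {})) A = 1" if "A \<subseteq> X" for A
  proof -
    have "finite A" using that X by (rule finite_subset)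
    then have "setval (\<lambda>S. of_bool (S = {})) A = (\<Sum>S\<in>{{} :: 'v set}. of_bool (S = {}))"
      unfolding setval_def by (intro sum.mono_neutral_right) auto
    then show ?thesis by simp
  qed
  moreover have "deg_le X 0 (\<lambda>S. of_bool (S = {}))" by (auto simp: deg_le_def)
  ultimately show ?thesis unfolding setpoly_def by (intro exI[of _ "\<lambda>S. of_bool (S = {})"]) auto
qed

lemma setpoly_prod:
  assumes "finite X" "\<And>i. i < (t::nat) \<Longrightarrow> setpoly X d (f i)"
  shows "setpoly X (d * t) (\<lambda>A. \<Prod>i<t. f i A)"
  using assms(2)
proof (induction t)
  case 0
  then show ?case using setpoly_one[OF assms(1)] by simp
next
  case (Suc t)
  have "setpoly X (d * t + d) (\<lambda>A. (\<Prod>i<t. f i A) * f t A)"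
    using Suc by (intro setpoly_mult assms(1)) auto
  then show ?case by (simp add: add.commute)
qed

lemma setpoly_minus_one:
  fixes X :: "'v set"
  assumes X: "finite X" and deg: "mpoly_degree p \<le> d"
  shows "setpoly X d (\<lambda>A. setev p A - 1)"
proof -
  define c where "c S = setcoeff p S - of_bool (S = {})" for S
  have "deg_le X d c"
    unfolding deg_le_def
  proof (intro allI impI)
    fix S assume S: "c S \<noteq> 0"
    show "card S \<le> d"
    proof (cases "S = {}")
      case False
      then have "setcoeff p S \<noteq> 0" using S by (simp add: c_def)
      from setcoeff_degree[OF this] deg show ?thesis by simp
    qed simp
  qed
  moreover have "setev p A - 1 = setval c A" if A: "A \<subseteq> X" for A
  proof -
    have fin: "finite A" using A X by (rule finite_subset)
    have "(\<Sum>S\<in>Pow A. of_bool (S = {}) :: real) = (\<Sum>S\<in>{{} :: 'v set}. of_bool (S = {}))"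
      using fin by (intro sum.mono_neutral_right) auto
    then show ?thesis
      unfolding mpoly_eval_indicator[OF fin] setval_def c_def sum_subtractf by simp
  qed
  ultimately show ?thesis unfolding setpoly_def by blast
qed

lemma prob_poly_error:
  assumes P: "probabilistic_polynomial \<epsilon> X (OR_fun X) P" and A: "A \<subseteq> X"
  shows "measure_pmf.prob P {p. setev p A \<noteq> of_bool (A \<noteq> {})} \<le> \<epsilon>"
proof -
  define a where "a = (\<lambda>v\<in>X. v \<in> A)"
  have "a \<in> bool_cube X" by (simp add: a_def bool_cube_def)
  then have le: "measure_pmf.prob P {p. mpoly_eval p (\<lambda>v. of_bool (a v)) \<noteq> of_bool (OR_fun X a)} \<le> \<epsilon>"
    using P by (auto simp: probabilistic_polynomial_def)
  \<comment> \<open>Outside \<open>X\<close> the point \<open>a\<close> is \<open>undefined\<close>,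
    so the two evaluations are compared only on the support, where polynomials use variables of
    \<open>X\<close> alone.\<close>
  have eval: "mpoly_eval p (\<lambda>v. of_bool (a v)) = setev p A" if "p \<in> set_pmf P" for p
  proof -
    have vars: "mpoly_vars p \<subseteq> X" using P that by (auto simp: probabilistic_polynomial_def)
    show ?thesis
      unfolding mpoly_eval_def
    proof (intro sum.cong refl arg_cong2[where f = "(*)"] prod.cong)
      fix m v assume "m \<in> Poly_Mapping.keys p" "v \<in> Poly_Mapping.keys m"
      then have "v \<in> X" using vars by (auto simp: mpoly_vars_def)
      then show "of_bool (a v) ^ Poly_Mapping.lookup m v = (of_bool (v \<in> A) :: real) ^ Poly_Mapping.lookup m v"
        by (simp add: a_def)
    qed
  qed
  have OR: "OR_fun X a = (A \<noteq> {})" using A by (auto simp: OR_fun_def a_def)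
  have "measure_pmf.prob P {p. setev p A \<noteq> of_bool (A \<noteq> {})} =
     measure_pmf.prob P {p. mpoly_eval p (\<lambda>v. of_bool (a v)) \<noteq> of_bool (OR_fun X a)}"
    by (intro measure_pmf.finite_measure_eq_AE) (auto simp: AE_measure_pmf_iff eval OR)
  with le show ?thesis by simp
qed

text \<open>Amplification: \<open>t\<close> independent copies, multiplied as \<open>\<Prod> (p\<^sub>i - 1)\<close>, err on a nonzero input
  only if all of them do, while the value at \<open>0\<close> is nonzero with probability at least \<open>(7/8)^t\<close>.\<close>

lemma degree_tradeoff:
  fixes X :: "'v set" and \<rho> :: real
  assumes X: "finite X" and P: "probabilistic_polynomial (1/8) X (OR_fun X) P"
    and d: "\<And>p. p \<in> set_pmf P \<Longrightarrow> mpoly_degree p \<le> d" and D: "D = d * t" "0 < D"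
    and \<rho>: "0 \<le> \<rho>" "\<rho> * real (rank_bound D * D) \<le> 1 / (2 * real D)" "\<rho> \<le> 1"
  shows "(7 / 8) ^ t / 400 \<le> (real D + 1) * ((1 / 8) ^ t + (1 - \<rho> ^ D / 2) ^ card X)"
proof -
  \<comment> \<open>The default 0 is the polynomial at indices from t on; the events below look only
    at indices below t.\<close>
  define M where "M = Pi_pmf {..<t} 0 (\<lambda>_. P)"
  define bad where "bad A = Pi {..<t} (\<lambda>_. {p :: 'v real_mpoly. setev p A \<noteq> 1})" for A :: "'v set"
  define zero where "zero = Pi {..<t} (\<lambda>_. {p :: 'v real_mpoly. setev p {} = 0})"
  have prob: "measure_pmf.prob M (Pi {..<t} (\<lambda>_. B)) = measure_pmf.prob P B ^ t" for B
    unfolding M_def by (subst measure_Pi_pmf_Pi) auto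
  \<comment> \<open>At the origin q ought to be nonzero, so the empty set gets the trivial bound.
    Emptiness is written \<open>A \<inter> X = {}\<close> to suit \<open>expect_disjoint\<close>
    with H = X.\<close>
  have pbad: "measure_pmf.prob M (bad A) \<le> (1 / 8) ^ t + of_bool (A \<inter> X = {})" if A: "A \<subseteq> X" for A
  proof (cases "A = {}")
    case True
    have "measure_pmf.prob M (bad A) \<le> 1" by simp
    also have "\<dots> \<le> (1 / 8) ^ t + of_bool (A \<inter> X = {})" using True by simp
    finally show ?thesis .
  next
    case False
    have "measure_pmf.prob M (bad A) = measure_pmf.prob P {p. setev p A \<noteq> 1} ^ t"
      unfolding bad_def by (rule prob)
    also have "\<dots> \<le> (1 / 8) ^ t"
      using prob_poly_error[OF P A] False by (intro power_mono) auto
    also have "\<dots> \<le> (1 / 8) ^ t + of_bool (A \<inter> X = {})" by simp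
    finally show ?thesis .
  qed
  have pzero: "(7 / 8) ^ t \<le> measure_pmf.prob M zero"
  proof -
    have "measure_pmf.prob P {p. setev p {} = 0} = 1 - measure_pmf.prob P {p. setev p {} \<noteq> 0}"
      using measure_pmf.prob_compl[of "{p. setev p {} \<noteq> 0}" P] by (simp add: Compl_eq_Diff_UNIV[symmetric] Collect_neg_eq[symmetric])
    moreover have "measure_pmf.prob P {p. setev p {} \<noteq> 0} \<le> 1 / 8"
      using prob_poly_error[OF P, of "{}"] by simp
    ultimately have "(7 / 8) ^ t \<le> measure_pmf.prob P {p. setev p {} = 0} ^ t"
      by (intro power_mono) auto
    then show ?thesis unfolding zero_def prob .
  qed
  have p01: "0 \<le> \<rho> ^ j / 2" "\<rho> ^ j / 2 \<le> 1" for j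
    using \<rho> power_le_one[of \<rho> j] by auto
  \<comment> \<open>Pointwise in the outcome \<open>ps\<close>: the stage that detects the product
    depends on \<open>ps\<close>, hence the sum over all stages.\<close>
  have pt: "indicator zero ps / 400 \<le> (\<Sum>j\<le>D. expect (\<rho> ^ j / 2) X (\<lambda>A. indicator (bad A) ps))"
    if ps: "ps \<in> set_pmf M" for ps
  proof (cases "ps \<in> zero")
    case True
    have psP: "ps i \<in> set_pmf P" if "i < t" for i
      using ps that unfolding M_def set_Pi_pmf[OF finite_lessThan] PiE_dflt_def by fastforce
    have "setpoly X (d * t) (\<lambda>A. \<Prod>i<t. setev (ps i) A - 1)"
      using d psP by (intro setpoly_prod setpoly_minus_one X) auto
    then obtain c where c: "deg_le X D c" "\<And>A. A \<subseteq> X \<Longrightarrow> (\<Prod>i<t. setev (ps i) A - 1) = setval c A"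
      unfolding setpoly_def D(1) by blast
    have "c {} = setval c {}" by (simp add: setval_def)
    also have "\<dots> = (\<Prod>i<t. setev (ps i) {} - 1)" using c(2)[of "{}"] by simp
    also have "\<dots> = (\<Prod>i<t. - 1)" using True by (intro prod.cong) (auto simp: zero_def Pi_def)
    finally have c0: "c {} \<noteq> 0" by simp
    \<comment> \<open>Each of at most D stages misses its hitting set except with probability 1 /
      (2D), so the whole chain keeps a factor 1/2, and 1/200 becomes 1/400.\<close>
    have "1 + real D * (- (\<rho> * real (rank_bound D * D))) \<le> (1 + - (\<rho> * real (rank_bound D * D))) ^ D"
    proof (rule Bernoulli_inequality)
      have "\<rho> * real (rank_bound D * D) \<le> 1 / (2 * real D)" by (rule \<rho>(2))
      also have "\<dots> \<le> 1" using D(2) by (simp add: divide_le_eq)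
      finally show "- 1 \<le> - (\<rho> * real (rank_bound D * D))" by simp
    qed
    moreover have "real D * (\<rho> * real (rank_bound D * D)) \<le> real D * (1 / (2 * real D))"
      using \<rho>(2) by (intro mult_left_mono) auto
    ultimately have "1 / 2 \<le> (1 - \<rho> * real (rank_bound D * D)) ^ D" using D(2) by simp
    then have "1 / 400 \<le> (1 - \<rho> * real (rank_bound D * D)) ^ D / 200" by simp
    also have "\<dots> \<le> (\<Sum>j\<le>D. expect (\<rho> ^ j / 2) X (\<lambda>A. of_bool (setval c A \<noteq> 0)))"
    proof (rule restriction_chain[where k = D and s = D, OF X c0 c(1) order_refl D(2) \<rho>(1) _ \<rho>(3)])
      have "1 / (2 * real D) \<le> 1" using D(2) by (simp add: divide_le_eq)
      then show "\<rho> * real (rank_bound D * D) \<le> 1" using \<rho>(2) by linarith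
    qed
    also have "\<dots> = (\<Sum>j\<le>D. expect (\<rho> ^ j / 2) X (\<lambda>A. indicator (bad A) ps))"
    proof (intro sum.cong refl expect_cong)
      fix A assume "A \<subseteq> X"
      have "setval c A \<noteq> 0 \<longleftrightarrow> ps \<in> bad A"
        unfolding c(2)[OF \<open>A \<subseteq> X\<close>, symmetric] by (auto simp: bad_def Pi_def)
      then show "of_bool (setval c A \<noteq> 0) = (indicator (bad A) ps :: real)" by (simp add: indicator_def)
    qed
    finally show ?thesis using True by simp
  next
    case False
    then show ?thesis using p01 by (auto intro!: sum_nonneg expect_nonneg)
  qed
  have "(7 / 8) ^ t / 400 \<le> measure_pmf.prob M zero / 400" using pzero by simp
  also have "\<dots> = (\<integral>ps. indicator zero ps / 400 \<partial>M)" by simp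
  also have "\<dots> \<le> (\<integral>ps. (\<Sum>j\<le>D. expect (\<rho> ^ j / 2) X (\<lambda>A. indicator (bad A) ps)) \<partial>M)"
  proof (rule integral_mono_AE)
    show "integrable (measure_pmf M) (\<lambda>ps. indicator zero ps / 400 :: real)"
      by (intro integrable_divide integrable_real_indicator) (auto simp: measure_pmf.emeasure_eq_measure)
    show "integrable (measure_pmf M) (\<lambda>ps. \<Sum>j\<le>D. expect (\<rho> ^ j / 2) X (\<lambda>A. indicator (bad A) ps))"
      by (intro Bochner_Integration.integrable_sum integrable_expect_indicator) (auto simp: measure_pmf.prob_space_axioms)
    show "AE ps in measure_pmf M. indicator zero ps / 400 \<le> (\<Sum>j\<le>D. expect (\<rho> ^ j / 2) X (\<lambda>A. indicator (bad A) ps))"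
      using pt by (simp add: AE_measure_pmf_iff)
  qed
  also have "\<dots> = (\<Sum>j\<le>D. \<integral>ps. expect (\<rho> ^ j / 2) X (\<lambda>A. indicator (bad A) ps) \<partial>M)"
    by (intro Bochner_Integration.integral_sum integrable_expect_indicator) (auto simp: measure_pmf.prob_space_axioms)
  also have "\<dots> = (\<Sum>j\<le>D. expect (\<rho> ^ j / 2) X (\<lambda>A. measure_pmf.prob M (bad A)))"
    by (intro sum.cong refl integral_expect_indicator) (auto simp: measure_pmf.prob_space_axioms)
  also have "\<dots> \<le> (\<Sum>j\<le>D. (1 / 8) ^ t + (1 - \<rho> ^ D / 2) ^ card X)"
  proof (rule sum_mono)
    fix j assume j: "j \<in> {..D}"
    have "expect (\<rho> ^ j / 2) X (\<lambda>A. measure_pmf.prob M (bad A)) \<le>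
       expect (\<rho> ^ j / 2) X (\<lambda>A. (1 / 8) ^ t + of_bool (A \<inter> X = {}))"
      using p01 pbad by (intro expect_mono)
    also have "\<dots> = (1 / 8) ^ t + (1 - \<rho> ^ j / 2) ^ card X"
      by (simp only: expect_add expect_const[OF X] expect_disjoint[OF X order_refl])
    also have "\<dots> \<le> (1 / 8) ^ t + (1 - \<rho> ^ D / 2) ^ card X"
    proof -
      \<comment> \<open>The sparsest stage is the most likely one to select no variable.\<close>
      have "\<rho> ^ D \<le> \<rho> ^ j" using j \<rho> by (intro power_decreasing) auto
      then show ?thesis using p01[of j] by (intro add_left_mono power_mono) auto
    qed
    finally show "expect (\<rho> ^ j / 2) X (\<lambda>A. measure_pmf.prob M (bad A)) \<le> (1 / 8) ^ t + (1 - \<rho> ^ D / 2) ^ card X" .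
  qed
  also have "\<dots> = (real D + 1) * ((1 / 8) ^ t + (1 - \<rho> ^ D / 2) ^ card X)" by simp
  finally show ?thesis .
qed

text \<open>In degree at most 1 the alternating sum over the four points of a two-dimensional face
  is 0, while for OR it is -1. So each polynomial of the support errs at one of four points, yet the
  errors add up to at most 1/2. This disposes of small n, where the claimed bound does not exceed
  2.\<close>

lemma degree_ge_2:
  assumes X: "finite X" "2 \<le> card X" and P: "probabilistic_polynomial (1/8) X (OR_fun X) P"
  shows "\<exists>p\<in>set_pmf P. 2 \<le> mpoly_degree p"
proof (rule ccontr)
  assume "\<not> ?thesis"
  then have deg: "mpoly_degree p \<le> 1" if "p \<in> set_pmf P" for p using that by force
  obtain Y where "Y \<subseteq> X" "card Y = 2" using X by (meson obtain_subset_with_card_n)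
  then obtain x y where xy: "x \<in> X" "y \<in> X" "x \<noteq> y" by (auto simp: card_2_iff)
  define err where "err A = {p. setev p A \<noteq> (of_bool (A \<noteq> {}) :: real)}" for A :: "'a set"
  have "1 = measure_pmf.prob P (err {} \<union> err {x} \<union> err {y} \<union> err {x, y})"
  proof -
    have "p \<in> err {} \<union> err {x} \<union> err {y} \<union> err {x, y}" if p: "p \<in> set_pmf P" for p
    proof (rule ccontr)
      assume "\<not> ?thesis"
      then have vals: "setev p {} = 0" "setev p {x} = 1" "setev p {y} = 1" "setev p {x, y} = 1"
        by (auto simp: err_def)
      have Pow: "Pow {x} = {{}, {x}}" "Pow {y} = {{}, {y}}" "Pow {x, y} = {{}, {x}, {y}, {x, y}}" by auto
      have "setcoeff p {x, y} = 0"
        using setcoeff_degree[of p "{x, y}"] deg[OF p] xy by fastforce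
      then have "setev p {} - setev p {x} - setev p {y} + setev p {x, y} = 0"
        using xy by (simp only: mpoly_eval_indicator finite.intros setval_def Pow) (simp add: doubleton_eq_iff)
      then show False using vals by simp
    qed
    then have "AE p in measure_pmf P. p \<in> err {} \<union> err {x} \<union> err {y} \<union> err {x, y}"
      by (simp add: AE_measure_pmf_iff)
    then show ?thesis by (subst eq_commute, subst measure_pmf.prob_eq_1) auto
  qed
  also have "\<dots> \<le> measure_pmf.prob P (err {}) + measure_pmf.prob P (err {x}) + measure_pmf.prob P (err {y})
     + measure_pmf.prob P (err {x, y})"
    by (intro order_trans[OF measure_Un_le] add_right_mono) auto
  also have "\<dots> \<le> 1 / 8 + 1 / 8 + 1 / 8 + 1 / 8"
    unfolding err_def using xy by (intro add_mono prob_poly_error[OF P]) auto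
  finally show False by simp
qed

text \<open>The numerical factors multiply to 134217728000 \<le> 2^37, the powers with exponent D to
  59049 \<le> 2^16, and 1153 \<le> 2^11 enters with exponent 8. Raising everything to the power D
  gives the compact form.\<close>

lemma rank_bound_le:
  assumes "0 < D"
  shows "2 * rank_bound D * D\<^sup>2 \<le> (2 ^ 141 * D ^ 29) ^ D"
proof -
  have p: "(4 * (a * D ^ 3) ^ (2 * D)) ^ 4 = 256 * ((a ^ 8) ^ D * (D ^ 24) ^ D)" for a :: nat
  proof -
    have "((a * D ^ 3) ^ (2 * D)) ^ 4 = (a * D ^ 3) ^ (2 * D * 4)" by (rule power_mult[symmetric])
    also have "2 * D * 4 = 8 * D" by simp
    also have "(a * D ^ 3) ^ (8 * D) = ((a * D ^ 3) ^ 8) ^ D" by (rule power_mult)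
    also have "(a * D ^ 3) ^ 8 = a ^ 8 * D ^ 24" by (simp add: power_mult_distrib flip: power_mult)
    finally show ?thesis by (simp add: power_mult_distrib)
  qed
  have q: "9 ^ D * 81 ^ D * 9 ^ D * 9 ^ D = (59049 :: nat) ^ D"
    by (simp flip: power_mult_distrib)
  have r: "2 * (8 * x * (32 * y * D\<^sup>2 * (4000 * x * (256 * w)) * (256 * x * D))) * D\<^sup>2 =
      134217728000 * D ^ 5 * (x * y * x * x) * w" for x y w :: nat
  proof -
    have "D ^ 5 = D\<^sup>2 * D * D\<^sup>2" by (simp add: eval_nat_numeral)
    then show ?thesis by simp
  qed
  have "2 * rank_bound D * D\<^sup>2 = 134217728000 * D ^ 5 * (9 ^ D * 81 ^ D * 9 ^ D * 9 ^ D) * ((1153 ^ 8) ^ D * (D ^ 24) ^ D)"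
    unfolding rank_bound_def depth_def p by (rule r)
  also have "\<dots> \<le> (2 ^ 37) ^ D * (D ^ 5) ^ D * (2 ^ 16) ^ D * ((2 ^ 88) ^ D * (D ^ 24) ^ D)"
    unfolding q
  proof (intro mult_mono)
    have "134217728000 \<le> (2 ^ 37 :: nat)" by simp
    also have "\<dots> \<le> (2 ^ 37) ^ D" using assms self_le_power[of "2 ^ 37 :: nat" D] by simp
    finally show "134217728000 \<le> (2 ^ 37 :: nat) ^ D" .
    show "D ^ 5 \<le> (D ^ 5) ^ D" using assms by (intro self_le_power) auto
    show "59049 ^ D \<le> (2 ^ 16 :: nat) ^ D" by (intro power_mono) auto
    show "(1153 ^ 8) ^ D \<le> ((2 ^ 88) ^ D :: nat)" by (intro power_mono) auto
  qed auto
  also have "\<dots> = (2 ^ 37 * D ^ 5 * 2 ^ 16 * (2 ^ 88 * D ^ 24)) ^ D" by (simp only: power_mult_distrib)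
  also have "2 ^ 37 * D ^ 5 * 2 ^ 16 * (2 ^ 88 * D ^ 24) = 2 ^ (37 + 16 + 88) * D ^ (5 + 24)"
    by (simp only: power_add mult_ac)
  also have "\<dots> = 2 ^ 141 * D ^ 29" by (simp only: numeral_plus_numeral semiring_norm)
  finally show ?thesis .
qed

text \<open>On an interval from a to 2m, monotonicity reduces the negation to 2^m \<le> 2 a^2; five
  such intervals cover [1, 18).\<close>

lemma loglog_large:
  fixes l :: real
  assumes "1 \<le> l" "2 * l\<^sup>2 < 2 powr (l / 2)"
  shows "18 \<le> l"
proof (rule ccontr)
  assume "\<not> ?thesis"
  then have l: "l < 18" by simp
  have *: "2 powr (l / 2) \<le> 2 * l\<^sup>2" if "a \<le> l" "l \<le> 2 * real m" "2 ^ m \<le> 2 * a\<^sup>2" "0 \<le> a" for a m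
  proof -
    have "2 powr (l / 2) \<le> 2 powr real m" using that by (intro powr_mono) auto
    also have "\<dots> = 2 ^ m" by (simp add: powr_realpow)
    also have "\<dots> \<le> 2 * a\<^sup>2" by fact
    also have "\<dots> \<le> 2 * l\<^sup>2" using that by (intro mult_left_mono power_mono) auto
    finally show ?thesis .
  qed
  consider "l \<le> 2" | "2 \<le> l" "l \<le> 6" | "6 \<le> l" "l \<le> 12" | "12 \<le> l" "l \<le> 16" | "16 \<le> l" using l by linarith
  then have "2 powr (l / 2) \<le> 2 * l\<^sup>2"
  proof cases
    case 1 then show ?thesis using *[of 1 1] assms by simp
  next
    case 2 then show ?thesis using *[of 2 3] by simp
  next
    case 3 then show ?thesis using *[of 6 6] by simp
  next
    case 4 then show ?thesis using *[of 12 8] by simp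
  next
    case 5 then show ?thesis using *[of 16 9] l by simp
  qed
  then show False using assms by linarith
qed

lemma powr_2_ge_half: "0 \<le> y \<Longrightarrow> y / 2 \<le> 2 powr y" for y :: real
proof -
  assume y: "0 \<le> y"
  have "1 / 2 \<le> ln (2::real)" using ln_2_less_1 ln_le_minus_one[of "1 / 2 :: real"] by (simp add: ln_div)
  then have "y * (1 / 2) \<le> y * ln 2" using y by (intro mult_left_mono) auto
  also have "\<dots> \<le> exp (y * ln 2)" using exp_ge_add_one_self[of "y * ln 2"] by linarith
  finally show ?thesis by (simp add: powr_def mult.commute)
qed

text \<open>The final budget. With s = sqrt L and \<open>t\<close> about l/3, D is at most 7/18 of
  s/l and D + 1 at most s/40. After division by (7/8)^t both errors times s are at most 1/64, and
  (1/64 + 1/64) / 40 < 1/400.\<close>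

lemma no_low_degree:
  fixes n d :: nat and L l :: real
  assumes L: "L = 2 powr l" and n: "real n = 2 powr L" and l: "18 \<le> l"
    and d: "0 < d" "real d < 2 powr (l / 2) / l\<^sup>2"
    and t: "t = nat \<lceil>l / 3\<rceil>" and D: "D = d * t" and \<rho>: "\<rho> = 1 / real (2 * rank_bound D * D\<^sup>2)"
  shows "(real D + 1) * ((1 / 8) ^ t + (1 - \<rho> ^ D / 2) ^ n) < (7 / 8) ^ t / 400"
proof -
  define s where "s = 2 powr (l / 2)"
  have s2: "s * s = L" by (simp add: s_def L flip: powr_add)
  have s512: "512 \<le> s"
  proof -
    have "2 powr real 9 \<le> s" unfolding s_def using l by (intro powr_mono) auto
    then show ?thesis by (simp only: powr_realpow zero_less_numeral) simp
  qed
  have t1: "l / 3 \<le> real t" "real t \<le> l / 3 + 1" using l unfolding t by linarith+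
  have t0: "0 < t" using t1 l by (cases t) auto
  have D0: "0 < D" using d t0 by (simp add: D)
  have D1: "real D \<le> 7 / 18 * (s / l)"
  proof -
    have "real D = real d * real t" by (simp add: D)
    also have "\<dots> \<le> (s / l\<^sup>2) * (7 / 18 * l)" using d t1 l unfolding s_def by (intro mult_mono) auto
    also have "\<dots> = 7 / 18 * (s / l)" using l by (simp add: power2_eq_square)
    finally show ?thesis .
  qed
  have D2: "real D + 1 \<le> s / 40"
  proof -
    have "s / l \<le> s / 18" using l s512 by (intro divide_left_mono) auto
    then show ?thesis using D1 s512 by linarith
  qed
  have R0: "0 < rank_bound D" using D0 by (simp add: rank_bound_def depth_def)
  have rho: "0 < \<rho>" "\<rho> \<le> 1"
  proof -
    have "1 \<le> 2 * rank_bound D * D\<^sup>2" using R0 D0 by (simp add: Suc_le_eq)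
    then have "1 \<le> real (2 * rank_bound D * D\<^sup>2)" by (metis of_nat_1 of_nat_mono)
    moreover define Y where "Y = real (2 * rank_bound D * D\<^sup>2)"
    ultimately have "1 \<le> Y" by simp
    then show "0 < \<rho>" "\<rho> \<le> 1" unfolding \<rho> Y_def[symmetric] by simp_all
  qed
  \<comment> \<open>The bound on \<open>d\<close> is spent here: the right-hand side is sqrt n. The
    exponent is (141 + 29 l / 2) D^2, and as l \<ge> 18 the first factor is at most 23 l, so the
    exponent is at most a constant times L / l.\<close>
  have inv: "(1 / \<rho>) ^ D \<le> 2 powr (L / 2)"
  proof -
    have two: "(2::real) ^ m = 2 powr real m" for m by (simp add: powr_realpow)
    have "1 / \<rho> = real (2 * rank_bound D * D\<^sup>2)"
      unfolding \<rho> divide_divide_eq_right by (simp only: mult_1_left div_by_1)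
    also have "\<dots> \<le> real ((2 ^ 141 * D ^ 29) ^ D)" by (rule of_nat_mono[OF rank_bound_le[OF D0]])
    also have "\<dots> = (2 ^ 141 * real D ^ 29) ^ D"
      by (simp only: of_nat_power of_nat_mult of_nat_numeral)
    also have "\<dots> \<le> (2 ^ 141 * s ^ 29) ^ D"
      using D2 s512 by (intro power_mono mult_left_mono) auto
    also have "2 ^ 141 * s ^ 29 = 2 powr (real 141 + l / 2 * real 29)"
      unfolding s_def two powr_add by (subst powr_power) (simp_all add: mult.commute)
    also have "real 141 + l / 2 * real 29 = 141 + 29 * (l / 2)" by simp
    finally have "(1 / \<rho>) ^ D \<le> ((2 powr (141 + 29 * (l / 2))) ^ D) ^ D"
      using rho by (intro power_mono) auto
    also have "\<dots> = 2 powr ((141 + 29 * (l / 2)) * (real D * real D))"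
      by (simp add: powr_power mult_ac)
    also have "\<dots> \<le> 2 powr (L / 2)"
    proof (intro powr_mono)
      have "(141 + 29 * (l / 2)) * (real D * real D) \<le> (23 * l) * ((7 / 18 * (s / l)) * (7 / 18 * (s / l)))"
        using l D1 s512 by (intro mult_mono) auto
      also have "\<dots> = 23 * 49 / 324 * L / l" using l by (simp add: field_simps s2[symmetric])
      also have "\<dots> \<le> 23 * 49 / 324 * L / 18" using l by (intro divide_left_mono) (auto simp: L)
      also have "\<dots> \<le> L / 2" by (simp add: L)
      finally show "(141 + 29 * (l / 2)) * (real D * real D) \<le> L / 2" .
    qed simp
    finally show ?thesis .
  qed
  \<comment> \<open>Because 2^(5/2) < 7, 7^t is at least 2^(5 l / 6), which exceeds s by 2^(l/3)
    \<ge> 64. This is where \<open>t\<close> needs l/3 and l needs 18.\<close>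
  have A: "s * (1 / 7) ^ t \<le> 1 / 64"
  proof -
    have "2 powr (5 / 2) \<le> (7::real)"
    proof -
      have "(2 powr (5 / 2)) ^ 2 = (2::real) powr real 5" by (simp add: powr_power)
      also have "\<dots> = 2 ^ 5" by (rule powr_realpow) simp
      also have "\<dots> \<le> (7::real) ^ 2" by simp
      finally show ?thesis by (rule power2_le_imp_le) simp
    qed
    then have "(2 powr (5 / 2)) ^ t \<le> (7::real) ^ t" by (intro power_mono) auto
    then have "2 powr (5 / 2 * real t) \<le> (7::real) ^ t" by (simp add: powr_power mult.commute)
    moreover have "2 powr (5 / 6 * l) \<le> 2 powr (5 / 2 * real t)" using t1 by (intro powr_mono) auto
    ultimately have "2 powr (5 / 6 * l) \<le> (7::real) ^ t" by linarith
    moreover have "s * 64 \<le> 2 powr (5 / 6 * l)"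
    proof -
      have "s * 64 = s * 2 powr real 6" by (simp only: powr_realpow zero_less_numeral) simp
      also have "\<dots> = 2 powr (l / 2 + 6)" by (simp add: s_def powr_add)
      also have "\<dots> \<le> 2 powr (5 / 6 * l)" using l by (intro powr_mono) auto
      finally show ?thesis .
    qed
    ultimately show ?thesis by (simp add: power_one_over field_simps)
  qed
  \<comment> \<open>By \<open>inv\<close>, n \<rho>^D is at least sqrt n, so an empty test set has
    probability at most exp (- sqrt n / 2). The crude bound 128 / L^2 suffices against (8/7)^t s
    \<le> s^2 = L.\<close>
  have B: "(8 / 7) ^ t * (1 - \<rho> ^ D / 2) ^ n * s \<le> 1 / 64"
  proof -
    have "\<rho> ^ D * 2 powr (L / 2) \<ge> 1"
      using inv rho by (simp add: power_one_over field_simps)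
    then have "2 powr (L / 2) * 1 \<le> 2 powr (L / 2) * (\<rho> ^ D * 2 powr (L / 2))" by (intro mult_left_mono) auto
    also have "\<dots> = real n * \<rho> ^ D" by (simp add: n mult_ac flip: powr_add)
    finally have x: "2 powr (L / 2) \<le> real n * \<rho> ^ D" by simp
    have rp: "\<rho> ^ D \<le> 1" "0 \<le> \<rho> ^ D" using rho by (auto intro: power_le_one)
    have L0: "2 ^ 18 \<le> L"
    proof -
      have "2 powr real 18 \<le> L" unfolding L using l by (intro powr_mono) auto
      then show ?thesis by (simp only: powr_realpow zero_less_numeral)
    qed
    have "(1 - \<rho> ^ D / 2) ^ n \<le> exp (- (\<rho> ^ D / 2)) ^ n"
      using rp exp_ge_add_one_self[of "- (\<rho> ^ D / 2)"] by (intro power_mono) auto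
    also have "\<dots> = exp (- (real n * \<rho> ^ D / 2))" by (simp flip: exp_of_nat_mult)
    also have "\<dots> \<le> exp (- (2 powr (L / 2) / 2))" using x by simp
    also have "\<dots> = inverse (exp (2 powr (L / 2) / 2))" by (rule exp_minus)
    also have "\<dots> \<le> inverse (L * L / 128)"
    proof (rule le_imp_inverse_le)
      have "(L / 4) / 2 * ((L / 4) / 2) \<le> 2 powr (L / 4) * 2 powr (L / 4)"
        using L0 powr_2_ge_half[of "L / 4"] by (intro mult_mono) auto
      also have "\<dots> = 2 powr (L / 2)" by (simp flip: powr_add)
      also have "2 powr (L / 2) / 2 \<le> exp (2 powr (L / 2) / 2)"
        using exp_ge_add_one_self[of "2 powr (L / 2) / 2"] by linarith
      finally show "L * L / 128 \<le> exp (2 powr (L / 2) / 2)" by simp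
    qed (use L0 in auto)
    finally have e: "(1 - \<rho> ^ D / 2) ^ n \<le> 128 / (L * L)" by simp
    have "(8 / 7 :: real) ^ t \<le> 2 ^ t" by (intro power_mono) auto
    also have "\<dots> = 2 powr real t" by (simp add: powr_realpow)
    also have "\<dots> \<le> s" unfolding s_def using t1 l by (intro powr_mono) auto
    finally have "(8 / 7) ^ t * (1 - \<rho> ^ D / 2) ^ n * s \<le> s * (128 / (L * L)) * s"
      using e s512 rp by (intro mult_right_mono mult_mono) auto
    also have "\<dots> = 128 / L" using L0 by (simp add: s2[symmetric] field_simps)
    also have "\<dots> \<le> 128 / 2 ^ 18" using L0 by (intro divide_left_mono) auto
    finally show ?thesis by simp
  qed
  have "(real D + 1) * ((1 / 8) ^ t + (1 - \<rho> ^ D / 2) ^ n) =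
     (7 / 8) ^ t * ((real D + 1) * ((1 / 7) ^ t + (8 / 7) ^ t * (1 - \<rho> ^ D / 2) ^ n))"
    by (simp add: power_divide field_simps)
  also have "\<dots> \<le> (7 / 8) ^ t * (s / 40 * ((1 / 7) ^ t + (8 / 7) ^ t * (1 - \<rho> ^ D / 2) ^ n))"
  proof -
    have "\<rho> ^ D \<le> 1" using rho by (auto intro: power_le_one)
    then show ?thesis using D2 by (intro mult_left_mono mult_right_mono add_nonneg_nonneg mult_nonneg_nonneg) auto
  qed
  also have "s / 40 * ((1 / 7) ^ t + (8 / 7) ^ t * (1 - \<rho> ^ D / 2) ^ n) =
     (s * (1 / 7) ^ t + (8 / 7) ^ t * (1 - \<rho> ^ D / 2) ^ n * s) / 40"
    by (simp add: algebra_simps add_divide_distrib)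
  also have "(7 / 8) ^ t * \<dots> \<le> (7 / 8) ^ t * ((1 / 64 + 1 / 64) / 40)"
    using A B by (intro mult_left_mono divide_right_mono add_mono) auto
  also have "\<dots> < (7 / 8) ^ t / 400" by simp
  finally show ?thesis .
qed

theorem theorem3p1:
  fixes X\<^sub>0 :: "'v set" and n :: nat and P :: "'v real_mpoly pmf"
  assumes "finite X\<^sub>0" and "card X\<^sub>0 = n" and "n \<ge> 4"
    and "probabilistic_polynomial (1/8) X\<^sub>0 (OR_fun X\<^sub>0) P"
  shows "ereal (sqrt (log 2 (real n)) / (log 2 (log 2 (real n)))\<^sup>2)
           \<le> ereal_of_enat (prob_poly_degree P)"
proof (rule ccontr)
  assume contra: "\<not> ?thesis"
  define L where "L = log 2 (real n)"
  define l where "l = log 2 L"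
  have n: "real n = 2 powr L" using assms(3) by (simp add: L_def)
  have L2: "2 \<le> L" using assms(3) by (simp add: L_def le_log_iff)
  have Ll: "L = 2 powr l" using L2 by (simp add: l_def)
  have l1: "1 \<le> l" using L2 by (simp add: l_def le_log_iff)
  have sqrtL: "sqrt L = 2 powr (l / 2)"
    using L2 by (simp add: Ll powr_powr flip: powr_half_sqrt)
  \<comment> \<open>An infinite degree would satisfy the claimed inequality.\<close>
  obtain d where d: "prob_poly_degree P = enat d"
    using contra by (cases "prob_poly_degree P") auto
  have lt: "real d < 2 powr (l / 2) / l\<^sup>2"
  proof -
    have "\<not> ereal (sqrt L / l\<^sup>2) \<le> ereal (real d)"
      using contra unfolding d l_def L_def by simp
    then show ?thesis unfolding sqrtL by simp
  qed
  have deg: "mpoly_degree p \<le> d" if "p \<in> set_pmf P" for p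
  proof -
    have "enat (mpoly_degree p) \<le> prob_poly_degree P"
      unfolding prob_poly_degree_def using that by (rule SUP_upper)
    then show ?thesis by (simp add: d)
  qed
  \<comment> \<open>Together with \<open>lt\<close> this forces 2 l^2 < 2^(l/2) and hence l \<ge>
    18, so the numerical estimates are needed only for large n.\<close>
  obtain p where "p \<in> set_pmf P" "2 \<le> mpoly_degree p"
    using degree_ge_2[OF assms(1) _ assms(4)] assms(2,3) by auto
  then have d2: "2 \<le> d" using deg[of p] by simp
  have "2 \<le> real d" using d2 by simp
  then have "2 < 2 powr (l / 2) / l\<^sup>2" using lt by linarith
  then have "2 * l\<^sup>2 < 2 powr (l / 2)" using l1 by (simp add: less_divide_eq split: if_splits)
  then have l18: "18 \<le> l" by (rule loglog_large[OF l1])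
  define t where "t = nat \<lceil>l / 3\<rceil>"
  define D where "D = d * t"
  \<comment> \<open>Chosen so that a hitting set of size at most \<open>rank_bound D * D\<close> is
    met with probability at most 1 / (2D).\<close>
  define \<rho> where "\<rho> = 1 / real (2 * rank_bound D * D\<^sup>2)"
  have D0: "0 < D" using d2 l18 by (simp add: D_def t_def)
  have R0: "0 < rank_bound D" using D0 by (simp add: rank_bound_def depth_def)
  have "(7 / 8) ^ t / 400 \<le> (real D + 1) * ((1 / 8) ^ t + (1 - \<rho> ^ D / 2) ^ card X\<^sub>0)"
  proof (rule degree_tradeoff[OF assms(1,4) deg D_def D0])
    show "0 \<le> \<rho>" by (simp add: \<rho>_def)
    have "\<rho> * real (rank_bound D * D) = 1 / (2 * real D)"
      using D0 R0 by (simp add: \<rho>_def power2_eq_square)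
    then show "\<rho> * real (rank_bound D * D) \<le> 1 / (2 * real D)" by simp
    have "1 \<le> 2 * rank_bound D * D\<^sup>2" using R0 D0 by (simp add: Suc_le_eq)
    then have "1 \<le> real (2 * rank_bound D * D\<^sup>2)" by (metis of_nat_1 of_nat_mono)
    moreover define Y where "Y = real (2 * rank_bound D * D\<^sup>2)"
    ultimately have "1 \<le> Y" by simp
    then show "\<rho> \<le> 1" unfolding \<rho>_def Y_def[symmetric] by simp
  qed
  also have "\<dots> < (7 / 8) ^ t / 400"
    unfolding assms(2) using d2 by (intro no_low_degree[OF Ll n l18 _ lt t_def D_def \<rho>_def]) simp
  finally show False by simp
qed

end
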